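(* Let $\varphi\in L^{2}(\mathbb{H}^{n})$ satisfy condition C. If $G^{\varphi}_{0,0}(\lambda)>0$ for a.e. $\lambda\in(0,1]$, then $\{L_{(2k,l,m)}\varphi:(k,l,m)\in\mathbb{Z}^{2n+1}\}$ is $\ell^{2}$-linearly independent.
   Context: The Heisenberg group $\mathbb{H}^{n}$ is $\mathbb{R}^{n}\times\mathbb{R}^{n}\times\mathbb{R}$ with group law $(x,y,t)(x',y',t')=(x+x',y+y',t+t'+\frac12(x'\cdot y-y'\cdot x))$ and Haar measure $dx\,dy\,dt$. Left translation: $L_{h}\varphi(X)=\varphi(h^{-1}X)$. In $(k,l,m)\in\mathbb{Z}^{2n+1}$, $k,l\in\mathbb{Z}^n$ and $m\in\mathbb{Z}$. For $\lambda\in\mathbb{R}^{\star}=\mathbb{R}\setminus\{0\}$, $\pi_{\lambda}(x,y,t)$ acts on $\phi\in L^{2}(\mathbb{R}^{n})$ by $\pi_{\lambda}(x,y,t)\phi(\xi)=e^{2\pi i\lambda t}e^{2\pi i\lambda(x\cdot\xi+\frac12x\cdot y)}\phi(\xi+y)$. The group Fourier transform is $\widehat{f}(\lambda)=\int_{\mathbb{H}^{n}}f(x,y,t)\pi_{\lambda}(x,y,t)\,dx\,dy\,dt$ for $f\in L^{1}(\mathbb{H}^{n})$, extended to an isometric isomorphism of $L^{2}(\mathbb{H}^{n})$ onto $L^{2}(\mathbb{R}^{\star},\mathcal{B}_{2};|\lambda|^{n}d\lambda)$, where $\mathcal{B}_{2}$ is the space of Hilbert–Schmidt operators on $L^{2}(\mathbb{R}^{n})$.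 For $(k,l)\in\mathbb{Z}^{2n}$ and $\lambda\in(0,1]$, $G^{\varphi}_{k,l}(\lambda)=\sum_{r\in\mathbb{Z}}\langle\widehat{\varphi}(\lambda+r),\widehat{L_{(2k,l,0)}\varphi}(\lambda+r)\rangle_{\mathcal{B}_{2}}|\lambda+r|^{n}$. Condition C: $G^{\varphi}_{k,l}(\lambda)=0$ for a.e. $\lambda\in(0,1]$, for all $(k,l)\in\mathbb{Z}^{2n}\setminus\{(0,0)\}$. A family $\{f_{j}:j\in\mathbb{Z}^{d}\}$ in a Hilbert space $\mathcal{H}$ is $\ell^{2}$-linearly dependent if there is a non-zero sequence $\{c_{j}\}\in\ell^{2}(\mathbb{Z}^{d})$ with $\sum_{j\in\mathbb{Z}^{d}}c_{j}f_{j}=0$; otherwise it is $\ell^{2}$-linearly independent. Convergence of a series over $\mathbb{Z}^{d}$ means norm convergence in $\mathcal{H}$ of the partial sums over $\{j:\max_i|j_i|\le N\}$ as $N\to\infty$. *)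

theory Defs
  imports "HOL-Analysis.Analysis"
begin

section \<open>Square-integrable functions\<close>

text \<open>
  Elements of \<open>L\<^sup>2\<close> are represented by Borel functions, with equality almost everywhere.
  Every Lebesgue measurable function has such a representative.
\<close>

definition L2 :: "('a::euclidean_space \<Rightarrow> complex) set" where
  "L2 = {f \<in> borel_measurable borel. integrable lborel (\<lambda>x. (cmod (f x))\<^sup>2)}"

definition L2_normsq :: "('a::euclidean_space \<Rightarrow> complex) \<Rightarrow> ennreal" where
  "L2_normsq f = (\<integral>\<^sup>+ x. ennreal ((cmod (f x))\<^sup>2) \<partial>lborel)"

definition L2_inner :: "('a::euclidean_space \<Rightarrow> complex) \<Rightarrow> ('a \<Rightarrow> complex) \<Rightarrow> complex" where
  "L2_inner f g = (LINT x|lborel. f x * cnj (g x))"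

definition L2_tendsto ::
    "(nat \<Rightarrow> 'a::euclidean_space \<Rightarrow> complex) \<Rightarrow> ('a \<Rightarrow> complex) \<Rightarrow> bool" where
  "L2_tendsto f g \<longleftrightarrow> (\<lambda>N. L2_normsq (\<lambda>x. f N x - g x)) \<longlonglongrightarrow> 0"


section \<open>Hilbert--Schmidt operators on \<open>L\<^sup>2(\<real>\<^sup>n)\<close>\<close>

type_synonym 'n op = "(real ^ 'n \<Rightarrow> complex) \<Rightarrow> (real ^ 'n \<Rightarrow> complex)"

definition orthonormal_basis :: "(nat \<Rightarrow> real ^ 'n::finite \<Rightarrow> complex) \<Rightarrow> bool" where
  "orthonormal_basis e \<longleftrightarrow>
     (\<forall>i. e i \<in> L2) \<and>
     (\<forall>i j. L2_inner (e i) (e j) = (if i = j then 1 else 0)) \<and>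
     (\<forall>f\<in>L2. (\<forall>i. L2_inner f (e i) = 0) \<longrightarrow> (AE x in lborel. f x = 0))"

text \<open>
  The Hilbert--Schmidt norm and inner product do not depend on the orthonormal basis, so
  one basis is fixed.  It can be indexed by \<open>nat\<close> because \<open>L\<^sup>2(\<real>\<^sup>n)\<close> is separable and
  infinite-dimensional (\<open>n \<ge> 1\<close> for the index type \<open>'n\<close>).
\<close>

definition L2_basis :: "nat \<Rightarrow> real ^ 'n::finite \<Rightarrow> complex" where
  "L2_basis = (SOME e. orthonormal_basis e)"

definition bounded_operator :: "'n::finite op \<Rightarrow> bool" where
  "bounded_operator T \<longleftrightarrow>
     (\<forall>u\<in>L2. T u \<in> L2) \<and>
     (\<forall>u\<in>L2. \<forall>v\<in>L2. \<forall>a b. AE x in lborel.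
        T (\<lambda>y. a * u y + b * v y) x = a * T u x + b * T v x) \<and>
     (\<exists>C::real. \<forall>u\<in>L2. L2_normsq (T u) \<le> ennreal C * L2_normsq u)"

definition HS_normsq :: "'n::finite op \<Rightarrow> ennreal" where
  "HS_normsq T = (\<Sum>i. L2_normsq (T (L2_basis i)))"

definition HS :: "'n::finite op set" where
  "HS = {T. bounded_operator T \<and> HS_normsq T < \<infinity>}"

definition HS_inner :: "'n::finite op \<Rightarrow> 'n op \<Rightarrow> complex" where
  "HS_inner S T = (\<Sum>\<^sub>\<infinity>i. L2_inner (S (L2_basis i)) (T (L2_basis i)))"


section \<open>The Heisenberg group\<close>

type_synonym 'n heis = "(real ^ 'n) \<times> (real ^ 'n) \<times> real"

definition heis_mult :: "'n::finite heis \<Rightarrow> 'n heis \<Rightarrow> 'n heis" where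
  "heis_mult = (\<lambda>(x, y, t) (x', y', t').
     (x + x', y + y', t + t' + (x' \<bullet> y - y' \<bullet> x) / 2))"

definition heis_inv :: "'n::finite heis \<Rightarrow> 'n heis" where
  "heis_inv = (\<lambda>(x, y, t). (- x, - y, - t))"

lemma heis_inv_mult: "heis_mult (heis_inv h) h = (0, 0, 0)"
  and heis_mult_inv: "heis_mult h (heis_inv h) = (0, 0, 0)"
  by (auto simp: heis_mult_def heis_inv_def inner_commute split: prod.splits)

definition left_transl :: "'n::finite heis \<Rightarrow> ('n heis \<Rightarrow> complex) \<Rightarrow> 'n heis \<Rightarrow> complex" where
  "left_transl h f X = f (heis_mult (heis_inv h) X)"


section \<open>The group Fourier transform\<close>

definition schroedinger :: "real \<Rightarrow> 'n::finite heis \<Rightarrow> 'n op" where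
  "schroedinger lam = (\<lambda>(x, y, t) u \<xi>.
     cis (2 * pi * lam * t) * cis (2 * pi * lam * (x \<bullet> \<xi> + (x \<bullet> y) / 2)) * u (\<xi> + y))"

text \<open>
  For integrable \<open>f\<close> and \<open>u \<in> L2\<close> the integral converges absolutely for almost every \<open>\<xi>\<close>,
  and it represents the operator-valued integral of \<open>f(X) \<pi>\<^sub>\<lambda>(X)\<close> applied to \<open>u\<close>.
\<close>

definition fourier_L1 :: "('n::finite heis \<Rightarrow> complex) \<Rightarrow> real \<Rightarrow> 'n op" where
  "fourier_L1 f lam u \<xi> = (LINT X|lborel. f X * schroedinger lam X u \<xi>)"

definition plancherel_measure :: "'n::finite itself \<Rightarrow> real measure" where
  "plancherel_measure _ = density lborel (\<lambda>lam. ennreal (\<bar>lam\<bar> ^ CARD('n)))"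

definition field_normsq :: "(real \<Rightarrow> 'n::finite op) \<Rightarrow> ennreal" where
  "field_normsq F = (\<integral>\<^sup>+ lam. HS_normsq (F lam) \<partial>plancherel_measure TYPE('n))"

text \<open>
  The space \<open>L\<^sup>2(\<real>\<^sup>\<star>, \<B>\<^sub>2; |\<lambda>|\<^sup>n d\<lambda>)\<close>.  Since \<open>\<B>\<^sub>2\<close> is separable, weak measurability of the
  field is the same as strong measurability; the point \<open>0\<close> is a null set.
\<close>

definition L2_fields :: "(real \<Rightarrow> 'n::finite op) set" where
  "L2_fields = {F.
     (AE lam in lborel. F lam \<in> HS) \<and>
     (\<forall>u\<in>L2. \<forall>v\<in>L2. (\<lambda>lam. L2_inner (F lam u) v) \<in> borel_measurable borel) \<and>
     field_normsq F < \<infinity>}"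

text \<open>
  Extension by continuity from \<open>L\<^sup>1 \<inter> L\<^sup>2\<close>: \<open>F\<close> is the transform of \<open>f\<close> if some sequence in
  \<open>L\<^sup>1 \<inter> L\<^sup>2\<close> converges to \<open>f\<close> while its transforms converge to \<open>F\<close>.  By the Plancherel
  theorem such an \<open>F\<close> exists for each \<open>f \<in> L2\<close>, and any two of them agree as operators
  on \<open>L\<^sup>2(\<real>\<^sup>n)\<close> for almost every parameter.
\<close>

definition is_fourier :: "('n::finite heis \<Rightarrow> complex) \<Rightarrow> (real \<Rightarrow> 'n op) \<Rightarrow> bool" where
  "is_fourier f F \<longleftrightarrow> F \<in> L2_fields \<and>
     (\<exists>g. (\<forall>j. g j \<in> L2 \<and> integrable lborel (g j)) \<and> L2_tendsto g f \<and>
          (\<lambda>j. field_normsq (\<lambda>lam u \<xi>. fourier_L1 (g j) lam u \<xi> - F lam u \<xi>)) \<longlonglongrightarrow> 0)"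

definition fourier :: "('n::finite heis \<Rightarrow> complex) \<Rightarrow> real \<Rightarrow> 'n op" where
  "fourier f = (SOME F. is_fourier f F)"


section \<open>The functions \<open>G\<close> and condition C\<close>

definition lattice_vec :: "int ^ 'n \<Rightarrow> real ^ 'n::finite" where
  "lattice_vec k = (\<chi> i. real_of_int (k $ i))"

text \<open>
  For \<open>\<phi> \<in> L2\<close> the series below converges absolutely for almost every parameter (where it
  does not, \<open>infsum\<close> is \<open>0\<close>).  Altering \<^term>\<open>fourier \<phi>\<close> on a null set changes it on a null
  set only.
\<close>

definition G :: "('n::finite heis \<Rightarrow> complex) \<Rightarrow> int ^ 'n \<Rightarrow> int ^ 'n \<Rightarrow> real \<Rightarrow> complex" where
  "G \<phi> k l lam = (\<Sum>\<^sub>\<infinity>r::int.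
     HS_inner (fourier \<phi> (lam + of_int r))
              (fourier (left_transl (2 *\<^sub>R lattice_vec k, lattice_vec l, 0) \<phi>) (lam + of_int r))
     * of_real (\<bar>lam + of_int r\<bar> ^ CARD('n)))"

definition condition_C :: "('n::finite heis \<Rightarrow> complex) \<Rightarrow> bool" where
  "condition_C \<phi> \<longleftrightarrow> (\<forall>k l. (k, l) \<noteq> (0, 0) \<longrightarrow>
     (AE lam in lborel. lam \<in> {0<..1} \<longrightarrow> G \<phi> k l lam = 0))"


section \<open>\<open>\<ell>\<^sup>2\<close>-linear independence\<close>

text \<open>Families in \<open>L2\<close> indexed by \<open>\<int>\<^sup>2\<^sup>n\<^sup>+\<^sup>1\<close>, written as triples; series are summed over cubes.\<close>

type_synonym 'n lattice = "(int ^ 'n) \<times> (int ^ 'n) \<times> int"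

definition cube :: "nat \<Rightarrow> 'n::finite lattice set" where
  "cube N = {(k, l, m). (\<forall>i. \<bar>k $ i\<bar> \<le> int N) \<and> (\<forall>i. \<bar>l $ i\<bar> \<le> int N) \<and> \<bar>m\<bar> \<le> int N}"

definition l2_linearly_dependent ::
    "('n::finite lattice \<Rightarrow> 'a::euclidean_space \<Rightarrow> complex) \<Rightarrow> bool" where
  "l2_linearly_dependent f \<longleftrightarrow>
     (\<exists>c. (\<exists>j. c j \<noteq> 0) \<and> (\<lambda>j. (cmod (c j))\<^sup>2) summable_on UNIV \<and>
          L2_tendsto (\<lambda>N x. \<Sum>j\<in>cube N. c j * f j x) (\<lambda>x. 0))"

definition l2_linearly_independent ::
    "('n::finite lattice \<Rightarrow> 'a::euclidean_space \<Rightarrow> complex) \<Rightarrow> bool" where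
  "l2_linearly_independent f \<longleftrightarrow> \<not> l2_linearly_dependent f"

lemma finite_cube: "finite (cube N :: 'n::finite lattice set)"
proof -
  let ?V = "{k :: int ^ 'n. \<forall>i. k $ i \<in> {- int N..int N}}"
  have "finite ?V"
    by (rule finite_subset[OF _ finite_imageI[OF finite_PiE[of UNIV "\<lambda>_. {- int N..int N}"], of "\<lambda>f. \<chi> i. f i"]])
       (auto simp: image_iff intro!: bexI[of _ "($) _"] )
  then have "finite (?V \<times> ?V \<times> {- int N..int N})" by simp
  then show ?thesis
    by (rule finite_subset[rotated]) (auto simp: cube_def abs_le_iff minus_le_iff)
qed

end

theory Submission
  imports Defs "HOL-Probability.Characteristic_Functions"
begin

text \<open>
  The translates by \<open>(2k, l, m)\<close> form the orbit of \<open>\<phi>\<close> under a discrete group of isometries, so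
  their inner products are determined by those of \<open>\<phi>\<close> itself with its translates.  A central
  translation by \<open>m\<close> multiplies the group Fourier transform by \<open>exp (2\<pi>\<i> \<lambda> m)\<close>, which has period
  \<open>1\<close> in \<open>\<lambda>\<close>.  By the Plancherel theorem, and by folding the line onto the interval \<open>(0, 1]\<close>, the
  inner products of \<open>\<phi>\<close> with the translates by \<open>(2k, l, m)\<close> are, for fixed \<open>(k, l)\<close>, the Fourier
  coefficients of \<open>G \<phi> k l\<close> (\<open>ip_translate_eq_Fourier_coeff\<close>).

  Condition C therefore says that translates with different pairs \<open>(k, l)\<close> are orthogonal.  If a
  combination with coefficients \<open>c\<close> tends to \<open>0\<close>, so does its part for each single pair.  That part
  has the norm of the trigonometric polynomial with coefficients \<open>c (k, l, m)\<close>, \<open>|m| \<le> N\<close>, in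
  \<open>L\<^sup>2\<close> of \<open>(0, 1]\<close> with the weight \<open>G \<phi> 0 0\<close>.  Without the weight the polynomials converge to a
  function \<open>h\<close> whose Fourier coefficients are these \<open>c\<close>.  The weighted norm of \<open>h\<close> is \<open>0\<close> and the
  weight is positive, hence \<open>h = 0\<close> and \<open>c = 0\<close> (\<open>weighted_trig_series_zero\<close>).

  The Plancherel theorem on the Heisenberg group is reduced to the Euclidean one.  The transform
  of an integrable \<open>f\<close> at \<open>\<lambda>\<close> is an integral operator whose kernel is the Euclidean transform of
  \<open>f (\<cdot>, y, \<cdot>)\<close> at \<open>(\<lambda> (\<xi> + \<eta>) / 2, \<lambda>)\<close> with \<open>y = \<eta> - \<xi>\<close>, and the Hilbert--Schmidt norm of an
  integral operator is the norm of its kernel (\<open>heis_kernel_Plancherel\<close>).  The extension to all of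
  \<open>L\<^sup>2\<close> rests on completeness, applied to the kernels (\<open>is_fourier_exists\<close>), and the identity for
  inner products on polarization (\<open>is_fourier_ip\<close>).  The Euclidean theorem follows from Gaussian
  summation, where the continuity of translation in \<open>L\<^sup>2\<close> enters (\<open>Plancherel_euclidean\<close>).
\<close>

section \<open>Square-integrable functions on a measure space\<close>

definition normsq :: "'a measure \<Rightarrow> ('a \<Rightarrow> complex) \<Rightarrow> ennreal" where
  "normsq M f = (\<integral>\<^sup>+ x. ennreal ((cmod (f x))\<^sup>2) \<partial>M)"

definition sqint :: "'a measure \<Rightarrow> ('a \<Rightarrow> complex) set" where
  "sqint M = {f \<in> borel_measurable M. normsq M f < \<infinity>}"

definition ip :: "'a measure \<Rightarrow> ('a \<Rightarrow> complex) \<Rightarrow> ('a \<Rightarrow> complex) \<Rightarrow> complex" where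
  "ip M f g = (LINT x|M. f x * cnj (g x))"

lemma borel_measurable_cnj [measurable (raw)]:
  "f \<in> borel_measurable M \<Longrightarrow> (\<lambda>x. cnj (f x)) \<in> borel_measurable M"
  by (rule borel_measurable_continuous_on[where f=cnj]) (auto intro: continuous_intros)

lemma L2_eq_sqint: "L2 = sqint lborel"
  by (auto simp: L2_def sqint_def normsq_def integrable_iff_bounded)

lemma L2_normsq_eq: "L2_normsq = normsq lborel"
  by (simp add: fun_eq_iff L2_normsq_def normsq_def)

lemma L2_inner_eq: "L2_inner = ip lborel"
  by (simp add: fun_eq_iff L2_inner_def ip_def)

lemma sqintD: "f \<in> sqint M \<Longrightarrow> f \<in> borel_measurable M" "f \<in> sqint M \<Longrightarrow> normsq M f < \<infinity>"
  by (auto simp: sqint_def)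

lemma sqintI: "f \<in> borel_measurable M \<Longrightarrow> normsq M f < \<infinity> \<Longrightarrow> f \<in> sqint M"
  by (auto simp: sqint_def)

lemma sqint_integrable: "f \<in> sqint M \<Longrightarrow> integrable M (\<lambda>x. (cmod (f x))\<^sup>2)"
  by (auto simp: sqint_def normsq_def integrable_iff_bounded)

lemma normsq_cong_AE: "AE x in M. cmod (f x) = cmod (g x) \<Longrightarrow> normsq M f = normsq M g"
  unfolding normsq_def by (rule nn_integral_cong_AE) auto

lemma normsq_eq_AE: "AE x in M. f x = g x \<Longrightarrow> normsq M f = normsq M g"
  by (rule normsq_cong_AE) (auto elim: eventually_mono)

lemma ip_cong_AE:
  assumes "f \<in> borel_measurable M" "f' \<in> borel_measurable M" "g \<in> borel_measurable M" "g' \<in> borel_measurable M"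
    "AE x in M. f x = f' x" "AE x in M. g x = g' x"
  shows "ip M f g = ip M f' g'"
  unfolding ip_def using assms by (intro integral_cong_AE) auto

lemma cmod_add_sq_le: "(cmod (a + b))\<^sup>2 \<le> 2 * (cmod a)\<^sup>2 + 2 * (cmod b)\<^sup>2"
proof -
  have "(cmod (a + b))\<^sup>2 \<le> (cmod a + cmod b)\<^sup>2"
    by (intro power_mono norm_triangle_ineq) auto
  also have "\<dots> \<le> 2 * (cmod a)\<^sup>2 + 2 * (cmod b)\<^sup>2"
    using sum_squares_bound[of "cmod a" "cmod b"] by (simp add: power2_sum)
  finally show ?thesis .
qed

lemma normsq_add_le:
  assumes [measurable]: "f \<in> borel_measurable M" "g \<in> borel_measurable M"
  shows "normsq M (\<lambda>x. f x + g x) \<le> 2 * normsq M f + 2 * normsq M g"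
proof -
  have "normsq M (\<lambda>x. f x + g x) \<le> (\<integral>\<^sup>+ x. 2 * ennreal ((cmod (f x))\<^sup>2) + 2 * ennreal ((cmod (g x))\<^sup>2) \<partial>M)"
    unfolding normsq_def
  proof (intro nn_integral_mono)
    fix x
    have "ennreal ((cmod (f x + g x))\<^sup>2) \<le> ennreal (2 * (cmod (f x))\<^sup>2 + 2 * (cmod (g x))\<^sup>2)"
      by (intro ennreal_leI cmod_add_sq_le)
    then show "ennreal ((cmod (f x + g x))\<^sup>2) \<le> 2 * ennreal ((cmod (f x))\<^sup>2) + 2 * ennreal ((cmod (g x))\<^sup>2)"
      by (simp add: ennreal_mult)
  qed
  then show ?thesis
    by (simp add: normsq_def nn_integral_add nn_integral_cmult)
qed

lemma normsq_scale:
  assumes [measurable]: "f \<in> borel_measurable M"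
  shows "normsq M (\<lambda>x. c * f x) = ennreal ((cmod c)\<^sup>2) * normsq M f"
  by (simp add: normsq_def norm_mult power_mult_distrib ennreal_mult nn_integral_cmult)

lemma normsq_minus_commute: "normsq M (\<lambda>x. f x - g x) = normsq M (\<lambda>x. g x - f x)"
  by (simp add: normsq_def norm_minus_commute)

lemma sqint_zero: "(\<lambda>x. 0) \<in> sqint M"
  by (simp add: sqint_def normsq_def)

lemma sqint_scale: "f \<in> sqint M \<Longrightarrow> (\<lambda>x. c * f x) \<in> sqint M"
  by (auto simp: sqint_def normsq_scale ennreal_mult_less_top)

lemma sqint_add: "f \<in> sqint M \<Longrightarrow> g \<in> sqint M \<Longrightarrow> (\<lambda>x. f x + g x) \<in> sqint M"
  using normsq_add_le[of f M g]
  by (auto simp: sqint_def ennreal_mult_less_top intro: le_less_trans)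

lemma sqint_diff: "f \<in> sqint M \<Longrightarrow> g \<in> sqint M \<Longrightarrow> (\<lambda>x. f x - g x) \<in> sqint M"
  using sqint_add[of f M "\<lambda>x. (-1) * g x"] sqint_scale[of g M "-1"] by simp

lemma sqint_sum: "(\<And>i. i \<in> I \<Longrightarrow> f i \<in> sqint M) \<Longrightarrow> (\<lambda>x. \<Sum>i\<in>I. f i x) \<in> sqint M"
  by (induct I rule: infinite_finite_induct) (auto simp: sqint_zero sqint_add)

lemma sqint_cnj: "f \<in> sqint M \<Longrightarrow> (\<lambda>x. cnj (f x)) \<in> sqint M"
  by (auto simp: sqint_def normsq_def)

lemma normsq_diff_triangle:
  assumes "f \<in> borel_measurable M" "g \<in> borel_measurable M" "h \<in> borel_measurable M"
  shows "normsq M (\<lambda>x. f x - h x) \<le> 2 * normsq M (\<lambda>x. f x - g x) + 2 * normsq M (\<lambda>x. g x - h x)"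
  using normsq_add_le[of "\<lambda>x. f x - g x" M "\<lambda>x. g x - h x"] assms by simp

lemma sqint_mult_integrable:
  assumes f: "f \<in> sqint M" and g: "g \<in> sqint M"
  shows "integrable M (\<lambda>x. f x * cnj (g x))"
proof (rule Bochner_Integration.integrable_bound)
  show "integrable M (\<lambda>x. (cmod (f x))\<^sup>2 + (cmod (g x))\<^sup>2)"
    using f g by (intro Bochner_Integration.integrable_add sqint_integrable)
  show "(\<lambda>x. f x * cnj (g x)) \<in> borel_measurable M"
    using sqintD(1)[OF f] sqintD(1)[OF g] by measurable
  have "a * b \<le> a\<^sup>2 + b\<^sup>2" if "a \<ge> 0" "b \<ge> 0" for a b :: real
    using sum_squares_bound[of a b] mult_nonneg_nonneg[OF that] by linarith
  then show "AE x in M. norm (f x * cnj (g x)) \<le> norm ((cmod (f x))\<^sup>2 + (cmod (g x))\<^sup>2)"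
    by (auto simp: norm_mult)
qed

lemma normsq_eq_ip:
  assumes "f \<in> sqint M"
  shows "ip M f f = of_real (enn2real (normsq M f))" "normsq M f = ennreal (Re (ip M f f))"
proof -
  have "ip M f f = (LINT x|M. complex_of_real ((cmod (f x))\<^sup>2))"
    unfolding ip_def by (intro Bochner_Integration.integral_cong) (auto simp: complex_norm_square simp del: of_real_power)
  also have "\<dots> = of_real (LINT x|M. (cmod (f x))\<^sup>2)"
    by (simp only: integral_complex_of_real)
  finally have *: "ip M f f = of_real (LINT x|M. (cmod (f x))\<^sup>2)" .
  have **: "normsq M f = ennreal (LINT x|M. (cmod (f x))\<^sup>2)"
    unfolding normsq_def by (intro nn_integral_eq_integral sqint_integrable assms) auto
  show "ip M f f = of_real (enn2real (normsq M f))" "normsq M f = ennreal (Re (ip M f f))"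
    using * ** by simp_all
qed

lemma Re_ip_self_nonneg: "0 \<le> Re (ip M f f)"
proof -
  have "ip M f f = (LINT x|M. complex_of_real ((cmod (f x))\<^sup>2))"
    unfolding ip_def by (intro Bochner_Integration.integral_cong) (auto simp: complex_norm_square simp del: of_real_power)
  also have "\<dots> = of_real (LINT x|M. (cmod (f x))\<^sup>2)"
    by (simp only: integral_complex_of_real)
  finally show ?thesis by simp
qed

lemma ip_add_left: "f \<in> sqint M \<Longrightarrow> g \<in> sqint M \<Longrightarrow> h \<in> sqint M \<Longrightarrow>
    ip M (\<lambda>x. f x + g x) h = ip M f h + ip M g h"
  unfolding ip_def
  by (simp add: ring_distribs sqint_mult_integrable)

lemma ip_scale_left: "ip M (\<lambda>x. c * f x) g = c * ip M f g"
  unfolding ip_def by (simp add: mult.assoc)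

lemma ip_commute: "ip M f g = cnj (ip M g f)"
  unfolding ip_def by (subst Bochner_Integration.integral_cnj[symmetric]) (simp add: mult.commute)

lemma ip_add_right: "f \<in> sqint M \<Longrightarrow> g \<in> sqint M \<Longrightarrow> h \<in> sqint M \<Longrightarrow>
    ip M h (\<lambda>x. f x + g x) = ip M h f + ip M h g"
  by (subst (1 2 3) ip_commute) (simp add: ip_add_left)

lemma ip_scale_right: "ip M f (\<lambda>x. c * g x) = cnj c * ip M f g"
  by (subst (1 2) ip_commute) (simp add: ip_scale_left)

lemma ip_diff_left: "f \<in> sqint M \<Longrightarrow> g \<in> sqint M \<Longrightarrow> h \<in> sqint M \<Longrightarrow>
    ip M (\<lambda>x. f x - g x) h = ip M f h - ip M g h"
  using ip_add_left[of f M "\<lambda>x. (-1) * g x" h] sqint_scale[of g M "-1"] ip_scale_left[of M "-1" g h]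
  by simp

lemma ip_zero [simp]: "ip M (\<lambda>x. 0) g = 0" "ip M g (\<lambda>x. 0) = 0"
  by (simp_all add: ip_def)

lemma ip_sum_left: "(\<And>i. i \<in> I \<Longrightarrow> f i \<in> sqint M) \<Longrightarrow> g \<in> sqint M \<Longrightarrow>
    ip M (\<lambda>x. \<Sum>i\<in>I. f i x) g = (\<Sum>i\<in>I. ip M (f i) g)"
  by (induct I rule: infinite_finite_induct) (auto simp: ip_add_left sqint_sum)

lemma ip_sum_right: "(\<And>i. i \<in> I \<Longrightarrow> f i \<in> sqint M) \<Longrightarrow> g \<in> sqint M \<Longrightarrow>
    ip M g (\<lambda>x. \<Sum>i\<in>I. f i x) = (\<Sum>i\<in>I. ip M g (f i))"
  by (induct I rule: infinite_finite_induct) (auto simp: ip_add_right sqint_sum)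

lemma ip_Cauchy_Schwarz:
  assumes f: "f \<in> sqint M" and g: "g \<in> sqint M"
  shows "ennreal ((cmod (ip M f g))\<^sup>2) \<le> normsq M f * normsq M g"
proof -
  have [measurable]: "f \<in> borel_measurable M" "g \<in> borel_measurable M"
    using f g by (auto dest: sqintD)
  have "ennreal (cmod (ip M f g)) \<le> (\<integral>\<^sup>+ x. ennreal (norm (f x * cnj (g x))) \<partial>M)"
    unfolding ip_def by (rule integral_norm_bound_ennreal) (rule sqint_mult_integrable[OF f g])
  also have "\<dots> = (\<integral>\<^sup>+ x. ennreal (cmod (f x)) * ennreal (cmod (g x)) \<partial>M)"
    by (simp add: norm_mult ennreal_mult)
  finally have "(ennreal (cmod (ip M f g)))\<^sup>2 \<le> (\<integral>\<^sup>+ x. ennreal (cmod (f x)) * ennreal (cmod (g x)) \<partial>M)\<^sup>2"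
    by (intro power_mono) auto
  also have "\<dots> \<le> (\<integral>\<^sup>+ x. (ennreal (cmod (f x)))\<^sup>2 \<partial>M) * (\<integral>\<^sup>+ x. (ennreal (cmod (g x)))\<^sup>2 \<partial>M)"
    by (rule Cauchy_Schwarz_nn_integral) measurable
  finally show ?thesis
    by (simp add: normsq_def ennreal_power)
qed

lemma normsq_zero_iff:
  assumes [measurable]: "f \<in> borel_measurable M"
  shows "normsq M f = 0 \<longleftrightarrow> (AE x in M. f x = 0)"
  unfolding normsq_def by (subst nn_integral_0_iff_AE) auto

lemma normsq_add_expand:
  assumes "f \<in> sqint M" "g \<in> sqint M"
  shows "Re (ip M (\<lambda>x. f x + c * g x) (\<lambda>x. f x + c * g x)) =
    Re (ip M f f) + 2 * Re (cnj c * ip M f g) + (cmod c)\<^sup>2 * Re (ip M g g)"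
proof -
  have [simp]: "(\<lambda>x. c * g x) \<in> sqint M" by (rule sqint_scale) fact
  have "ip M (\<lambda>x. f x + c * g x) (\<lambda>x. f x + c * g x) =
      ip M f f + cnj c * ip M f g + (c * cnj (ip M f g) + (c * cnj c) * ip M g g)"
    using assms
    by (simp add: ip_add_left ip_add_right sqint_add ip_scale_left ip_scale_right ring_distribs ip_commute[of M g f])
  also have "c * cnj c = of_real ((cmod c)\<^sup>2)"
    by (rule complex_norm_square[symmetric])
  finally show ?thesis by (simp add: algebra_simps)
qed

text \<open>Parseval's identity for a transform is first proved, and extended to limits, for norms;
  this lemma turns it into an identity of inner products.\<close>

lemma polarization:
  assumes f: "f \<in> sqint M" and g: "g \<in> sqint M" and a: "a \<in> sqint N" and b: "b \<in> sqint N"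
    and eq: "\<And>c. normsq N (\<lambda>x. a x + c * b x) = normsq M (\<lambda>x. f x + c * g x)"
  shows "ip N a b = ip M f g"
proof -
  have *: "Re (ip N (\<lambda>x. a x + c * b x) (\<lambda>x. a x + c * b x)) = Re (ip M (\<lambda>x. f x + c * g x) (\<lambda>x. f x + c * g x))" for c
  proof -
    have "ennreal (Re (ip N (\<lambda>x. a x + c * b x) (\<lambda>x. a x + c * b x))) = ennreal (Re (ip M (\<lambda>x. f x + c * g x) (\<lambda>x. f x + c * g x)))"
      using eq[of c] f g a b by (simp add: sqint_add sqint_scale flip: normsq_eq_ip(2))
    then show ?thesis by (simp add: Re_ip_self_nonneg)
  qed
  note E = *[unfolded normsq_add_expand[OF f g] normsq_add_expand[OF a b]]
  from E[of 0] E[of 1] E[of "-1"] have "Re (ip N a b) = Re (ip M f g)" by simp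
  moreover from E[of 0] E[of \<i>] E[of "-\<i>"] have "Im (ip N a b) = Im (ip M f g)" by simp
  ultimately show ?thesis by (simp add: complex_eq_iff)
qed

subsection \<open>Convergence and completeness\<close>

definition sq_tendsto :: "'a measure \<Rightarrow> (nat \<Rightarrow> 'a \<Rightarrow> complex) \<Rightarrow> ('a \<Rightarrow> complex) \<Rightarrow> bool" where
  "sq_tendsto M f g \<longleftrightarrow> (\<lambda>j. normsq M (\<lambda>x. f j x - g x)) \<longlonglongrightarrow> 0"

lemma L2_tendsto_eq: "L2_tendsto = sq_tendsto lborel"
  by (simp add: fun_eq_iff L2_tendsto_def sq_tendsto_def L2_normsq_eq)

lemma ennreal_tendsto_0I:
  fixes f :: "'b \<Rightarrow> ennreal"
  assumes "\<And>d::real. d > 0 \<Longrightarrow> eventually (\<lambda>j. f j \<le> ennreal d) F"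
  shows "(f \<longlongrightarrow> 0) F"
proof (rule order_tendstoI)
  fix a :: ennreal assume "0 < a"
  then obtain e where e: "0 < e" "e < a" using dense by blast
  then have "e < top" using order.strict_trans2[OF e(2)] by simp
  then have e': "e = ennreal (enn2real e)" "0 < enn2real e"
    using e(1) by (auto simp: enn2real_positive_iff)
  from assms[OF e'(2)] show "eventually (\<lambda>j. f j < a) F"
    by eventually_elim (use e e'(1) in auto)
qed auto

lemma ennreal_tendsto_0_bound:
  fixes f g :: "nat \<Rightarrow> ennreal"
  assumes "g \<longlonglongrightarrow> 0" "\<And>j. f j \<le> g j"
  shows "f \<longlonglongrightarrow> 0"
  by (rule tendsto_sandwich[of "\<lambda>_. 0" f sequentially g 0]) (use assms in auto)

lemma ennreal_tendsto_0_cmult: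
  fixes f :: "'b \<Rightarrow> ennreal"
  assumes "(f \<longlongrightarrow> 0) F" "c < top"
  shows "((\<lambda>j. c * f j) \<longlongrightarrow> 0) F"
  using ennreal_tendsto_cmult[OF assms(2,1)] by simp

lemma sq_tendsto_add:
  assumes "sq_tendsto M f a" "sq_tendsto M g b"
    and m: "\<And>j. f j \<in> borel_measurable M" "\<And>j. g j \<in> borel_measurable M" "a \<in> borel_measurable M" "b \<in> borel_measurable M"
  shows "sq_tendsto M (\<lambda>j x. f j x + g j x) (\<lambda>x. a x + b x)"
  unfolding sq_tendsto_def
proof (rule ennreal_tendsto_0_bound)
  show "(\<lambda>j. 2 * normsq M (\<lambda>x. f j x - a x) + 2 * normsq M (\<lambda>x. g j x - b x)) \<longlonglongrightarrow> 0"
    using tendsto_add[OF ennreal_tendsto_0_cmult ennreal_tendsto_0_cmult, OF assms(1)[unfolded sq_tendsto_def] _ assms(2)[unfolded sq_tendsto_def], of 2 2]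
    by simp
  show "normsq M (\<lambda>x. f j x + g j x - (a x + b x)) \<le> 2 * normsq M (\<lambda>x. f j x - a x) + 2 * normsq M (\<lambda>x. g j x - b x)" for j
    using normsq_add_le[of "\<lambda>x. f j x - a x" M "\<lambda>x. g j x - b x"] m by (simp add: algebra_simps)
qed

lemma sq_tendsto_scale:
  assumes "sq_tendsto M f a" "\<And>j. f j \<in> borel_measurable M" "a \<in> borel_measurable M"
  shows "sq_tendsto M (\<lambda>j x. c * f j x) (\<lambda>x. c * a x)"
  using ennreal_tendsto_0_cmult[OF assms(1)[unfolded sq_tendsto_def], of "ennreal ((cmod c)\<^sup>2)"] assms(2,3)
  by (simp add: sq_tendsto_def normsq_scale flip: right_diff_distrib)

lemma ip_tendsto_left:
  assumes "sq_tendsto M f a" "\<And>j. f j \<in> sqint M" "a \<in> sqint M" and g: "g \<in> sqint M"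
  shows "(\<lambda>j. ip M (f j) g) \<longlonglongrightarrow> ip M a g"
proof -
  have "(\<lambda>j. normsq M (\<lambda>x. f j x - a x) * normsq M g) \<longlonglongrightarrow> 0"
    using ennreal_tendsto_0_cmult[OF assms(1)[unfolded sq_tendsto_def], of "normsq M g"] sqintD(2)[OF g]
    by (simp add: mult.commute)
  then have "(\<lambda>j. ennreal ((cmod (ip M (\<lambda>x. f j x - a x) g))\<^sup>2)) \<longlonglongrightarrow> 0"
    by (rule ennreal_tendsto_0_bound) (intro ip_Cauchy_Schwarz sqint_diff assms)
  then have "(\<lambda>j. (cmod (ip M (\<lambda>x. f j x - a x) g))\<^sup>2) \<longlonglongrightarrow> 0"
    by (subst (asm) ennreal_0[symmetric], subst (asm) tendsto_ennreal_iff) auto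
  then have "(\<lambda>j. ip M (\<lambda>x. f j x - a x) g) \<longlonglongrightarrow> 0"
    by (rule_tac tendsto_norm_zero_cancel) (drule tendsto_real_sqrt, simp)
  then show ?thesis
    using assms by (simp add: ip_diff_left LIM_zero_iff)
qed

lemma normsq_tendsto:
  assumes "sq_tendsto M f a" "\<And>j. f j \<in> sqint M" "a \<in> sqint M"
  shows "(\<lambda>j. normsq M (f j)) \<longlonglongrightarrow> normsq M a"
proof -
  have 1: "(\<lambda>j. ip M (f j) a) \<longlonglongrightarrow> ip M a a"
    by (rule ip_tendsto_left) fact+
  define d where "d j x = f j x - a x" for j x
  have d: "d j \<in> sqint M" for j unfolding d_def[abs_def] by (intro sqint_diff assms)
  have "(\<lambda>j. ennreal (Re (ip M (d j) (d j)))) \<longlonglongrightarrow> 0"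
    using assms(1) unfolding sq_tendsto_def by (simp add: d flip: normsq_eq_ip(2)) (simp add: d_def[abs_def])
  then have 2: "(\<lambda>j. Re (ip M (d j) (d j))) \<longlonglongrightarrow> 0"
    by (subst (asm) ennreal_0[symmetric], subst (asm) tendsto_ennreal_iff) (auto simp: Re_ip_self_nonneg)
  have "Re (ip M (f j) (f j)) = 2 * Re (ip M (f j) a) - Re (ip M a a) + Re (ip M (d j) (d j))" for j
    unfolding d_def[abs_def] using normsq_add_expand[OF assms(2,3), of j "-1"] by simp
  then have "(\<lambda>j. Re (ip M (f j) (f j))) \<longlonglongrightarrow> 2 * Re (ip M a a) - Re (ip M a a) + 0"
    by (simp only:) (intro tendsto_intros 1 2)
  then have "(\<lambda>j. Re (ip M (f j) (f j))) \<longlonglongrightarrow> Re (ip M a a)" by simp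
  then show ?thesis
    using assms by (simp add: normsq_eq_ip(2) tendsto_ennrealI)
qed

lemma normsq_liminf_le:
  assumes m: "\<And>k. h k \<in> borel_measurable M" and lim: "AE x in M. (\<lambda>k. h k x) \<longlonglongrightarrow> g x"
  shows "normsq M g \<le> liminf (\<lambda>k. normsq M (h k))"
proof -
  have "normsq M g = (\<integral>\<^sup>+ x. liminf (\<lambda>k. ennreal ((cmod (h k x))\<^sup>2)) \<partial>M)"
    unfolding normsq_def
  proof (rule nn_integral_cong_AE, use lim in eventually_elim)
    fix x assume "(\<lambda>k. h k x) \<longlonglongrightarrow> g x"
    then have "(\<lambda>k. ennreal ((cmod (h k x))\<^sup>2)) \<longlonglongrightarrow> ennreal ((cmod (g x))\<^sup>2)"
      by (intro tendsto_intros tendsto_ennrealI)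
    then show "ennreal ((cmod (g x))\<^sup>2) = liminf (\<lambda>k. ennreal ((cmod (h k x))\<^sup>2))"
      using lim_imp_Liminf by (metis trivial_limit_sequentially)
  qed
  also have "\<dots> \<le> liminf (\<lambda>k. normsq M (h k))"
    unfolding normsq_def by (rule nn_integral_liminf) (use m in measurable)
  finally show ?thesis .
qed

text \<open>Riesz--Fischer.  Along a subsequence with \<open>\<parallel>\<Delta>\<^sub>k\<parallel>\<^sup>2 \<le> 4\<^sup>-\<^sup>k\<close> the sum of
  \<open>2\<^sup>k |\<Delta>\<^sub>k|\<^sup>2\<close> is integrable, and \<open>|\<Delta>\<^sub>k| \<le> 2\<^sup>-\<^sup>k + 2\<^sup>k |\<Delta>\<^sub>k|\<^sup>2\<close>, so the subsequence
  converges almost everywhere; Fatou's lemma turns this into convergence in norm.\<close>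

theorem sq_complete:
  assumes f: "\<And>j. f j \<in> sqint M"
    and Cauchy: "\<And>e. e > 0 \<Longrightarrow> \<exists>N. \<forall>i\<ge>N. \<forall>j\<ge>N. normsq M (\<lambda>x. f i x - f j x) \<le> ennreal e"
  obtains g where "g \<in> sqint M" "sq_tendsto M f g"
proof -
  have [measurable]: "f j \<in> borel_measurable M" for j using f by (auto dest: sqintD)
  \<comment> \<open>\<open>r\<close> dominates the moduli of convergence \<open>N\<close> and is increasing, so it selects a subsequence.\<close>
  have "\<forall>k. \<exists>N. \<forall>i\<ge>N. \<forall>j\<ge>N. normsq M (\<lambda>x. f i x - f j x) \<le> ennreal ((1/4)^k)"
    using Cauchy by auto
  then obtain N where N: "\<And>k i j. i \<ge> N k \<Longrightarrow> j \<ge> N k \<Longrightarrow> normsq M (\<lambda>x. f i x - f j x) \<le> ennreal ((1/4)^k)"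
    by metis
  define r where "r k = (\<Sum>i\<le>k. N i) + k" for k
  have rN: "N k \<le> r k" for k
    unfolding r_def using member_le_sum[of k "{..k}" N] by simp
  have rk: "k \<le> r k" for k by (simp add: r_def)
  have rS: "r k \<le> r (Suc k)" for k by (simp add: r_def)
  define D where "D k x = f (r (Suc k)) x - f (r k) x" for k x
  have [measurable]: "D k \<in> borel_measurable M" for k unfolding D_def[abs_def] by measurable
  have D: "normsq M (D k) \<le> ennreal ((1/4)^k)" for k
    unfolding D_def[abs_def] by (rule N) (use rN[of k] rS[of k] in auto)
  have "(\<integral>\<^sup>+x. (\<Sum>k. ennreal (2^k * (cmod (D k x))\<^sup>2)) \<partial>M) = (\<Sum>k. \<integral>\<^sup>+x. ennreal (2^k * (cmod (D k x))\<^sup>2) \<partial>M)"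
    by (rule nn_integral_suminf) measurable
  also have "\<dots> = (\<Sum>k. ennreal (2^k) * normsq M (D k))"
    by (simp add: normsq_def ennreal_mult nn_integral_cmult)
  also have "\<dots> \<le> (\<Sum>k. ennreal ((1/2)^k))"
  proof (intro suminf_le)
    fix k
    have "ennreal (2^k) * normsq M (D k) \<le> ennreal (2^k) * ennreal ((1/4)^k)"
      by (intro mult_left_mono D) auto
    also have "\<dots> = ennreal (2^k * (1/4)^k)" by (rule ennreal_mult[symmetric]) auto
    also have "2^k * (1/4::real)^k = (1/2)^k" by (simp flip: power_mult_distrib)
    finally show "ennreal (2^k) * normsq M (D k) \<le> ennreal ((1/2)^k)" .
  qed auto
  also have "\<dots> = ennreal (\<Sum>k. (1/2)^k)"
    by (rule suminf_ennreal2) (auto intro: summable_geometric)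
  also have "\<dots> < \<infinity>" by simp
  finally have "AE x in M. (\<Sum>k. ennreal (2^k * (cmod (D k x))\<^sup>2)) \<noteq> \<infinity>"
    by (intro nn_integral_PInf_AE) auto
  then have conv: "AE x in M. convergent (\<lambda>k. f (r k) x)"
  proof eventually_elim
    fix x assume "(\<Sum>k. ennreal (2^k * (cmod (D k x))\<^sup>2)) \<noteq> \<infinity>"
    then have s: "summable (\<lambda>k. 2^k * (cmod (D k x))\<^sup>2)"
      by (intro summable_suminf_not_top) auto
    have "summable (\<lambda>k. (1/2)^k + 2^k * (cmod (D k x))\<^sup>2)"
      by (intro summable_add s summable_geometric) simp
    then have "summable (\<lambda>k. D k x)"
    proof (rule summable_comparison_test'[where N=0])
      fix k :: nat
      show "norm (D k x) \<le> (1/2)^k + 2^k * (cmod (D k x))\<^sup>2"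
      proof (cases "cmod (D k x) \<le> (1/2)^k")
        case True then show ?thesis by (simp add: add_increasing2)
      next
        case False
        then have "1 \<le> 2^k * cmod (D k x)" by (simp add: field_simps)
        then have "1 * cmod (D k x) \<le> (2^k * cmod (D k x)) * cmod (D k x)"
          by (rule mult_right_mono) simp
        then show ?thesis by (simp add: power2_eq_square mult.assoc add_increasing)
      qed
    qed
    then have "convergent (\<lambda>n. \<Sum>k<n. D k x)" by (simp add: summable_iff_convergent)
    moreover have "(\<Sum>k<n. D k x) = f (r n) x - f (r 0) x" for n
      unfolding D_def by (rule sum_lessThan_telescope)
    ultimately have "convergent (\<lambda>n. f (r n) x - f (r 0) x)" by simp
    then have "convergent (\<lambda>n. (f (r n) x - f (r 0) x) + f (r 0) x)"
      by (intro convergent_add convergent_const)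
    then show "convergent (\<lambda>k. f (r k) x)" by simp
  qed
  define g where "g x = lim (\<lambda>k. f (r k) x)" for x
  have gm [measurable]: "g \<in> borel_measurable M"
    unfolding g_def[abs_def] by (rule borel_measurable_lim_metric) measurable
  have lim: "AE x in M. (\<lambda>k. f (r k) x) \<longlonglongrightarrow> g x"
    using conv by eventually_elim (simp add: g_def convergent_LIMSEQ_iff)
  have bound: "\<exists>N. \<forall>j\<ge>N. normsq M (\<lambda>x. f j x - g x) \<le> ennreal e" if "e > 0" for e
  proof -
    obtain K where K: "\<And>i j. i \<ge> K \<Longrightarrow> j \<ge> K \<Longrightarrow> normsq M (\<lambda>x. f i x - f j x) \<le> ennreal e"
      using Cauchy[OF \<open>e > 0\<close>] by blast
    have "normsq M (\<lambda>x. f j x - g x) \<le> ennreal e" if "j \<ge> K" for j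
    proof -
      have "normsq M (\<lambda>x. f j x - g x) \<le> liminf (\<lambda>k. normsq M (\<lambda>x. f j x - f (r k) x))"
      proof (rule normsq_liminf_le)
        show "AE x in M. (\<lambda>k. f j x - f (r k) x) \<longlonglongrightarrow> f j x - g x"
          using lim by eventually_elim (intro tendsto_intros)
      qed measurable
      also have "\<dots> \<le> ennreal e"
      proof (rule Liminf_le)
        have "eventually (\<lambda>k. k \<ge> K) sequentially" by (rule eventually_ge_at_top)
        then show "eventually (\<lambda>k. normsq M (\<lambda>x. f j x - f (r k) x) \<le> ennreal e) sequentially"
          by eventually_elim (rule K[OF that], use rk in \<open>blast intro: order_trans\<close>)
      qed simp
      finally show ?thesis .
    qed
    then show ?thesis by blast
  qed
  have t: "sq_tendsto M f g"
    unfolding sq_tendsto_def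
    by (rule ennreal_tendsto_0I) (use bound in \<open>auto simp: eventually_sequentially\<close>)
  obtain j where "normsq M (\<lambda>x. f j x - g x) \<le> ennreal 1" using bound[of 1] by auto
  then have "(\<lambda>x. f j x - g x) \<in> sqint M"
    by (intro sqintI) (auto intro: le_less_trans)
  then have "g \<in> sqint M"
    using sqint_diff[OF f[of j], of "\<lambda>x. f j x - g x"] by simp
  with t show thesis by (rule that[rotated])
qed

section \<open>Orthonormal bases\<close>

definition orthonormal_on :: "'a measure \<Rightarrow> ('i \<Rightarrow> 'a \<Rightarrow> complex) \<Rightarrow> bool" where
  "orthonormal_on M e \<longleftrightarrow>
     (\<forall>i. e i \<in> sqint M) \<and> (\<forall>i j. ip M (e i) (e j) = (if i = j then 1 else 0))"

lemma orthonormal_on_D: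
  assumes "orthonormal_on M e"
  shows "e i \<in> sqint M" "ip M (e i) (e j) = (if i = j then 1 else 0)" "normsq M (e i) = 1"
  using assms normsq_eq_ip(2)[of "e i" M] by (auto simp: orthonormal_on_def)

lemma orthonormal_sum_coeff:
  assumes e: "orthonormal_on M e" and I: "finite I"
  shows "ip M (\<lambda>x. \<Sum>i\<in>I. c i * e i x) (e j) = (if j \<in> I then c j else 0)"
proof -
  have "ip M (\<lambda>x. \<Sum>i\<in>I. c i * e i x) (e j) = (\<Sum>i\<in>I. c i * ip M (e i) (e j))"
    using orthonormal_on_D[OF e] by (simp add: ip_sum_left sqint_scale ip_scale_left)
  also have "\<dots> = (\<Sum>i\<in>I. if i = j then c j else 0)"
    using orthonormal_on_D[OF e] by (intro sum.cong) auto
  finally show ?thesis using I by simp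
qed

lemma orthonormal_sum_normsq:
  assumes e: "orthonormal_on M e" and I: "finite I"
  shows "normsq M (\<lambda>x. \<Sum>i\<in>I. c i * e i x) = ennreal (\<Sum>i\<in>I. (cmod (c i))\<^sup>2)"
proof -
  let ?p = "\<lambda>x. \<Sum>i\<in>I. c i * e i x"
  have p: "?p \<in> sqint M" by (intro sqint_sum sqint_scale orthonormal_on_D[OF e])
  have "ip M ?p ?p = (\<Sum>i\<in>I. cnj (c i) * ip M ?p (e i))"
    using orthonormal_on_D[OF e] by (subst ip_sum_right) (auto intro!: sqint_scale p simp: ip_scale_right)
  also have "\<dots> = (\<Sum>i\<in>I. of_real ((cmod (c i))\<^sup>2))"
    by (intro sum.cong refl)
       (simp add: orthonormal_sum_coeff[OF e I] complex_norm_square mult.commute del: of_real_power)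
  finally have "Re (ip M ?p ?p) = (\<Sum>i\<in>I. (cmod (c i))\<^sup>2)" by simp
  then show ?thesis using normsq_eq_ip(2)[OF p] by simp
qed

lemma Bessel_identity:
  assumes e: "orthonormal_on M e" and f: "f \<in> sqint M" and I: "finite I"
  shows "normsq M f = normsq M (\<lambda>x. f x - (\<Sum>i\<in>I. ip M f (e i) * e i x)) + ennreal (\<Sum>i\<in>I. (cmod (ip M f (e i)))\<^sup>2)"
proof -
  define p where "p = (\<lambda>x. \<Sum>i\<in>I. ip M f (e i) * e i x)"
  have p: "p \<in> sqint M" unfolding p_def by (intro sqint_sum sqint_scale orthonormal_on_D[OF e])
  have "ip M f p = (\<Sum>i\<in>I. cnj (ip M f (e i)) * ip M f (e i))"
    unfolding p_def using orthonormal_on_D[OF e]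
    by (subst ip_sum_right) (auto intro!: sqint_scale f simp: ip_scale_right)
  also have "\<dots> = (\<Sum>i\<in>I. of_real ((cmod (ip M f (e i)))\<^sup>2))"
    by (intro sum.cong refl) (simp add: complex_norm_square mult.commute del: of_real_power)
  finally have 1: "Re (ip M f p) = (\<Sum>i\<in>I. (cmod (ip M f (e i)))\<^sup>2)" by simp
  have 2: "Re (ip M p p) = (\<Sum>i\<in>I. (cmod (ip M f (e i)))\<^sup>2)"
    using orthonormal_sum_normsq[OF e I, of "\<lambda>i. ip M f (e i)"] normsq_eq_ip(2)[OF p]
    by (simp add: p_def[symmetric] Re_ip_self_nonneg sum_nonneg)
  have "Re (ip M (\<lambda>x. f x - p x) (\<lambda>x. f x - p x)) = Re (ip M f f) - (\<Sum>i\<in>I. (cmod (ip M f (e i)))\<^sup>2)"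
    using normsq_add_expand[OF f p, of "-1"] 1 2 by simp
  then have 3: "Re (ip M f f) = Re (ip M (\<lambda>x. f x - p x) (\<lambda>x. f x - p x)) + (\<Sum>i\<in>I. (cmod (ip M f (e i)))\<^sup>2)"
    by simp
  show ?thesis
    unfolding p_def[symmetric, THEN fun_cong]
    by (simp add: normsq_eq_ip(2) f p sqint_diff 3 Re_ip_self_nonneg sum_nonneg ennreal_plus)
qed

lemma Bessel_inequality:
  assumes "orthonormal_on M e" "f \<in> sqint M" "finite I"
  shows "ennreal (\<Sum>i\<in>I. (cmod (ip M f (e i)))\<^sup>2) \<le> normsq M f"
  by (subst Bessel_identity[OF assms]) (simp add: add_increasing)

lemma Bessel_summable:
  assumes e: "orthonormal_on M (e :: nat \<Rightarrow> _)" and f: "f \<in> sqint M"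
  shows "summable (\<lambda>i. (cmod (ip M f (e i)))\<^sup>2)"
proof (rule bounded_imp_summable)
  fix n
  have "ennreal (\<Sum>i\<le>n. (cmod (ip M f (e i)))\<^sup>2) \<le> ennreal (Re (ip M f f))"
    using Bessel_inequality[OF e f, of "{..n}"] normsq_eq_ip(2)[OF f] by simp
  then show "(\<Sum>i\<le>n. (cmod (ip M f (e i)))\<^sup>2) \<le> Re (ip M f f)"
    by (subst (asm) ennreal_le_iff) (auto simp: Re_ip_self_nonneg)
qed simp

text \<open>The Riesz--Fischer series with given square-summable coefficients, summed along any
  exhaustion of the index set by finite sets.\<close>

lemma orthonormal_series_exhaustion:
  assumes e: "orthonormal_on M e" and I: "\<And>N::nat. finite (I N)" "incseq I" "(\<Union>N. I N) = UNIV"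
    and c: "convergent (\<lambda>N. \<Sum>i\<in>I N. (cmod (c i))\<^sup>2)"
  obtains p where "p \<in> sqint M" "sq_tendsto M (\<lambda>N x. \<Sum>i\<in>I N. c i * e i x) p" "\<And>j. ip M p (e j) = c j"
proof -
  define s where "s N = (\<lambda>x. \<Sum>i\<in>I N. c i * e i x)" for N
  define t where "t N = (\<Sum>i\<in>I N. (cmod (c i))\<^sup>2)" for N
  have s: "s N \<in> sqint M" for N unfolding s_def by (intro sqint_sum sqint_scale orthonormal_on_D[OF e])
  have diff: "normsq M (\<lambda>x. s n x - s m x) = ennreal (t n - t m)" if "m \<le> n" for m n
  proof -
    have sub: "I m \<subseteq> I n" using I(2) that by (auto simp: incseq_def)
    have "s n x - s m x = (\<Sum>i\<in>I n - I m. c i * e i x)" for x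
      unfolding s_def using sum_diff[OF I(1) sub] by metis
    moreover have "t n - t m = (\<Sum>i\<in>I n - I m. (cmod (c i))\<^sup>2)"
      unfolding t_def using sum_diff[OF I(1) sub] by metis
    ultimately show ?thesis using orthonormal_sum_normsq[OF e, of "I n - I m" c] I(1) by simp
  qed
  have "\<exists>N. \<forall>i\<ge>N. \<forall>j\<ge>N. normsq M (\<lambda>x. s i x - s j x) \<le> ennreal d" if "d > 0" for d
  proof -
    have "Cauchy t" using c unfolding t_def by (simp add: convergent_eq_Cauchy Cauchy_convergent_iff)
    then obtain N where N: "\<And>m n. m \<ge> N \<Longrightarrow> n \<ge> N \<Longrightarrow> norm (t m - t n) < d"
      using \<open>d > 0\<close> unfolding Cauchy_iff by blast
    have *: "normsq M (\<lambda>x. s i x - s j x) \<le> ennreal d" if "i \<ge> N" "j \<ge> N" "j \<le> i" for i j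
      using N[OF that(1,2)] diff[OF that(3)] by (auto intro!: ennreal_leI)
    show ?thesis
    proof (intro exI allI impI)
      fix i j assume ij: "N \<le> i" "N \<le> j"
      show "normsq M (\<lambda>x. s i x - s j x) \<le> ennreal d"
        using *[of j i] *[of i j] ij normsq_minus_commute[of M "s i" "s j"] by (cases "j \<le> i") auto
    qed
  qed
  with s obtain p where p: "p \<in> sqint M" "sq_tendsto M s p" by (rule sq_complete) blast+
  have "ip M p (e j) = c j" for j
  proof (rule LIMSEQ_unique)
    show "(\<lambda>N. ip M (s N) (e j)) \<longlonglongrightarrow> ip M p (e j)"
      by (rule ip_tendsto_left) (use p s orthonormal_on_D[OF e] in auto)
    obtain N where "j \<in> I N" using I(3) by blast
    then have "eventually (\<lambda>n. j \<in> I n) sequentially"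
      using I(2) unfolding eventually_sequentially incseq_def by blast
    then have "eventually (\<lambda>N. ip M (s N) (e j) = c j) sequentially"
      by eventually_elim (simp add: s_def orthonormal_sum_coeff[OF e I(1)])
    then show "(\<lambda>N. ip M (s N) (e j)) \<longlonglongrightarrow> c j" by (rule tendsto_eventually)
  qed
  with p show thesis using that unfolding s_def[abs_def] by blast
qed

lemma orthonormal_series_converges:
  assumes e: "orthonormal_on M (e :: nat \<Rightarrow> _)" and c: "summable (\<lambda>i. (cmod (c i))\<^sup>2)"
  obtains p where "p \<in> sqint M" "sq_tendsto M (\<lambda>N x. \<Sum>i<N. c i * e i x) p" "\<And>j. ip M p (e j) = c j"
  by (rule orthonormal_series_exhaustion[OF e, of lessThan c])
     (use c in \<open>auto simp: incseq_def summable_iff_convergent intro: that\<close>)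

lemma indicator_sqint:
  assumes "U \<in> sets M" "emeasure M U < \<infinity>"
  shows "(indicator U :: 'a \<Rightarrow> complex) \<in> sqint M" "normsq M (indicator U :: 'a \<Rightarrow> complex) = emeasure M U"
proof -
  have "normsq M (indicator U :: 'a \<Rightarrow> complex) = (\<integral>\<^sup>+x. indicator U x \<partial>M)"
    unfolding normsq_def by (intro nn_integral_cong) (auto split: split_indicator)
  then show "normsq M (indicator U :: 'a \<Rightarrow> complex) = emeasure M U" using assms by simp
  with assms show "(indicator U :: 'a \<Rightarrow> complex) \<in> sqint M" by (intro sqintI) auto
qed

lemma bounded_open_sqint:
  assumes "open U" "bounded (U :: 'a::euclidean_space set)"
  shows "(indicator U :: 'a \<Rightarrow> complex) \<in> sqint lborel"
  using assms emeasure_bounded_finite[of U] by (intro indicator_sqint) (auto simp: less_top)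

text \<open>The finite intersections of members of a countable base generate the Borel sets and are
  closed under intersection.  So a function orthogonal to their indicators, each cut down to a
  ball, has integral \<open>0\<close> over every Borel subset of the ball.\<close>

lemma countable_total_bounded_open:
  obtains \<O> :: "'a::euclidean_space set set" where "countable \<O>"
    "\<And>U. U \<in> \<O> \<Longrightarrow> open U \<and> bounded U"
    "\<And>f. f \<in> sqint lborel \<Longrightarrow> (\<And>U. U \<in> \<O> \<Longrightarrow> ip lborel f (indicator U) = 0) \<Longrightarrow> AE x in lborel. f x = 0"
proof -
  obtain B :: "'a set set" where B: "countable B" "topological_basis B" using ex_countable_basis by blast
  define \<G> where "\<G> = Inter ` {F. finite F \<and> F \<subseteq> B}"
  define \<O> where "\<O> = (\<lambda>(G, n::nat). G \<inter> ball 0 (real n)) ` (\<G> \<times> UNIV)"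
  have openG: "open G" if "G \<in> \<G>" for G
    using that topological_basis_open[OF B(2)] unfolding \<G>_def by (auto intro!: open_Inter)
  have "countable \<O>"
    unfolding \<O>_def \<G>_def
    by (intro countable_image countable_SIGMA countable_Collect_finite_subset B countableI_type)
  moreover have "open U \<and> bounded U" if "U \<in> \<O>" for U
    using that openG unfolding \<O>_def by (auto intro: bounded_subset[OF bounded_ball])
  moreover have "AE x in lborel. f x = 0"
    if f: "f \<in> sqint lborel" and orth: "\<And>U. U \<in> \<O> \<Longrightarrow> ip lborel f (indicator U) = 0" for f
  proof -
    have stable: "Int_stable \<G>"
    proof (rule Int_stableI)
      fix a b assume "a \<in> \<G>" "b \<in> \<G>"
      then obtain F F' where F: "finite F" "F \<subseteq> B" "a = \<Inter>F" "finite F'" "F' \<subseteq> B" "b = \<Inter>F'"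
        unfolding \<G>_def by auto
      then have "a \<inter> b = \<Inter>(F \<union> F')" by auto
      with F show "a \<inter> b \<in> \<G>" unfolding \<G>_def by (auto intro!: image_eqI[of _ _ "F \<union> F'"])
    qed
    have BG: "B \<subseteq> \<G>" unfolding \<G>_def by (auto intro!: image_eqI[of _ _ "{_}"])
    have gen: "A \<in> sigma_sets UNIV \<G>" if "A \<in> sets borel" for A
    proof -
      have "sets borel = sigma_sets UNIV B" by (subst borel_eq_countable_basis[OF B]) simp
      then have "A \<in> sigma_sets UNIV B" using that by simp
      then show ?thesis using sigma_sets_mono'[OF BG] by blast
    qed
    have gen': "A \<in> sets borel" if "A \<in> sigma_sets UNIV \<G>" for A
      using that openG by (metis borel_open sets.sigma_sets_subset space_borel subsetD subsetI)
    have meas [measurable]: "f \<in> borel_measurable borel" using sqintD(1)[OF f] by simp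
    have "AE x in lborel. x \<in> ball 0 (real n) \<longrightarrow> f x = 0" for n
    proof -
      define h where "h x = f x * cnj (indicator (ball 0 (real n)) x)" for x
      have int: "integrable lborel h"
        unfolding h_def by (rule sqint_mult_integrable[OF f bounded_open_sqint]) auto
      have sint: "set_integrable lborel A h" if "A \<in> sets borel" for A
        using integrable_mult_indicator[of A lborel h] int that by (simp add: set_integrable_def)
      have univ: "UNIV \<in> \<G>" unfolding \<G>_def by (auto intro!: image_eqI[of _ _ "{}"])
      have zero: "(LINT x:A|lborel. h x) = 0" if "A \<in> sets borel" for A
      proof -
        have "\<G> \<subseteq> Pow UNIV" "A \<in> sigma_sets UNIV \<G>" using gen[OF that] by auto
        with stable show ?thesis
        proof (induct rule: sigma_sets_induct_disjoint)
          case (basic A)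
          have "A \<inter> ball 0 (real n) \<in> \<O>" unfolding \<O>_def using basic by auto
          moreover have "(\<lambda>x. f x * cnj (indicator (A \<inter> ball 0 (real n)) x)) = (\<lambda>x. indicat_real A x *\<^sub>R h x)"
            by (auto simp: fun_eq_iff h_def split: split_indicator)
          ultimately show ?case
            using orth[of "A \<inter> ball 0 (real n)"] by (simp add: set_lebesgue_integral_def ip_def)
        next
          case empty show ?case by (simp add: set_lebesgue_integral_def)
        next
          case (compl A)
          have A: "A \<in> sets borel" by (rule gen') fact
          have "UNIV \<inter> ball 0 (real n) \<in> \<O>" unfolding \<O>_def using univ by blast
          from orth[OF this] have u0: "(LINT x:UNIV|lborel. h x) = 0"
            by (simp add: set_lebesgue_integral_def ip_def h_def)
          have u1: "(LINT x:UNIV|lborel. h x) = (LINT x:A \<union> (UNIV - A)|lborel. h x)"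
            by (simp add: Un_Diff_cancel)
          have u2: "(LINT x:A \<union> (UNIV - A)|lborel. h x) = (LINT x:A|lborel. h x) + (LINT x:(UNIV - A)|lborel. h x)"
            using A by (intro set_integral_Un sint) auto
          from compl(2) show ?case using u0 unfolding u1 u2 by simp
        next
          case (union A)
          have A: "A i \<in> sets borel" for i by (rule gen') (use union in auto)
          have "(LINT x:(\<Union>i. A i)|lborel. h x) = (\<Sum>i. (LINT x:(A i)|lborel. h x))"
            using A union(1) by (intro lebesgue_integral_countable_add sint) (auto simp: disjoint_family_on_def)
          then show ?case using union by simp
        qed
      qed
      have "AE x in lborel. Re (h x) = 0"
      proof (rule density_unique_real)
        fix A :: "'a set" assume A: "A \<in> sets lborel"
        have "(LINT x:A|lborel. Re (h x)) = Re (LINT x:A|lborel. h x)"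
          using sint[of A] A by (simp add: set_lebesgue_integral_def set_integrable_def flip: integral_Re)
        then show "(LINT x:A|lborel. Re (h x)) = (LINT x:A|lborel. 0)"
          using zero[of A] A by (simp add: set_lebesgue_integral_def)
      qed (use int in auto)
      moreover have "AE x in lborel. Im (h x) = 0"
      proof (rule density_unique_real)
        fix A :: "'a set" assume A: "A \<in> sets lborel"
        have "(LINT x:A|lborel. Im (h x)) = Im (LINT x:A|lborel. h x)"
          using sint[of A] A by (simp add: set_lebesgue_integral_def set_integrable_def flip: integral_Im)
        then show "(LINT x:A|lborel. Im (h x)) = (LINT x:A|lborel. 0)"
          using zero[of A] A by (simp add: set_lebesgue_integral_def)
      qed (use int in auto)
      ultimately show ?thesis
        by eventually_elim (auto simp: h_def complex_eq_iff)
    qed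
    then have "AE x in lborel. \<forall>n. x \<in> ball 0 (real n) \<longrightarrow> f x = 0" by (subst AE_all_countable) blast
    then show ?thesis
      by eventually_elim (metis dist_0_norm mem_ball reals_Archimedean2)
  qed
  ultimately show thesis by (rule that)
qed

text \<open>Zorn's lemma extends an infinite orthonormal family of indicator functions to a
  maximal orthonormal set inside the subspace.  Bessel's inequality and a countable total family
  make it countable.  By maximality it spans a dense part of the subspace, which contains the
  total family; so nothing outside the subspace is orthogonal to it.\<close>

theorem orthonormal_basis_in_subspace:
  fixes V :: "('a::euclidean_space \<Rightarrow> complex) set"
  assumes V: "V \<subseteq> sqint lborel"
    and add: "\<And>f g c. f \<in> V \<Longrightarrow> g \<in> V \<Longrightarrow> (\<lambda>x. f x + c * g x) \<in> V"
    and closed: "\<And>f g. (\<And>j. f j \<in> V) \<Longrightarrow> g \<in> sqint lborel \<Longrightarrow> sq_tendsto lborel f g \<Longrightarrow> g \<in> V"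
    and ind: "\<And>U. open U \<Longrightarrow> bounded U \<Longrightarrow> indicator U \<in> V"
  obtains e :: "nat \<Rightarrow> 'a \<Rightarrow> complex" where "orthonormal_on lborel e" "\<And>i. e i \<in> V"
    "\<And>f. f \<in> sqint lborel \<Longrightarrow> (\<And>i. ip lborel f (e i) = 0) \<Longrightarrow> AE x in lborel. f x = 0"
proof -
  \<comment> \<open>Indicators of disjoint unit cubes along the diagonal; they make the maximal set infinite.\<close>
  define u :: "nat \<Rightarrow> 'a \<Rightarrow> complex" where "u j = indicator (box (real j *\<^sub>R One) (real (Suc j) *\<^sub>R One))" for j
  have uV: "u j \<in> V" for j unfolding u_def by (intro ind) auto
  have u_disj: "box (real i *\<^sub>R One) (real (Suc i) *\<^sub>R One) \<inter> box (real j *\<^sub>R One) (real (Suc j) *\<^sub>R (One::'a)) = {}"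
    if "i < j" for i j
  proof -
    obtain b :: 'a where b: "b \<in> Basis" using nonempty_Basis by blast
    have "real (Suc i) \<le> real j" using that by simp
    then show ?thesis using b by (auto simp: box_def dest!: bspec[OF _ b])
  qed
  have u_on: "orthonormal_on lborel u"
    unfolding orthonormal_on_def
  proof (intro conjI allI)
    fix i j
    have n1: "normsq lborel (u i) = 1"
      unfolding u_def by (subst indicator_sqint(2)) (auto simp: inner_diff_left algebra_simps)
    show "u i \<in> sqint lborel" using uV V by blast
    show "ip lborel (u i) (u j) = (if i = j then 1 else 0)"
    proof (cases "i = j")
      case True
      then show ?thesis using n1 normsq_eq_ip(1)[OF \<open>u i \<in> sqint lborel\<close>] by simp
    next
      case False
      then have "(\<lambda>x. u i x * cnj (u j x)) = (\<lambda>x. 0)"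
        using u_disj[of i j] u_disj[of j i] by (cases "i < j") (auto simp: u_def indicator_def fun_eq_iff)
      then show ?thesis using False by (simp only: ip_def) simp
    qed
  qed
  define \<A> where "\<A> = {S. S \<subseteq> V \<and> range u \<subseteq> S \<and> (\<forall>s\<in>S. \<forall>t\<in>S. ip lborel s t = (if s = t then 1 else 0))}"
  have inj_u: "inj u"
    using orthonormal_on_D(2)[OF u_on] by (intro injI) (metis one_neq_zero)
  have "\<exists>S\<in>\<A>. \<forall>X\<in>\<A>. S \<subseteq> X \<longrightarrow> X = S"
  proof (rule subset_Zorn_nonempty)
    have "range u \<in> \<A>"
      unfolding \<A>_def using uV orthonormal_on_D(2)[OF u_on] inj_u by (auto simp: inj_eq)
    then show "\<A> \<noteq> {}" by auto
    fix C assume C: "C \<noteq> {}" "subset.chain \<A> C"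
    show "\<Union>C \<in> \<A>"
      unfolding \<A>_def
    proof (safe)
      show "x \<in> V" if "x \<in> X" "X \<in> C" for x X using that C unfolding subset.chain_def \<A>_def by blast
      obtain X where X: "X \<in> C" using C(1) by blast
      then have "range u \<subseteq> X" using C(2) unfolding subset.chain_def \<A>_def by blast
      then show "u j \<in> \<Union>C" for j using X by blast
      fix s t S T assume st: "s \<in> S" "S \<in> C" "t \<in> T" "T \<in> C"
      then have "S \<subseteq> T \<or> T \<subseteq> S" using C(2) unfolding subset_chain_def by blast
      then obtain W where "W \<in> C" "s \<in> W" "t \<in> W" using st by blast
      then show "ip lborel s t = (if s = t then 1 else 0)"
        using C(2) unfolding subset.chain_def \<A>_def by blast
    qed
  qed
  then obtain S where S: "S \<in> \<A>" and max: "\<And>X. X \<in> \<A> \<Longrightarrow> S \<subseteq> X \<Longrightarrow> X = S" by blast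
  have S_V: "S \<subseteq> V" and S_ip: "\<And>s t. s \<in> S \<Longrightarrow> t \<in> S \<Longrightarrow> ip lborel s t = (if s = t then 1 else 0)" and Su: "range u \<subseteq> S"
    using S unfolding \<A>_def by auto
  obtain \<O> :: "'a set set" where \<O>: "countable \<O>" "\<And>U. U \<in> \<O> \<Longrightarrow> open U \<and> bounded U"
    "\<And>f. f \<in> sqint lborel \<Longrightarrow> (\<And>U. U \<in> \<O> \<Longrightarrow> ip lborel f (indicator U) = 0) \<Longrightarrow> AE x in lborel. f x = 0"
    by (rule countable_total_bounded_open) blast
  have "countable {s \<in> S. ip lborel f s \<noteq> 0}" if f: "f \<in> sqint lborel" for f
  proof -
    have fin: "finite {s \<in> S. (cmod (ip lborel f s))\<^sup>2 > 1 / real (Suc n)}" (is "finite ?T") for n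
    proof (rule ccontr)
      assume "infinite ?T"
      obtain e :: "nat \<Rightarrow> _" where e: "inj e" "range e \<subseteq> ?T"
        using infinite_countable_subset[OF \<open>infinite ?T\<close>] by blast
      then have eo: "orthonormal_on lborel e"
        unfolding orthonormal_on_def using S_ip S_V V by (auto simp: inj_eq subset_iff image_subset_iff)
      have "(\<lambda>i. (cmod (ip lborel f (e i)))\<^sup>2) \<longlonglongrightarrow> 0"
        by (rule summable_LIMSEQ_zero[OF Bessel_summable[OF eo f]])
      then have "1 / real (Suc n) \<le> 0"
        by (rule tendsto_lowerbound) (use e(2) in \<open>auto simp: image_subset_iff intro!: always_eventually less_imp_le\<close>)
      then show False by simp
    qed
    have "{s \<in> S. ip lborel f s \<noteq> 0} \<subseteq> (\<Union>n. {s \<in> S. (cmod (ip lborel f s))\<^sup>2 > 1 / real (Suc n)})"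
    proof
      fix s assume "s \<in> {s \<in> S. ip lborel f s \<noteq> 0}"
      then have "s \<in> S" "0 < (cmod (ip lborel f s))\<^sup>2" by auto
      moreover from reals_Archimedean[OF this(2)]
      obtain n where "1 / real (Suc n) < (cmod (ip lborel f s))\<^sup>2" by (auto simp: inverse_eq_divide)
      ultimately show "s \<in> (\<Union>n. {s \<in> S. (cmod (ip lborel f s))\<^sup>2 > 1 / real (Suc n)})" by blast
    qed
    then show ?thesis by (rule countable_subset) (intro countable_UN countable_finite[OF fin] countableI_type)
  qed
  then have "countable (\<Union>U\<in>\<O>. {s \<in> S. ip lborel (indicator U) s \<noteq> 0})"
    using \<O>(2) by (intro countable_UN[OF \<O>(1)]) (simp add: bounded_open_sqint)
  moreover have "S \<subseteq> (\<Union>U\<in>\<O>. {s \<in> S. ip lborel (indicator U) s \<noteq> 0})"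
  proof (rule ccontr)
    assume "\<not> ?thesis"
    then obtain s where s: "s \<in> S" "\<And>U. U \<in> \<O> \<Longrightarrow> ip lborel (indicator U) s = 0" by blast
    have sq: "s \<in> sqint lborel" using s S_V V by blast
    have "AE x in lborel. s x = 0"
      using s(2) by (intro \<O>(3) sq) (simp add: ip_commute[of lborel s])
    then have "normsq lborel s = 0" using sqintD[OF sq] by (simp add: normsq_zero_iff)
    then show False using S_ip[of s s] s normsq_eq_ip(1)[OF sq] by simp
  qed
  ultimately have "countable S" by (rule countable_subset[rotated])
  moreover have "infinite S" using Su inj_u by (metis finite_subset infinite_UNIV_nat range_inj_infinite)
  ultimately obtain e where e: "bij_betw (e::nat \<Rightarrow> _) UNIV S"
    using bij_betw_from_nat_into by blast
  then have eS: "e i \<in> S" for i by (auto simp: bij_betw_def)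
  have eV: "e i \<in> V" for i using eS S_V by blast
  have eo: "orthonormal_on lborel e"
    unfolding orthonormal_on_def using S_ip eS eV V e by (auto simp: bij_betw_def inj_eq)
  have dense: "ip lborel f v = 0" if f: "f \<in> sqint lborel" "\<And>i. ip lborel f (e i) = 0" and v: "v \<in> V" for f v
  proof -
    have vs: "v \<in> sqint lborel" using v V by blast
    \<comment> \<open>The projection \<open>p\<close> of \<open>v\<close>: normalizing \<open>v - p \<noteq> 0\<close> would extend the maximal set.\<close>
    obtain p where p: "p \<in> sqint lborel" "sq_tendsto lborel (\<lambda>N x. \<Sum>i<N. ip lborel v (e i) * e i x) p"
        "\<And>j. ip lborel p (e j) = ip lborel v (e j)"
      using orthonormal_series_converges[OF eo Bessel_summable[OF eo vs]] by blast
    have sumV: "(\<lambda>x. \<Sum>i<N. ip lborel v (e i) * e i x) \<in> V" for N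
    proof (induct N)
      case 0
      have "(\<lambda>x. 0) \<in> V" using add[OF v v, of "-1"] by simp
      then show ?case by simp
    next
      case (Suc N) then show ?case using add[OF Suc eV] by simp
    qed
    have pV: "p \<in> V" by (rule closed[OF sumV p(1,2)])
    define d where "d x = v x - p x" for x
    have dV: "d \<in> V" unfolding d_def[abs_def] using add[OF v pV, of "-1"] by simp
    have ds: "d \<in> sqint lborel" using dV V by blast
    have de: "ip lborel d (e j) = 0" for j
      unfolding d_def[abs_def] using p vs orthonormal_on_D(1)[OF eo] by (simp add: ip_diff_left)
    have "Re (ip lborel d d) = 0"
    proof (rule ccontr)
      assume "Re (ip lborel d d) \<noteq> 0"
      then have pos: "Re (ip lborel d d) > 0" using Re_ip_self_nonneg[of lborel d] by simp
      define t where "t x = of_real (1 / sqrt (Re (ip lborel d d))) * d x" for x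
      have tV: "t \<in> V" unfolding t_def[abs_def] using add[OF add[OF dV dV, of "-1"] dV, of "of_real (1 / sqrt (Re (ip lborel d d)))"] by simp
      define a where "a = Re (ip lborel d d)"
      have a: "ip lborel d d = of_real a" "a > 0"
        using normsq_eq_ip(1)[OF ds] pos by (simp_all add: complex_eq_iff a_def)
      then have "complex_of_real (1 / sqrt a) * (complex_of_real (1 / sqrt a) * ip lborel d d) = of_real (1 / sqrt a * (1 / sqrt a * a))"
        by (simp only: of_real_mult)
      also have "1 / sqrt a * (1 / sqrt a * a) = 1" using a(2) by (simp add: field_simps flip: power2_eq_square)
      finally have tt: "ip lborel t t = 1"
        unfolding t_def[abs_def] ip_scale_left ip_scale_right a_def[symmetric] by simp
      have te: "ip lborel t s = 0" if "s \<in> S" for s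
        using that de e unfolding t_def[abs_def] ip_scale_left by (auto simp: bij_betw_def image_iff)
      have et: "ip lborel s t = 0" if "s \<in> S" for s
        using te[OF that] by (subst ip_commute) simp
      have "t \<notin> S" using te tt by force
      moreover have "insert t S \<in> \<A>"
        unfolding \<A>_def using tV tt te et S_V Su S_ip \<open>t \<notin> S\<close> by auto
      ultimately show False using max[of "insert t S"] by blast
    qed
    then have "normsq lborel d = 0" using normsq_eq_ip(2)[OF ds] by simp
    then have "AE x in lborel. d x = 0" using sqintD[OF ds] by (simp add: normsq_zero_iff)
    then have "AE x in lborel. v x = p x" by eventually_elim (simp add: d_def)
    then have "ip lborel v f = ip lborel p f"
      using sqintD(1)[OF vs] sqintD(1)[OF p(1)] sqintD(1)[OF f(1)] by (intro ip_cong_AE) auto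
    also have "ip lborel p f = 0"
    proof (rule LIMSEQ_unique)
      show "(\<lambda>N. ip lborel (\<lambda>x. \<Sum>i<N. ip lborel v (e i) * e i x) f) \<longlonglongrightarrow> ip lborel p f"
        using sumV V by (intro ip_tendsto_left p f) auto
      show "(\<lambda>N. ip lborel (\<lambda>x. \<Sum>i<N. ip lborel v (e i) * e i x) f) \<longlonglongrightarrow> 0"
      proof -
        have "ip lborel (e i) f = 0" for i using f(2)[of i] by (subst ip_commute) simp
        then show ?thesis
          using orthonormal_on_D(1)[OF eo] f(1) by (simp add: ip_sum_left sqint_scale ip_scale_left)
      qed
    qed
    finally show ?thesis by (subst ip_commute) simp
  qed
  show thesis
  proof (rule that[OF eo eV])
    fix f assume f: "f \<in> sqint lborel" "\<And>i. ip lborel f (e i) = 0"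
    show "AE x in lborel. f x = 0"
      by (rule \<O>(3)[OF f(1)]) (use \<O>(2) ind in \<open>auto intro: dense[OF f]\<close>)
  qed
qed

lemma basis_expansion:
  assumes e: "orthonormal_on M (e :: nat \<Rightarrow> _)"
    and total: "\<And>f. f \<in> sqint M \<Longrightarrow> (\<And>i. ip M f (e i) = 0) \<Longrightarrow> AE x in M. f x = 0"
    and f: "f \<in> sqint M"
  shows "sq_tendsto M (\<lambda>N x. \<Sum>i<N. ip M f (e i) * e i x) f"
    and "(\<Sum>i. ennreal ((cmod (ip M f (e i)))\<^sup>2)) = normsq M f"
proof -
  obtain p where p: "p \<in> sqint M" "sq_tendsto M (\<lambda>N x. \<Sum>i<N. ip M f (e i) * e i x) p"
      "\<And>j. ip M p (e j) = ip M f (e j)"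
    using orthonormal_series_converges[OF e Bessel_summable[OF e f]] by blast
  have "AE x in M. p x - f x = 0"
    by (rule total) (use p f orthonormal_on_D[OF e] in \<open>auto simp: ip_diff_left intro: sqint_diff\<close>)
  then have "normsq M (\<lambda>x. (\<Sum>i<N. ip M f (e i) * e i x) - f x) = normsq M (\<lambda>x. (\<Sum>i<N. ip M f (e i) * e i x) - p x)" for N
    by (intro normsq_cong_AE) auto
  with p(2) show lim: "sq_tendsto M (\<lambda>N x. \<Sum>i<N. ip M f (e i) * e i x) f"
    by (simp add: sq_tendsto_def)
  have "(\<lambda>N. normsq M (\<lambda>x. \<Sum>i<N. ip M f (e i) * e i x)) \<longlonglongrightarrow> normsq M f"
    by (rule normsq_tendsto[OF lim]) (intro sqint_sum sqint_scale orthonormal_on_D[OF e] f)+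
  then have "(\<lambda>N. \<Sum>i<N. ennreal ((cmod (ip M f (e i)))\<^sup>2)) \<longlonglongrightarrow> normsq M f"
    by (simp add: orthonormal_sum_normsq[OF e] sum_nonneg)
  then show "(\<Sum>i. ennreal ((cmod (ip M f (e i)))\<^sup>2)) = normsq M f"
    using LIMSEQ_unique summable_LIMSEQ[OF summableI] by blast
qed

text \<open>A density principle: every function is the limit of its expansion in a basis taken from the
  subspace.\<close>

corollary closed_subspace_eq_sqint:
  fixes V :: "('a::euclidean_space \<Rightarrow> complex) set"
  assumes V: "V \<subseteq> sqint lborel"
    and add: "\<And>f g c. f \<in> V \<Longrightarrow> g \<in> V \<Longrightarrow> (\<lambda>x. f x + c * g x) \<in> V"
    and closed: "\<And>f g. (\<And>j. f j \<in> V) \<Longrightarrow> g \<in> sqint lborel \<Longrightarrow> sq_tendsto lborel f g \<Longrightarrow> g \<in> V"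
    and ind: "\<And>U. open U \<Longrightarrow> bounded U \<Longrightarrow> indicator U \<in> V"
  shows "V = sqint lborel"
proof (intro equalityI V subsetI)
  fix f :: "'a \<Rightarrow> complex" assume f: "f \<in> sqint lborel"
  show "f \<in> V"
  proof (rule orthonormal_basis_in_subspace[OF V])
    show "(\<lambda>x. f x + c * g x) \<in> V" if "f \<in> V" "g \<in> V" for f g c
      using that by (rule add)
    show "g \<in> V" if "\<And>j. f j \<in> V" "g \<in> sqint lborel" "sq_tendsto lborel f g" for f g
      using that by (rule closed)
    show "indicator U \<in> V" if "open U" "bounded U" for U
      using that by (rule ind)
    fix e :: "nat \<Rightarrow> 'a \<Rightarrow> complex"
    assume e: "orthonormal_on lborel e" "\<And>i. e i \<in> V"
      "\<And>f. f \<in> sqint lborel \<Longrightarrow> (\<And>i. ip lborel f (e i) = 0) \<Longrightarrow> AE x in lborel. f x = 0"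
    have "(\<lambda>x. \<Sum>i<N. c i * e i x) \<in> V" for N c
    proof (induct N)
      case 0
      have "(\<lambda>x. 0) \<in> V" using add[OF e(2) e(2), of 0 "-1" 0] by simp
      then show ?case by simp
    next
      case (Suc N) then show ?case using add[OF Suc e(2)] by simp
    qed
    then show "f \<in> V" using basis_expansion(1)[OF e(1,3) f] by (intro closed[OF _ f]) auto
  qed
qed

lemma orthonormal_basis_L2_basis:
  "orthonormal_basis (L2_basis :: nat \<Rightarrow> real ^ 'n::finite \<Rightarrow> complex)"
proof -
  obtain e :: "nat \<Rightarrow> real ^ 'n \<Rightarrow> complex" where "orthonormal_on lborel e"
    "\<And>f. f \<in> sqint lborel \<Longrightarrow> (\<And>i. ip lborel f (e i) = 0) \<Longrightarrow> AE x in lborel. f x = 0"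
    by (rule orthonormal_basis_in_subspace[of "sqint lborel"])
       (auto intro: sqint_add sqint_scale bounded_open_sqint)
  then have "orthonormal_basis e"
    unfolding orthonormal_basis_def L2_eq_sqint L2_inner_eq orthonormal_on_def by blast
  then show ?thesis unfolding L2_basis_def by (rule someI[of orthonormal_basis])
qed

lemma L2_basis_orthonormal: "orthonormal_on lborel L2_basis"
  and L2_basis_total: "f \<in> sqint lborel \<Longrightarrow> (\<And>i. ip lborel f (L2_basis i) = 0) \<Longrightarrow> AE x in lborel. f x = 0"
  using orthonormal_basis_L2_basis
  unfolding orthonormal_basis_def L2_eq_sqint L2_inner_eq orthonormal_on_def by blast+

lemma L2_basis_sqint: "L2_basis i \<in> sqint lborel"
  using orthonormal_on_D(1)[OF L2_basis_orthonormal] .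

lemma L2_basis_Parseval:
  "f \<in> sqint lborel \<Longrightarrow> (\<Sum>i. ennreal ((cmod (ip lborel f (L2_basis i)))\<^sup>2)) = normsq lborel f"
  by (rule basis_expansion(2)[OF L2_basis_orthonormal L2_basis_total])

section \<open>The Plancherel theorem on Euclidean space\<close>

lemma nn_integral_lborel_affine:
  fixes f :: "'a::euclidean_space \<Rightarrow> ennreal"
  assumes [measurable]: "f \<in> borel_measurable borel" and c: "c \<noteq> 0"
  shows "(\<integral>\<^sup>+x. f x \<partial>lborel) = ennreal (\<bar>c\<bar> ^ DIM('a)) * (\<integral>\<^sup>+x. f (t + c *\<^sub>R x) \<partial>lborel)"
  by (subst lborel_affine[OF c, of t])
     (simp add: nn_integral_density nn_integral_distr nn_integral_cmult)

lemma integral_lborel_affine: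
  fixes f :: "'a::euclidean_space \<Rightarrow> complex"
  assumes [measurable]: "f \<in> borel_measurable borel" and c: "c \<noteq> 0"
  shows "(LINT x|lborel. f x) = of_real (\<bar>c\<bar> ^ DIM('a)) * (LINT x|lborel. f (t + c *\<^sub>R x))"
  by (subst lborel_affine[OF c, of t])
     (simp add: integral_density integral_distr scaleR_conv_of_real)

lemma integrable_lborel_affine:
  fixes f :: "'a::euclidean_space \<Rightarrow> complex"
  assumes f: "integrable lborel f" and c: "c \<noteq> 0"
  shows "integrable lborel (\<lambda>x. f (t + c *\<^sub>R x))"
proof -
  have [measurable]: "f \<in> borel_measurable borel" using f by auto
  have "ennreal (\<bar>c\<bar> ^ DIM('a)) * (\<integral>\<^sup>+x. ennreal (norm (f (t + c *\<^sub>R x))) \<partial>lborel) < \<infinity>"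
    using f nn_integral_lborel_affine[of "\<lambda>x. ennreal (norm (f x))" c t] c by (simp add: integrable_iff_bounded)
  then show ?thesis
    using c by (auto simp: integrable_iff_bounded ennreal_mult_less_top)
qed

lemma nn_integral_lborel_translate:
  fixes f :: "'a::euclidean_space \<Rightarrow> ennreal"
  assumes [measurable]: "f \<in> borel_measurable borel"
  shows "(\<integral>\<^sup>+x. f (x + t) \<partial>lborel) = (\<integral>\<^sup>+x. f x \<partial>lborel)"
  using nn_integral_lborel_affine[of f 1 t] assms by (simp add: add.commute)

lemma integral_lborel_translate:
  fixes f :: "'a::euclidean_space \<Rightarrow> complex"
  assumes [measurable]: "f \<in> borel_measurable borel"
  shows "(LINT x|lborel. f (x + t)) = (LINT x|lborel. f x)"
  using integral_lborel_affine[of f 1 t] assms by (simp add: add.commute)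

lemma normsq_translate:
  fixes f :: "'a::euclidean_space \<Rightarrow> complex"
  assumes [measurable]: "f \<in> borel_measurable borel"
  shows "normsq lborel (\<lambda>x. f (x + t)) = normsq lborel f"
  unfolding normsq_def using nn_integral_lborel_translate[of "\<lambda>x. ennreal ((cmod (f x))\<^sup>2)" t] by simp

lemma sqint_translate:
  fixes f :: "'a::euclidean_space \<Rightarrow> complex"
  assumes "f \<in> sqint lborel"
  shows "(\<lambda>x. f (x + t)) \<in> sqint lborel"
proof -
  have [measurable]: "f \<in> borel_measurable borel" using sqintD(1)[OF assms] by simp
  show ?thesis using sqintD(2)[OF assms] by (intro sqintI) (simp_all add: normsq_translate)
qed

text \<open>Functions on which translation is continuous form a closed subspace that contains the
  indicators of bounded open sets: \<open>1\<^sub>U(x) 1\<^sub>U(x + z\<^sub>j)\<close> tends to \<open>1\<^sub>U(x)\<close> at every point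
  when \<open>U\<close> is open, whatever its boundary.\<close>

lemma translation_continuous:
  fixes f :: "'a::euclidean_space \<Rightarrow> complex"
  assumes f: "f \<in> sqint lborel" and z: "z \<longlonglongrightarrow> 0"
  shows "sq_tendsto lborel (\<lambda>j x. f (x + z j)) f"
proof -
  define V where "V = {f :: 'a \<Rightarrow> complex. f \<in> sqint lborel \<and> sq_tendsto lborel (\<lambda>j x. f (x + z j)) f}"
  have "V = sqint lborel"
  proof (rule closed_subspace_eq_sqint)
    show "V \<subseteq> sqint lborel" by (auto simp: V_def)
  next
    fix f g c assume "f \<in> V" "g \<in> V"
    then have f: "f \<in> sqint lborel" "sq_tendsto lborel (\<lambda>j x. f (x + z j)) f"
      and g: "g \<in> sqint lborel" "sq_tendsto lborel (\<lambda>j x. g (x + z j)) g"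
      by (auto simp: V_def)
    note [measurable] = sqintD(1)[OF f(1), simplified] sqintD(1)[OF g(1), simplified]
    have "sq_tendsto lborel (\<lambda>j x. f (x + z j) + c * g (x + z j)) (\<lambda>x. f x + c * g x)"
      by (intro sq_tendsto_add sq_tendsto_scale f g) measurable
    then show "(\<lambda>x. f x + c * g x) \<in> V"
      using f g by (simp add: V_def sqint_add sqint_scale)
  next
    fix h :: "nat \<Rightarrow> 'a \<Rightarrow> complex" and g assume h: "\<And>k. h k \<in> V" and g: "g \<in> sqint lborel" and lim: "sq_tendsto lborel h g"
    have hs: "h k \<in> sqint lborel" for k using h by (auto simp: V_def)
    note [measurable] = sqintD(1)[OF hs, simplified] sqintD(1)[OF g, simplified]
    have "sq_tendsto lborel (\<lambda>j x. g (x + z j)) g"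
      unfolding sq_tendsto_def
    proof (rule ennreal_tendsto_0I)
      fix d :: real assume d: "d > 0"
      have "eventually (\<lambda>k. normsq lborel (\<lambda>x. h k x - g x) < ennreal (d / 12)) sequentially"
        using lim d unfolding sq_tendsto_def by (rule_tac order_tendstoD(2)) auto
      then obtain k where k: "normsq lborel (\<lambda>x. h k x - g x) < ennreal (d / 12)"
        by (auto simp: eventually_sequentially)
      have "(\<lambda>j. normsq lborel (\<lambda>x. h k (x + z j) - h k x)) \<longlonglongrightarrow> 0"
        using h[of k] by (simp add: V_def sq_tendsto_def)
      then have "eventually (\<lambda>j. normsq lborel (\<lambda>x. h k (x + z j) - h k x) < ennreal (d / 8)) sequentially"
        by (rule order_tendstoD(2)) (use d in auto)
      then show "eventually (\<lambda>j. normsq lborel (\<lambda>x. g (x + z j) - g x) \<le> ennreal d) sequentially"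
      proof eventually_elim
        fix j assume j: "normsq lborel (\<lambda>x. h k (x + z j) - h k x) < ennreal (d / 8)"
        have 1: "normsq lborel (\<lambda>x. g (x + z j) - h k (x + z j)) = normsq lborel (\<lambda>x. h k x - g x)"
          using normsq_translate[of "\<lambda>x. g x - h k x" "z j"] by (simp add: normsq_minus_commute[of _ g])
        have "normsq lborel (\<lambda>x. g (x + z j) - g x) \<le>
            2 * normsq lborel (\<lambda>x. h k x - g x) + 2 * normsq lborel (\<lambda>x. h k (x + z j) - g x)"
          using normsq_diff_triangle[of "\<lambda>x. g (x + z j)" lborel "\<lambda>x. h k (x + z j)" g] 1 by simp
        also have "\<dots> \<le> 2 * normsq lborel (\<lambda>x. h k x - g x) +
            2 * (2 * normsq lborel (\<lambda>x. h k (x + z j) - h k x) + 2 * normsq lborel (\<lambda>x. h k x - g x))"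
          by (intro add_left_mono mult_left_mono normsq_diff_triangle) auto
        \<comment> \<open>\<open>d = 6 (d / 12) + 4 (d / 8)\<close>: two uses of the quasi-triangle inequality with factor \<open>2\<close>.\<close>
        also have "\<dots> \<le> 2 * ennreal (d / 12) + 2 * (2 * ennreal (d / 8) + 2 * ennreal (d / 12))"
          using j k by (intro add_mono mult_left_mono less_imp_le) auto
        also have "\<dots> = ennreal (2 * (d / 12) + 2 * (2 * (d / 8) + 2 * (d / 12)))"
          using d by (simp del: ennreal_numeral flip: ennreal_mult ennreal_plus ennreal_numeral)
        also have "2 * (d / 12) + 2 * (2 * (d / 8) + 2 * (d / 12)) = d" by simp
        finally show "normsq lborel (\<lambda>x. g (x + z j) - g x) \<le> ennreal d" .
      qed
    qed
    with g show "g \<in> V" by (simp add: V_def)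
  next
    fix U :: "'a set" assume U: "open U" "bounded U"
    let ?i = "indicator U :: 'a \<Rightarrow> complex"
    have [measurable]: "U \<in> sets borel" using U by auto
    have i: "?i \<in> sqint lborel" by (rule bounded_open_sqint[OF U])
    define t where "t j x = ?i (x + z j)" for j x
    have t: "t j \<in> sqint lborel" for j unfolding t_def[abs_def] by (rule sqint_translate[OF i])
    have "(\<lambda>j. ip lborel (t j) ?i) \<longlonglongrightarrow> ip lborel ?i ?i"
      unfolding ip_def
    proof (rule integral_dominated_convergence)
      have "integrable lborel (\<lambda>x. (cmod (?i x))\<^sup>2)" by (rule sqint_integrable[OF i])
      then show "integrable lborel (\<lambda>x. (cmod (?i x))\<^sup>2)" .
      show "AE x in lborel. (\<lambda>j. t j x * cnj (?i x)) \<longlonglongrightarrow> ?i x * cnj (?i x)"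
      proof (rule AE_I2)
        fix x show "(\<lambda>j. t j x * cnj (?i x)) \<longlonglongrightarrow> ?i x * cnj (?i x)"
        proof (cases "x \<in> U")
          case True
          have "(\<lambda>j. x + z j) \<longlonglongrightarrow> x" using tendsto_add[OF tendsto_const z, of x] by simp
          then have "eventually (\<lambda>j. x + z j \<in> U) sequentially"
            using U(1) True by (rule topological_tendstoD)
          then have "eventually (\<lambda>j. t j x * cnj (?i x) = ?i x * cnj (?i x)) sequentially"
            by eventually_elim (simp add: t_def True)
          then show ?thesis by (rule tendsto_eventually)
        qed simp
      qed
      show "AE x in lborel. norm (t j x * cnj (?i x)) \<le> (cmod (?i x))\<^sup>2" for j
        by (rule AE_I2) (auto simp: t_def split: split_indicator)
    qed (auto simp: t_def)
    then have 1: "(\<lambda>j. Re (ip lborel (t j) ?i)) \<longlonglongrightarrow> Re (ip lborel ?i ?i)" by (intro tendsto_intros)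
    have 2: "Re (ip lborel (t j) (t j)) = Re (ip lborel ?i ?i)" for j
    proof -
      have "normsq lborel (t j) = normsq lborel ?i" unfolding t_def[abs_def] by (rule normsq_translate) measurable
      then show ?thesis by (simp add: normsq_eq_ip(1)[OF t] normsq_eq_ip(1)[OF i])
    qed
    have 3: "normsq lborel (\<lambda>x. t j x - ?i x) = ennreal (2 * Re (ip lborel ?i ?i) - 2 * Re (ip lborel (t j) ?i))" for j
      using normsq_add_expand[OF t i, of j "-1"] by (subst normsq_eq_ip(2)[OF sqint_diff[OF t i]]) (simp add: 2)
    have "(\<lambda>j. ennreal (2 * Re (ip lborel ?i ?i) - 2 * Re (ip lborel (t j) ?i))) \<longlonglongrightarrow>
        ennreal (2 * Re (ip lborel ?i ?i) - 2 * Re (ip lborel ?i ?i))"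
      by (intro tendsto_ennrealI tendsto_intros 1)
    then have "sq_tendsto lborel t ?i" by (simp add: sq_tendsto_def 3)
    with i show "?i \<in> V" by (simp add: V_def t_def[abs_def])
  qed
  with f show ?thesis unfolding V_def by blast
qed

subsection \<open>Gaussians\<close>

lemma borel_measurable_cis [measurable (raw)]:
  "f \<in> borel_measurable M \<Longrightarrow> (\<lambda>x. cis (f x)) \<in> borel_measurable M"
  by (rule borel_measurable_continuous_on[where f=cis]) (auto intro: continuous_intros)

text \<open>Normalized to be its own Fourier transform.\<close>

definition gauss :: "'a::euclidean_space \<Rightarrow> real" where
  "gauss x = exp (- pi * (norm x)\<^sup>2)"

lemma borel_measurable_gauss [measurable]: "gauss \<in> borel_measurable borel"
  unfolding gauss_def[abs_def] by measurable

lemma gauss_prod: "gauss (x :: 'a::euclidean_space) = (\<Prod>b\<in>Basis. exp (- pi * (x \<bullet> b)\<^sup>2))"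
  unfolding gauss_def power2_norm_eq_inner
  by (subst euclidean_inner) (simp add: exp_sum sum_distrib_left power2_eq_square)

lemma gauss_le_1: "0 < gauss x" "gauss x \<le> 1"
  by (auto simp: gauss_def)

lemma integral_lborel_prod_Basis:
  fixes f :: "'a::euclidean_space \<Rightarrow> real \<Rightarrow> complex"
  assumes f: "\<And>b. b \<in> Basis \<Longrightarrow> integrable lborel (f b)"
  shows "integrable lborel (\<lambda>x. \<Prod>b\<in>Basis. f b (x \<bullet> b))"
    "(LINT x|lborel. (\<Prod>b\<in>Basis. f b (x \<bullet> b))) = (\<Prod>b\<in>Basis. LINT x|lborel. f b x)"
proof -
  interpret product_sigma_finite "\<lambda>_::'a. lborel :: real measure" by standard
  have [measurable]: "\<And>b. b \<in> Basis \<Longrightarrow> f b \<in> borel_measurable borel" using f by auto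
  have *: "(\<Prod>b\<in>Basis. f b ((\<Sum>b\<in>Basis. g b *\<^sub>R b) \<bullet> b)) = (\<Prod>b\<in>Basis. f b (g b))" for g
    by (intro prod.cong) auto
  show "integrable lborel (\<lambda>x. \<Prod>b\<in>Basis. f b (x \<bullet> b))"
    unfolding lborel_eq[where 'a='a]
    by (subst integrable_distr_eq) (auto simp: * intro!: product_integrable_prod f)
  show "(LINT x|lborel. (\<Prod>b\<in>Basis. f b (x \<bullet> b))) = (\<Prod>b\<in>Basis. LINT x|lborel. f b x)"
    unfolding lborel_eq[where 'a='a]
    by (subst integral_distr) (auto simp: * intro!: product_integral_prod f)
qed

text \<open>The characteristic function of the standard normal distribution at \<open>\<surd>(2\<pi>) t\<close>, after the
  substitution \<open>x = \<surd>(2\<pi>) s\<close>.\<close>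

lemma gauss_integral_1:
  fixes t :: real
  shows "integrable lborel (\<lambda>s::real. complex_of_real (exp (- pi * s\<^sup>2)) * cis (2 * pi * (s * t)))"
    "(LINT s|lborel. complex_of_real (exp (- pi * s\<^sup>2)) * cis (2 * pi * (s * t))) = of_real (exp (- pi * t\<^sup>2))"
proof -
  define h where "h x = complex_of_real (std_normal_density x) * cis (sqrt (2 * pi) * t * x)" for x
  have hm [measurable]: "h \<in> borel_measurable borel" unfolding h_def[abs_def] by measurable
  have hi: "integrable lborel h"
    unfolding h_def[abs_def]
    by (rule Bochner_Integration.integrable_bound[OF integrable_normal_density[of 1 0]]) (auto simp: norm_mult)
  have "(LINT x|lborel. h x) = char std_normal_distribution (sqrt (2 * pi) * t)"
    unfolding char_def h_def
    by (subst integral_density) (auto simp: scaleR_conv_of_real cis_conv_exp)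
  also have "\<dots> = of_real (exp (- pi * t\<^sup>2))"
    by (simp add: char_std_normal_distribution power_mult_distrib)
  finally have I: "(LINT x|lborel. h x) = of_real (exp (- pi * t\<^sup>2))" .
  have eq: "of_real (sqrt (2 * pi)) * h (0 + sqrt (2 * pi) *\<^sub>R s) =
      complex_of_real (exp (- pi * s\<^sup>2)) * cis (2 * pi * (s * t))" for s
  proof -
    have e1: "sqrt (2 * pi) * std_normal_density (sqrt (2 * pi) * s) = exp (- pi * s\<^sup>2)"
      by (simp add: std_normal_density_def power_mult_distrib)
    have e2: "sqrt (2 * pi) * t * (sqrt (2 * pi) * s) = 2 * pi * (s * t)"
      by (simp add: algebra_simps)
    have "of_real (sqrt (2 * pi)) * h (0 + sqrt (2 * pi) *\<^sub>R s) =
        of_real (sqrt (2 * pi) * std_normal_density (sqrt (2 * pi) * s)) * cis (sqrt (2 * pi) * t * (sqrt (2 * pi) * s))"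
      unfolding h_def by simp
    then show ?thesis unfolding e1 e2 .
  qed
  have "integrable lborel (\<lambda>s::real. h (0 + sqrt (2 * pi) *\<^sub>R s))"
    by (rule integrable_lborel_affine[OF hi]) simp
  then have "integrable lborel (\<lambda>s::real. of_real (sqrt (2 * pi)) * h (0 + sqrt (2 * pi) *\<^sub>R s))"
    by simp
  then show "integrable lborel (\<lambda>s::real. complex_of_real (exp (- pi * s\<^sup>2)) * cis (2 * pi * (s * t)))"
    unfolding eq .
  have "(LINT x|lborel. h x) = of_real (sqrt (2 * pi)) * (LINT s|lborel. h (0 + sqrt (2 * pi) *\<^sub>R s))"
    by (subst integral_lborel_affine[of h "sqrt (2 * pi)" 0]) auto
  also have "\<dots> = (LINT s|lborel. of_real (sqrt (2 * pi)) * h (0 + sqrt (2 * pi) *\<^sub>R s))" by simp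
  finally show "(LINT s|lborel. complex_of_real (exp (- pi * s\<^sup>2)) * cis (2 * pi * (s * t))) = of_real (exp (- pi * t\<^sup>2))"
    using I unfolding eq by simp
qed

lemma cis_sum: "finite I \<Longrightarrow> cis (\<Sum>i\<in>I. f i) = (\<Prod>i\<in>I. cis (f i))"
  by (induct I rule: finite_induct) (auto simp: cis_mult[symmetric])

lemma gauss_integral:
  fixes x :: "'a::euclidean_space"
  shows "integrable lborel (\<lambda>w. complex_of_real (gauss w) * cis (2 * pi * (w \<bullet> x)))"
    "(LINT w|lborel. complex_of_real (gauss w) * cis (2 * pi * (w \<bullet> x))) = of_real (gauss x)"
proof -
  define f where "f b s = complex_of_real (exp (- pi * s\<^sup>2)) * cis (2 * pi * (s * (x \<bullet> b)))" for b :: 'a and s :: real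
  have eq: "complex_of_real (gauss w) * cis (2 * pi * (w \<bullet> x)) = (\<Prod>b\<in>Basis. f b (w \<bullet> b))" for w
    unfolding f_def by (subst euclidean_inner) (simp add: gauss_prod prod.distrib cis_sum sum_distrib_left)
  have fi: "integrable lborel (f b)" for b unfolding f_def[abs_def] by (rule gauss_integral_1)
  have fI: "(LINT s|lborel. f b s) = of_real (exp (- pi * (x \<bullet> b)\<^sup>2))" for b
    unfolding f_def by (rule gauss_integral_1)
  show "integrable lborel (\<lambda>w. complex_of_real (gauss w) * cis (2 * pi * (w \<bullet> x)))"
    unfolding eq by (rule integral_lborel_prod_Basis(1)[OF fi])
  show "(LINT w|lborel. complex_of_real (gauss w) * cis (2 * pi * (w \<bullet> x))) = of_real (gauss x)"
    unfolding eq by (subst integral_lborel_prod_Basis(2)[OF fi]) (simp add: fI gauss_prod)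
qed

lemma gauss_integrable: "integrable lborel (gauss :: 'a::euclidean_space \<Rightarrow> real)"
  and gauss_total: "(LINT w|lborel. gauss (w :: 'a::euclidean_space)) = 1"
proof -
  have "integrable lborel (\<lambda>w::'a. complex_of_real (gauss w))"
    "(LINT w|lborel. complex_of_real (gauss (w::'a))) = 1"
    using gauss_integral[of "0::'a"] by (simp_all add: gauss_def)
  then show "integrable lborel (gauss :: 'a \<Rightarrow> real)" "(LINT w|lborel. gauss (w :: 'a)) = 1"
    by (simp_all only: complex_of_real_integrable_eq integral_complex_of_real of_real_eq_1_iff)
qed

subsection \<open>The Fourier transform\<close>

definition ft :: "('a::euclidean_space \<Rightarrow> complex) \<Rightarrow> 'a \<Rightarrow> complex" where
  "ft f w = (LINT x|lborel. f x * cis (2 * pi * (w \<bullet> x)))"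

lemma borel_measurable_ft [measurable]:
  assumes [measurable]: "f \<in> borel_measurable borel"
  shows "ft f \<in> borel_measurable borel"
  unfolding ft_def[abs_def] by measurable

text \<open>The multiplication formula with a dilated Gaussian.\<close>

lemma ft_gauss:
  fixes A :: "'a::euclidean_space \<Rightarrow> complex"
  assumes A: "integrable lborel A" and e: "e \<noteq> 0"
  shows "(LINT w|lborel. gauss (e *\<^sub>R w) * ft A w) = (LINT z|lborel. A (e *\<^sub>R z) * gauss z)"
proof -
  have [measurable]: "A \<in> borel_measurable borel" using A by auto
  let ?h = "\<lambda>(w, z). complex_of_real (gauss (e *\<^sub>R w)) * (A z * cis (2 * pi * (w \<bullet> z)))"
  have "integrable lborel (\<lambda>w::'a. complex_of_real (gauss (0 + e *\<^sub>R w)))"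
    by (rule integrable_lborel_affine[OF _ e]) (simp add: gauss_integrable)
  then have gi: "integrable lborel (\<lambda>w::'a. complex_of_real (gauss (e *\<^sub>R w)))" by simp
  have int: "integrable (lborel \<Otimes>\<^sub>M lborel) ?h"
  proof (rule integrableI_bounded)
    have "(\<integral>\<^sup>+ p. ennreal (norm (?h p)) \<partial>(lborel \<Otimes>\<^sub>M lborel)) =
        (\<integral>\<^sup>+ w. \<integral>\<^sup>+ z. ennreal (norm (complex_of_real (gauss (e *\<^sub>R (w::'a))))) * ennreal (norm (A z)) \<partial>lborel \<partial>lborel)"
      by (subst lborel.nn_integral_fst[symmetric]) (auto simp: norm_mult ennreal_mult)
    also have "\<dots> < \<infinity>"
      using gi A unfolding integrable_iff_bounded
      by (simp add: nn_integral_cmult nn_integral_multc ennreal_mult_less_top)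
    finally show "(\<integral>\<^sup>+ p. ennreal (norm (?h p)) \<partial>(lborel \<Otimes>\<^sub>M lborel)) < \<infinity>" .
  qed measurable
  have "(LINT w|lborel. gauss (e *\<^sub>R w) * ft A w) = (LINT w|lborel. LINT z|lborel. ?h (w, z))"
    by (simp add: ft_def)
  also have "\<dots> = (LINT z|lborel. LINT w|lborel. ?h (w, z))"
    by (rule lborel_pair.Fubini_integral[symmetric]) (use int in simp)
  also have "\<dots> = (LINT z|lborel. A z * (of_real (1 / \<bar>e\<bar> ^ DIM('a)) * of_real (gauss ((1 / e) *\<^sub>R z))))"
  proof (intro Bochner_Integration.integral_cong refl)
    fix z :: 'a
    have "(LINT w|lborel. ?h (w, z)) = A z * (LINT w|lborel. complex_of_real (gauss (e *\<^sub>R w)) * cis (2 * pi * (w \<bullet> z)))"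
      by (simp add: ac_simps flip: integral_mult_right_zero)
    also have "(LINT w|lborel. complex_of_real (gauss (e *\<^sub>R w)) * cis (2 * pi * (w \<bullet> z))) =
       of_real (\<bar>1 / e\<bar> ^ DIM('a)) * (LINT w|lborel. complex_of_real (gauss w) * cis (2 * pi * (w \<bullet> ((1 / e) *\<^sub>R z))))"
      using e by (subst integral_lborel_affine[of _ "1 / e" 0]) auto
    also have "(LINT w|lborel. complex_of_real (gauss w) * cis (2 * pi * (w \<bullet> ((1 / e) *\<^sub>R z)))) = of_real (gauss ((1 / e) *\<^sub>R z))"
      by (rule gauss_integral)
    also have "\<bar>1 / e\<bar> ^ DIM('a) = 1 / \<bar>e\<bar> ^ DIM('a)" by (simp add: power_divide)
    finally show "(LINT w|lborel. ?h (w, z)) = A z * (of_real (1 / \<bar>e\<bar> ^ DIM('a)) * of_real (gauss ((1 / e) *\<^sub>R z)))" .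
  qed
  also have "\<dots> = (LINT z|lborel. A (e *\<^sub>R z) * gauss z)"
  proof -
    have "(LINT z|lborel. A z * (of_real (1 / \<bar>e\<bar> ^ DIM('a)) * of_real (gauss ((1 / e) *\<^sub>R z)))) =
        of_real (1 / \<bar>e\<bar> ^ DIM('a)) * (LINT z|lborel. A z * of_real (gauss ((1 / e) *\<^sub>R z)))"
      by (subst mult.left_commute) (rule integral_mult_right_zero)
    also have "(LINT z|lborel. A z * of_real (gauss ((1 / e) *\<^sub>R z))) =
        of_real (\<bar>e\<bar> ^ DIM('a)) * (LINT z|lborel. A (e *\<^sub>R z) * gauss z)"
      using e by (subst integral_lborel_affine[of _ e 0]) auto
    finally show ?thesis using e by simp
  qed
  finally show ?thesis .
qed

definition autocorr :: "('a::euclidean_space \<Rightarrow> complex) \<Rightarrow> 'a \<Rightarrow> complex" where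
  "autocorr f z = (LINT x|lborel. f x * cnj (f (x - z)))"

text \<open>The convolution theorem for \<open>f\<close> and its reflected conjugate.\<close>

lemma autocorr_ft:
  assumes f: "integrable lborel f"
  shows "integrable lborel (autocorr f)" "ft (autocorr f) w = of_real ((cmod (ft f w))\<^sup>2)"
proof -
  have [measurable]: "f \<in> borel_measurable borel" using f by auto
  have int: "integrable (lborel \<Otimes>\<^sub>M lborel) (\<lambda>(x, z). f x * cnj (f (x - z)) * cis (2 * pi * (w \<bullet> z)))" for w
  proof (rule integrableI_bounded)
    have "(\<integral>\<^sup>+ p. ennreal (norm (case p of (x, z) \<Rightarrow> f x * cnj (f (x - z)) * cis (2 * pi * (w \<bullet> z)))) \<partial>(lborel \<Otimes>\<^sub>M lborel)) =
        (\<integral>\<^sup>+ x. \<integral>\<^sup>+ z. ennreal (norm (f x)) * ennreal (norm (f (x - z))) \<partial>lborel \<partial>lborel)"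
      by (subst lborel.nn_integral_fst[symmetric]) (auto simp: norm_mult ennreal_mult)
    also have "\<dots> = (\<integral>\<^sup>+ x. ennreal (norm (f x)) * (\<integral>\<^sup>+ z. ennreal (norm (f z)) \<partial>lborel) \<partial>lborel)"
    proof (intro nn_integral_cong)
      fix x
      have "(\<integral>\<^sup>+ z. ennreal (norm (f z)) \<partial>lborel) = (\<integral>\<^sup>+ z. ennreal (norm (f (x - z))) \<partial>lborel)"
        by (subst nn_integral_lborel_affine[of _ "-1" x]) auto
      then show "(\<integral>\<^sup>+ z. ennreal (norm (f x)) * ennreal (norm (f (x - z))) \<partial>lborel) =
          ennreal (norm (f x)) * (\<integral>\<^sup>+ z. ennreal (norm (f z)) \<partial>lborel)"
        by (simp add: nn_integral_cmult)
    qed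
    also have "\<dots> < \<infinity>" using f by (simp add: nn_integral_multc integrable_iff_bounded ennreal_mult_less_top)
    finally show "(\<integral>\<^sup>+ p. ennreal (norm (case p of (x, z) \<Rightarrow> f x * cnj (f (x - z)) * cis (2 * pi * (w \<bullet> z)))) \<partial>(lborel \<Otimes>\<^sub>M lborel)) < \<infinity>" .
  qed measurable
  show "integrable lborel (autocorr f)"
    using lborel_pair.integrable_snd[OF int[of 0]] by (simp add: autocorr_def[abs_def])
  have "ft (autocorr f) w = (LINT z|lborel. LINT x|lborel. f x * cnj (f (x - z)) * cis (2 * pi * (w \<bullet> z)))"
    by (simp add: ft_def autocorr_def)
  also have "\<dots> = (LINT x|lborel. LINT z|lborel. f x * cnj (f (x - z)) * cis (2 * pi * (w \<bullet> z)))"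
    by (rule lborel_pair.Fubini_integral[OF int])
  also have "\<dots> = (LINT x|lborel. f x * cis (2 * pi * (w \<bullet> x)) * cnj (ft f w))"
  proof (intro Bochner_Integration.integral_cong refl)
    fix x
    have "cis (2 * pi * (w \<bullet> x)) * cnj (ft f w) = (LINT y|lborel. cis (2 * pi * (w \<bullet> x)) * cnj (f y * cis (2 * pi * (w \<bullet> y))))"
      unfolding ft_def by (simp flip: Bochner_Integration.integral_cnj)
    also have "\<dots> = (LINT z|lborel. cnj (f (x - z)) * cis (2 * pi * (w \<bullet> z)))"
    proof -
      have "cis (2 * pi * (w \<bullet> x)) * cnj (cis (2 * pi * (w \<bullet> (x - z)))) = cis (2 * pi * (w \<bullet> z))" for z
        by (simp add: cis_cnj cis_mult inner_diff_right algebra_simps)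
      then have *: "cis (2 * pi * (w \<bullet> x)) * cnj (f (x - z) * cis (2 * pi * (w \<bullet> (x - z)))) = cnj (f (x - z)) * cis (2 * pi * (w \<bullet> z))" for z
        by (metis complex_cnj_mult mult.left_commute)
      have "(LINT y|lborel. cis (2 * pi * (w \<bullet> x)) * cnj (f y * cis (2 * pi * (w \<bullet> y)))) =
          (LINT z|lborel. cis (2 * pi * (w \<bullet> x)) * cnj (f (x - z) * cis (2 * pi * (w \<bullet> (x - z)))))"
        by (subst integral_lborel_affine[of _ "-1" x]) auto
      then show ?thesis unfolding * .
    qed
    finally show "(LINT z|lborel. f x * cnj (f (x - z)) * cis (2 * pi * (w \<bullet> z))) = f x * cis (2 * pi * (w \<bullet> x)) * cnj (ft f w)"
      by (simp add: mult.assoc)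
  qed
  also have "\<dots> = ft f w * cnj (ft f w)" by (simp add: ft_def)
  also have "\<dots> = of_real ((cmod (ft f w))\<^sup>2)" by (rule complex_norm_square[symmetric])
  finally show "ft (autocorr f) w = of_real ((cmod (ft f w))\<^sup>2)" .
qed

text \<open>The transform of the autocorrelation \<open>A\<close> of \<open>f\<close> is \<open>|ft f|\<^sup>2\<close>.  Damped by
  \<open>gauss (\<epsilon> w)\<close>, its integral is the average of \<open>A (\<epsilon> z)\<close> against \<open>gauss z\<close>.  As \<open>\<epsilon>\<close>
  decreases to \<open>0\<close>, the former increases to the square norm of \<open>ft f\<close>, and the latter tends to
  \<open>A 0\<close>, the square norm of \<open>f\<close>, because \<open>A\<close> is bounded and continuous at \<open>0\<close>.\<close>

theorem Plancherel_euclidean: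
  fixes f :: "'a::euclidean_space \<Rightarrow> complex"
  assumes f1: "integrable lborel f" and f2: "f \<in> sqint lborel"
  shows "normsq lborel (ft f) = normsq lborel f"
proof -
  have [measurable]: "f \<in> borel_measurable borel" using f1 by auto
  define A where "A = autocorr f"
  have A_int: "integrable lborel A" and A_ft: "ft A w = of_real ((cmod (ft f w))\<^sup>2)" for w
    unfolding A_def using autocorr_ft[OF f1] by auto
  have A_ip: "A z = ip lborel f (\<lambda>x. f (x + (- z)))" for z by (simp add: A_def autocorr_def ip_def)
  have [measurable]: "A \<in> borel_measurable borel" using A_int by auto
  define S where "S = Re (ip lborel f f)"
  have S: "normsq lborel f = ennreal S" "ip lborel f f = of_real S" "S \<ge> 0"
    using normsq_eq_ip[OF f2] Re_ip_self_nonneg[of lborel f] by (auto simp: S_def complex_eq_iff)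
  have A_bound: "cmod (A z) \<le> S" for z
  proof -
    have "ennreal ((cmod (A z))\<^sup>2) \<le> normsq lborel f * normsq lborel (\<lambda>x. f (x + (- z)))"
      unfolding A_ip by (intro ip_Cauchy_Schwarz f2 sqint_translate)
    also have "\<dots> = ennreal (S\<^sup>2)"
      using S by (subst normsq_translate) (auto simp: power2_eq_square ennreal_mult)
    finally have "(cmod (A z))\<^sup>2 \<le> S\<^sup>2" by (subst (asm) ennreal_le_iff) auto
    then show ?thesis using S(3) by (rule power2_le_imp_le)
  qed
  define e where "e j = inverse (real (Suc j))" for j
  have e: "e j > 0" "e \<longlonglongrightarrow> 0" for j unfolding e_def using LIMSEQ_inverse_real_of_nat by auto
  have A_lim: "(\<lambda>j. A (e j *\<^sub>R z)) \<longlonglongrightarrow> of_real S" for z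
  proof -
    have "(\<lambda>j. - (e j *\<^sub>R z)) \<longlonglongrightarrow> - (0 *\<^sub>R z)" by (intro tendsto_intros e)
    then have "sq_tendsto lborel (\<lambda>j x. f (x + - (e j *\<^sub>R z))) f"
      by (intro translation_continuous[OF f2]) simp
    then have "(\<lambda>j. ip lborel (\<lambda>x. f (x + - (e j *\<^sub>R z))) f) \<longlonglongrightarrow> ip lborel f f"
      by (rule ip_tendsto_left) (intro sqint_translate f2)+
    then have "(\<lambda>j. cnj (ip lborel (\<lambda>x. f (x + - (e j *\<^sub>R z))) f)) \<longlonglongrightarrow> cnj (ip lborel f f)"
      by (intro tendsto_intros)
    then show ?thesis unfolding A_ip by (subst ip_commute) (simp add: S(2))
  qed
  have "(\<lambda>j. LINT z|lborel. A (e j *\<^sub>R z) * of_real (gauss z)) \<longlonglongrightarrow> (LINT z|lborel. of_real S * of_real (gauss (z::'a)))"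
  proof (rule integral_dominated_convergence)
    show "integrable lborel (\<lambda>z::'a. S * gauss z)" using gauss_integrable[where 'a='a] by simp
    show "AE z in lborel. (\<lambda>j. A (e j *\<^sub>R z) * of_real (gauss z)) \<longlonglongrightarrow> of_real S * of_real (gauss z)"
      by (intro AE_I2 tendsto_intros A_lim)
    show "AE z in lborel. norm (A (e j *\<^sub>R z) * of_real (gauss z)) \<le> S * gauss z" for j
      using gauss_le_1(1)[THEN less_imp_le] by (intro AE_I2) (auto simp: norm_mult intro!: mult_mono A_bound S)
  qed measurable
  also have "(LINT z|lborel. complex_of_real S * of_real (gauss (z::'a))) = of_real S"
    using gauss_total[where 'a='a] by simp
  finally have lim1: "(\<lambda>j. LINT w|lborel. gauss (e j *\<^sub>R w) * ft A w) \<longlonglongrightarrow> of_real S"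
    using ft_gauss[OF A_int] e(1) by (simp add: less_imp_neq[symmetric])
  have conv: "(\<integral>\<^sup>+w. ennreal (gauss (e j *\<^sub>R w) * (cmod (ft f w))\<^sup>2) \<partial>lborel) = ennreal (Re (LINT w|lborel. gauss (e j *\<^sub>R w) * ft A w))" for j
  proof -
    have eq: "(LINT w|lborel. gauss (e j *\<^sub>R w) * ft A w) = of_real (LINT w|lborel. gauss (e j *\<^sub>R w) * (cmod (ft f w))\<^sup>2)"
      unfolding A_ft by (simp flip: of_real_mult of_real_power)
    have "integrable lborel (\<lambda>w::'a. complex_of_real (gauss (0 + e j *\<^sub>R w)))"
      by (rule integrable_lborel_affine) (use gauss_integrable[where 'a='a] e(1)[of j] in auto)
    then have gi: "integrable lborel (\<lambda>w::'a. gauss (e j *\<^sub>R w))" by (simp add: complex_of_real_integrable_eq)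
    define B where "B = (LINT x|lborel. cmod (f x))"
    have ftb: "cmod (ft f w) \<le> B" for w
      unfolding ft_def B_def using integral_norm_bound[of lborel "\<lambda>x. f x * cis (2 * pi * (w \<bullet> x))"] by (simp add: norm_mult)
    have "integrable lborel (\<lambda>w::'a. gauss (e j *\<^sub>R w) * (cmod (ft f w))\<^sup>2)"
    proof (rule Bochner_Integration.integrable_bound)
      show "integrable lborel (\<lambda>w::'a. gauss (e j *\<^sub>R w) * B\<^sup>2)" using gi by simp
      show "AE w in lborel. norm (gauss (e j *\<^sub>R w) * (cmod (ft f w))\<^sup>2) \<le> norm (gauss (e j *\<^sub>R w) * B\<^sup>2)"
        using gauss_le_1(1)[THEN less_imp_le] ftb by (intro AE_I2) (auto simp: abs_mult intro!: mult_mono power_mono)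
    qed measurable
    then show ?thesis
      unfolding eq using gauss_le_1(1)[THEN less_imp_le] by (subst nn_integral_eq_integral) (auto intro!: AE_I2 mult_nonneg_nonneg)
  qed
  have "(\<lambda>j. \<integral>\<^sup>+w. ennreal (gauss (e j *\<^sub>R w) * (cmod (ft f w))\<^sup>2) \<partial>lborel) \<longlonglongrightarrow> normsq lborel (ft f)"
    unfolding normsq_def
  proof (rule nn_integral_LIMSEQ)
    have mono: "gauss (e i *\<^sub>R w) \<le> gauss (e j *\<^sub>R w)" if "i \<le> j" for i j and w :: 'a
    proof -
      have "e j \<le> e i" using that unfolding e_def by (intro le_imp_inverse_le) auto
      then have "(e j)\<^sup>2 \<le> (e i)\<^sup>2" using e(1)[of j] by (intro power_mono) auto
      then show ?thesis by (simp add: gauss_def power_mult_distrib mult_right_mono)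
    qed
    show "incseq (\<lambda>j w. ennreal (gauss (e j *\<^sub>R w) * (cmod (ft f w))\<^sup>2))"
      using mono by (auto simp: incseq_def le_fun_def intro!: ennreal_leI mult_right_mono)
    fix w :: 'a
    have "(\<lambda>j. gauss (e j *\<^sub>R w)) \<longlonglongrightarrow> gauss (0 *\<^sub>R w)"
      unfolding gauss_def by (intro tendsto_intros e)
    then have "(\<lambda>j. gauss (e j *\<^sub>R w)) \<longlonglongrightarrow> 1" by (simp add: gauss_def)
    then have "(\<lambda>j. ennreal (gauss (e j *\<^sub>R w) * (cmod (ft f w))\<^sup>2)) \<longlonglongrightarrow> ennreal (1 * (cmod (ft f w))\<^sup>2)"
      by (intro tendsto_intros tendsto_ennrealI)
    then show "(\<lambda>j. ennreal (gauss (e j *\<^sub>R w) * (cmod (ft f w))\<^sup>2)) \<longlonglongrightarrow> ennreal ((cmod (ft f w))\<^sup>2)" by simp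
  qed measurable
  moreover have "(\<lambda>j. \<integral>\<^sup>+w. ennreal (gauss (e j *\<^sub>R w) * (cmod (ft f w))\<^sup>2) \<partial>lborel) \<longlonglongrightarrow> ennreal S"
    unfolding conv using tendsto_Re[OF lim1] by (intro tendsto_ennrealI) simp
  ultimately show ?thesis using LIMSEQ_unique S(1) by auto
qed

section \<open>Integral operators and their Hilbert--Schmidt norm\<close>

lemma borel_measurable_fst_snd [measurable (raw)]:
  fixes f :: "'x \<Rightarrow> 'a::second_countable_topology \<times> 'b::second_countable_topology"
  assumes "f \<in> borel_measurable M"
  shows "(\<lambda>x. fst (f x)) \<in> borel_measurable M" "(\<lambda>x. snd (f x)) \<in> borel_measurable M"
  using assms by (auto intro!: borel_measurable_continuous_on[where g=f] continuous_intros)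

lemma nn_integral_lborel_pair:
  fixes f :: "'a::euclidean_space \<times> 'b::euclidean_space \<Rightarrow> ennreal"
  assumes "f \<in> borel_measurable borel"
  shows "(\<integral>\<^sup>+p. f p \<partial>lborel) = (\<integral>\<^sup>+x. \<integral>\<^sup>+y. f (x, y) \<partial>lborel \<partial>lborel)"
  using assms by (subst lborel_prod[symmetric], subst lborel.nn_integral_fst) (simp_all add: lborel_prod)

lemma nn_integral_lborel_swap:
  fixes f :: "'a::euclidean_space \<Rightarrow> 'b::euclidean_space \<Rightarrow> ennreal"
  assumes "(\<lambda>p. f (fst p) (snd p)) \<in> borel_measurable borel"
  shows "(\<integral>\<^sup>+x. \<integral>\<^sup>+y. f x y \<partial>lborel \<partial>lborel) = (\<integral>\<^sup>+y. \<integral>\<^sup>+x. f x y \<partial>lborel \<partial>lborel)"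
  using assms by (intro lborel_pair.Fubini'[symmetric]) (simp add: lborel_prod split_beta')

lemma scaleR_half_sum:
  fixes x y :: "'a::real_vector"
  shows "(c / 2) *\<^sub>R (x + (y + x)) = (c / 2) *\<^sub>R y + c *\<^sub>R x"
proof -
  have "x + (y + x) = y + 2 *\<^sub>R x" by (simp only: scaleR_2 add_ac)
  then show ?thesis by (simp only: scaleR_add_right scaleR_scaleR) simp
qed

lemma normsq_pair:
  fixes k :: "'a::euclidean_space \<times> 'b::euclidean_space \<Rightarrow> complex"
  assumes [measurable]: "k \<in> borel_measurable borel"
  shows "normsq lborel k = (\<integral>\<^sup>+x. normsq lborel (\<lambda>y. k (x, y)) \<partial>lborel)"
  unfolding normsq_def by (rule nn_integral_lborel_pair) measurable

lemma sqint_section: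
  fixes k :: "'a::euclidean_space \<times> 'b::euclidean_space \<Rightarrow> complex"
  assumes k: "k \<in> sqint lborel"
  shows "AE x in lborel. (\<lambda>y. k (x, y)) \<in> sqint lborel"
proof -
  have [measurable]: "k \<in> borel_measurable borel" using sqintD(1)[OF k] by simp
  have "(\<integral>\<^sup>+x. normsq lborel (\<lambda>y. k (x, y)) \<partial>lborel) \<noteq> \<infinity>"
    using sqintD(2)[OF k] by (simp add: normsq_pair)
  then have "AE x in lborel. normsq lborel (\<lambda>y. k (x, y)) \<noteq> \<infinity>"
    unfolding normsq_def by (intro nn_integral_PInf_AE) measurable
  then show ?thesis
    by eventually_elim (auto intro!: sqintI simp: less_top)
qed

definition kernel_op :: "((real ^ 'n) \<times> (real ^ 'n) \<Rightarrow> complex) \<Rightarrow> 'n::finite op" where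
  "kernel_op k u \<xi> = (LINT \<eta>|lborel. k (\<xi>, \<eta>) * u \<eta>)"

lemma kernel_op_ip: "kernel_op k u \<xi> = ip lborel (\<lambda>\<eta>. k (\<xi>, \<eta>)) (\<lambda>\<eta>. cnj (u \<eta>))"
  by (simp add: kernel_op_def ip_def)

lemma borel_measurable_kernel_op [measurable]:
  assumes [measurable]: "k \<in> borel_measurable borel" "u \<in> borel_measurable borel"
  shows "kernel_op k u \<in> borel_measurable borel"
  unfolding kernel_op_def[abs_def] by measurable

lemma normsq_kernel_op_le:
  assumes k: "k \<in> sqint lborel" and u: "u \<in> sqint lborel"
  shows "normsq lborel (kernel_op k u) \<le> normsq lborel k * normsq lborel u"
proof -
  have [measurable]: "k \<in> borel_measurable borel" "u \<in> borel_measurable borel"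
    using sqintD(1)[OF k] sqintD(1)[OF u] by simp_all
  have "normsq lborel (kernel_op k u) \<le> (\<integral>\<^sup>+\<xi>. normsq lborel (\<lambda>\<eta>. k (\<xi>, \<eta>)) * normsq lborel u \<partial>lborel)"
    unfolding normsq_def[of lborel "kernel_op k u"]
  proof (rule nn_integral_mono_AE, use sqint_section[OF k] in eventually_elim)
    fix \<xi> assume "(\<lambda>\<eta>. k (\<xi>, \<eta>)) \<in> sqint lborel"
    from ip_Cauchy_Schwarz[OF this sqint_cnj[OF u]]
    show "ennreal ((cmod (kernel_op k u \<xi>))\<^sup>2) \<le> normsq lborel (\<lambda>\<eta>. k (\<xi>, \<eta>)) * normsq lborel u"
      by (simp add: kernel_op_ip normsq_def)
  qed
  also have "\<dots> = normsq lborel k * normsq lborel u"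
  proof -
    have "(\<lambda>\<xi>. normsq lborel (\<lambda>\<eta>. k (\<xi>, \<eta>))) \<in> borel_measurable lborel"
      unfolding normsq_def by measurable
    then show ?thesis by (simp add: nn_integral_multc normsq_pair)
  qed
  finally show ?thesis .
qed

lemma kernel_op_sqint:
  assumes k: "k \<in> sqint lborel" and u: "u \<in> sqint lborel"
  shows "kernel_op k u \<in> sqint lborel"
proof (rule sqintI)
  have [measurable]: "k \<in> borel_measurable borel" "u \<in> borel_measurable borel"
    using sqintD(1)[OF k] sqintD(1)[OF u] by simp_all
  show "kernel_op k u \<in> borel_measurable lborel" by simp
  show "normsq lborel (kernel_op k u) < \<infinity>"
    using normsq_kernel_op_le[OF k u] sqintD(2)[OF k] sqintD(2)[OF u]
    by (auto intro: le_less_trans simp: ennreal_mult_less_top)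
qed

lemma kernel_op_diff:
  assumes k: "k \<in> sqint lborel" and l: "l \<in> sqint lborel" and u: "u \<in> sqint lborel"
  shows "AE \<xi> in lborel. kernel_op (\<lambda>p. k p - l p) u \<xi> = kernel_op k u \<xi> - kernel_op l u \<xi>"
  using sqint_section[OF k] sqint_section[OF l]
  by eventually_elim (simp add: kernel_op_ip ip_diff_left sqint_cnj[OF u])

text \<open>Parseval's identity, applied to \<open>k (\<xi>, \<cdot>)\<close> for almost every \<open>\<xi>\<close>.\<close>

lemma HS_normsq_kernel_op:
  assumes k: "k \<in> sqint lborel"
  shows "HS_normsq (kernel_op k) = normsq lborel k"
proof -
  have [measurable]: "k \<in> borel_measurable borel" using sqintD(1)[OF k] by simp
  have [measurable]: "L2_basis i \<in> borel_measurable borel" for i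
    using sqintD(1)[OF L2_basis_sqint] by simp
  have "HS_normsq (kernel_op k) = (\<Sum>i. \<integral>\<^sup>+\<xi>. ennreal ((cmod (kernel_op k (L2_basis i) \<xi>))\<^sup>2) \<partial>lborel)"
    by (simp add: HS_normsq_def L2_normsq_def)
  also have "\<dots> = (\<integral>\<^sup>+\<xi>. (\<Sum>i. ennreal ((cmod (kernel_op k (L2_basis i) \<xi>))\<^sup>2)) \<partial>lborel)"
    by (rule nn_integral_suminf[symmetric]) measurable
  also have "\<dots> = (\<integral>\<^sup>+\<xi>. normsq lborel (\<lambda>\<eta>. k (\<xi>, \<eta>)) \<partial>lborel)"
  proof (rule nn_integral_cong_AE, use sqint_section[OF k] in eventually_elim)
    fix \<xi> assume k\<xi>: "(\<lambda>\<eta>. k (\<xi>, \<eta>)) \<in> sqint lborel"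
    have "cmod (kernel_op k (L2_basis i) \<xi>) = cmod (ip lborel (\<lambda>\<eta>. cnj (k (\<xi>, \<eta>))) (L2_basis i))" for i
    proof -
      have "kernel_op k (L2_basis i) \<xi> = cnj (ip lborel (\<lambda>\<eta>. cnj (k (\<xi>, \<eta>))) (L2_basis i))"
        unfolding kernel_op_def ip_def by (subst Bochner_Integration.integral_cnj[symmetric]) simp
      then show ?thesis by simp
    qed
    then show "(\<Sum>i. ennreal ((cmod (kernel_op k (L2_basis i) \<xi>))\<^sup>2)) = normsq lborel (\<lambda>\<eta>. k (\<xi>, \<eta>))"
      using L2_basis_Parseval[OF sqint_cnj[OF k\<xi>]] by (simp add: normsq_def)
  qed
  finally show ?thesis by (simp add: normsq_pair)
qed

lemma kernel_op_HS:
  assumes k: "k \<in> sqint lborel"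
  shows "kernel_op k \<in> HS"
proof -
  have "AE \<xi> in lborel. kernel_op k (\<lambda>y. a * u y + b * v y) \<xi> = a * kernel_op k u \<xi> + b * kernel_op k v \<xi>"
    if u: "u \<in> sqint lborel" and v: "v \<in> sqint lborel" for u v a b
    using sqint_section[OF k]
  proof eventually_elim
    fix \<xi> assume s: "(\<lambda>\<eta>. k (\<xi>, \<eta>)) \<in> sqint lborel"
    have i: "integrable lborel (\<lambda>\<eta>. k (\<xi>, \<eta>) * u \<eta>)" "integrable lborel (\<lambda>\<eta>. k (\<xi>, \<eta>) * v \<eta>)"
      using sqint_mult_integrable[OF s sqint_cnj[OF u]] sqint_mult_integrable[OF s sqint_cnj[OF v]] by simp_all
    have "k (\<xi>, \<eta>) * (a * u \<eta> + b * v \<eta>) = a * (k (\<xi>, \<eta>) * u \<eta>) + b * (k (\<xi>, \<eta>) * v \<eta>)" for \<eta>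
      by (simp add: algebra_simps)
    then show "kernel_op k (\<lambda>y. a * u y + b * v y) \<xi> = a * kernel_op k u \<xi> + b * kernel_op k v \<xi>"
      using i by (simp add: kernel_op_def)
  qed
  moreover have "\<exists>C. \<forall>u\<in>L2. L2_normsq (kernel_op k u) \<le> ennreal C * L2_normsq u"
  proof (intro exI ballI)
    fix u :: "real ^ 'a \<Rightarrow> complex" assume "u \<in> L2"
    then show "L2_normsq (kernel_op k u) \<le> ennreal (enn2real (normsq lborel k)) * L2_normsq u"
      using normsq_kernel_op_le[OF k, of u] sqintD(2)[OF k] by (simp add: L2_normsq_eq L2_eq_sqint)
  qed
  ultimately have "bounded_operator (kernel_op k)"
    unfolding bounded_operator_def by (simp add: L2_eq_sqint kernel_op_sqint[OF k])
  then show ?thesis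
    using sqintD(2)[OF k] by (simp add: HS_def HS_normsq_kernel_op[OF k])
qed

section \<open>The Fourier transform of an integrable function on the Heisenberg group\<close>

text \<open>The Haar integral with the \<open>y\<close>-variable first: for fixed \<open>y\<close>, the variables \<open>x\<close> and
  \<open>t\<close> are those in which the group transform is an ordinary Fourier transform.\<close>

lemma distr_heis_perm:
  "distr lborel borel (\<lambda>(y, x, t). (x, y, t)) = (lborel :: 'n::finite heis measure)"
proof (rule measure_eqI)
  fix A :: "'n heis set" assume "A \<in> sets (distr lborel borel (\<lambda>(y, x, t). (x, y, t)))"
  then have A [measurable]: "A \<in> sets borel" by simp
  define g where "g = (indicator A :: 'n heis \<Rightarrow> ennreal)"
  have [measurable]: "g \<in> borel_measurable borel" unfolding g_def by measurable
  have T: "(\<lambda>(y, x, t). (x, y, t)) \<in> borel_measurable (borel :: ((real ^ 'n) \<times> (real ^ 'n) \<times> real) measure)"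
    unfolding split_beta' by measurable
  have "emeasure (distr lborel borel (\<lambda>(y, x, t). (x, y, t))) A = (\<integral>\<^sup>+p. g p \<partial>distr lborel borel (\<lambda>(y, x, t). (x, y, t)))"
    by (simp add: g_def)
  also have "\<dots> = (\<integral>\<^sup>+p. g (fst (snd p), fst p, snd (snd p)) \<partial>lborel)"
    using T by (subst nn_integral_distr) (auto simp: split_beta')
  also have "\<dots> = (\<integral>\<^sup>+y. \<integral>\<^sup>+x. \<integral>\<^sup>+t. g (x, y, t) \<partial>lborel \<partial>lborel \<partial>lborel)"
    by (simp add: nn_integral_lborel_pair)
  also have "\<dots> = (\<integral>\<^sup>+x. \<integral>\<^sup>+y. \<integral>\<^sup>+t. g (x, y, t) \<partial>lborel \<partial>lborel \<partial>lborel)"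
    by (rule nn_integral_lborel_swap) measurable
  also have "\<dots> = (\<integral>\<^sup>+p. g p \<partial>lborel)"
    by (simp add: nn_integral_lborel_pair)
  finally show "emeasure (distr lborel borel (\<lambda>(y, x, t). (x, y, t))) A = emeasure lborel A"
    by (simp add: g_def)
qed simp

definition slice :: "('n::finite heis \<Rightarrow> complex) \<Rightarrow> real ^ 'n \<Rightarrow> (real ^ 'n) \<times> real \<Rightarrow> complex" where
  "slice f y p = f (fst p, y, snd p)"

lemma nn_integral_heis:
  fixes f :: "'n::finite heis \<Rightarrow> ennreal"
  assumes [measurable]: "f \<in> borel_measurable borel"
  shows "(\<integral>\<^sup>+X. f X \<partial>lborel) = (\<integral>\<^sup>+y. \<integral>\<^sup>+p. f (fst p, y, snd p) \<partial>lborel \<partial>lborel)"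
proof -
  have "(\<integral>\<^sup>+X. f X \<partial>lborel) = (\<integral>\<^sup>+p. f (fst (snd p), fst p, snd (snd p)) \<partial>lborel)"
    by (subst distr_heis_perm[symmetric], subst nn_integral_distr) (auto simp: split_beta')
  also have "\<dots> = (\<integral>\<^sup>+y. \<integral>\<^sup>+p. f (fst p, y, snd p) \<partial>lborel \<partial>lborel)"
    by (subst nn_integral_lborel_pair) auto
  finally show ?thesis .
qed

lemma integral_heis:
  fixes f :: "'n::finite heis \<Rightarrow> complex"
  assumes f: "integrable lborel f"
  shows "(LINT X|lborel. f X) = (LINT y|lborel. LINT p|lborel. f (fst p, y, snd p))"
proof -
  have [measurable]: "f \<in> borel_measurable borel" using f by auto
  have i: "integrable lborel (\<lambda>p. f (fst (snd p), fst p, snd (snd p)))"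
    using f by (subst (asm) distr_heis_perm[symmetric], subst (asm) integrable_distr_eq) (auto simp: split_beta')
  have "(LINT X|lborel. f X) = (LINT p|lborel. f (fst (snd p), fst p, snd (snd p)))"
    by (subst distr_heis_perm[symmetric], subst integral_distr) (auto simp: split_beta')
  also have "\<dots> = (LINT y|lborel. LINT p|lborel. f (fst p, y, snd p))"
    using lborel_pair.integral_fst'[of "\<lambda>p. f (fst (snd p), fst p, snd (snd p))"] i by (simp add: lborel_prod)
  finally show ?thesis .
qed

lemma borel_measurable_slice [measurable (raw)]:
  assumes [measurable]: "f \<in> borel_measurable borel" "y \<in> borel_measurable M" "p \<in> borel_measurable M"
  shows "(\<lambda>x. slice f (y x) (p x)) \<in> borel_measurable M"
  unfolding slice_def by measurable

lemma borel_measurable_ft_slice [measurable (raw)]: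
  assumes [measurable]: "f \<in> borel_measurable borel" "y \<in> borel_measurable M" "w \<in> borel_measurable M"
  shows "(\<lambda>x. ft (slice f (y x)) (w x)) \<in> borel_measurable M"
  unfolding ft_def by measurable

text \<open>Integrating \<open>f (x, \<eta> - \<xi>, t)\<close> over \<open>x\<close> and \<open>t\<close> against the characters
  \<open>exp (2\<pi>\<i> \<lambda> x \<bullet> (\<xi> + \<eta>) / 2)\<close> and \<open>exp (2\<pi>\<i> \<lambda> t)\<close> gives the kernel of the transform of \<open>f\<close> at
  \<open>\<lambda>\<close>.\<close>

definition heis_kernel :: "('n::finite heis \<Rightarrow> complex) \<Rightarrow> real \<Rightarrow> (real ^ 'n) \<times> (real ^ 'n) \<Rightarrow> complex" where
  "heis_kernel f lam p = ft (slice f (snd p - fst p)) ((lam / 2) *\<^sub>R (fst p + snd p), lam)"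

lemma borel_measurable_heis_kernel [measurable (raw)]:
  assumes [measurable]: "f \<in> borel_measurable borel" "l \<in> borel_measurable M" "p \<in> borel_measurable M"
  shows "(\<lambda>x. heis_kernel f (l x) (p x)) \<in> borel_measurable M"
  unfolding heis_kernel_def by measurable

text \<open>A square-integrable \<open>u\<close> need not be bounded, but \<open>|u| \<le> 1 + |u|\<^sup>2\<close>, and the integral of
  \<open>|f (X)| |u (\<xi> + y)|\<^sup>2\<close> over both \<open>X\<close> and \<open>\<xi>\<close> is the product of the norms.\<close>

lemma fourier_L1_integrable:
  fixes f :: "'n::finite heis \<Rightarrow> complex"
  assumes f: "integrable lborel f" and u: "u \<in> sqint lborel"
  shows "AE \<xi> in lborel. integrable lborel (\<lambda>X. f X * schroedinger lam X u \<xi>)"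
proof -
  have [measurable]: "f \<in> borel_measurable borel" "u \<in> borel_measurable borel"
    using f sqintD(1)[OF u] by auto
  have bnd: "a * b \<le> a + a * b\<^sup>2" if "0 \<le> a" for a b :: real
  proof -
    have "2 * b \<le> b\<^sup>2 + 1" using sum_squares_bound[of b 1] by simp
    then have "b \<le> 1 + b\<^sup>2" using zero_le_power2[of b] by linarith
    then have "a * b \<le> a * (1 + b\<^sup>2)" using that by (rule mult_left_mono)
    then show ?thesis by (simp add: ring_distribs)
  qed
  have "(\<integral>\<^sup>+\<xi>. \<integral>\<^sup>+X. ennreal (cmod (f X)) * ennreal ((cmod (u (\<xi> + fst (snd X))))\<^sup>2) \<partial>lborel \<partial>lborel) =
      (\<integral>\<^sup>+X. \<integral>\<^sup>+\<xi>. ennreal (cmod (f X)) * ennreal ((cmod (u (\<xi> + fst (snd X))))\<^sup>2) \<partial>lborel \<partial>lborel)"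
    by (rule nn_integral_lborel_swap) measurable
  also have "\<dots> = (\<integral>\<^sup>+X. ennreal (cmod (f X)) * normsq lborel u \<partial>lborel)"
    unfolding normsq_def
    by (simp add: nn_integral_cmult nn_integral_lborel_translate[of "\<lambda>\<xi>. ennreal ((cmod (u \<xi>))\<^sup>2)"])
  also have "\<dots> < \<infinity>"
    using f sqintD(2)[OF u] by (simp add: nn_integral_multc integrable_iff_bounded ennreal_mult_less_top)
  finally have "(\<integral>\<^sup>+\<xi>. \<integral>\<^sup>+X. ennreal (cmod (f X)) * ennreal ((cmod (u (\<xi> + fst (snd X))))\<^sup>2) \<partial>lborel \<partial>lborel) \<noteq> \<infinity>"
    by simp
  then have "AE \<xi> in lborel. (\<integral>\<^sup>+X. ennreal (cmod (f X)) * ennreal ((cmod (u (\<xi> + fst (snd X))))\<^sup>2) \<partial>lborel) \<noteq> \<infinity>"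
    by (intro nn_integral_PInf_AE) measurable
  then show ?thesis
  proof eventually_elim
    fix \<xi> assume fin: "(\<integral>\<^sup>+X. ennreal (cmod (f X)) * ennreal ((cmod (u (\<xi> + fst (snd X))))\<^sup>2) \<partial>lborel) \<noteq> \<infinity>"
    show "integrable lborel (\<lambda>X. f X * schroedinger lam X u \<xi>)"
    proof (rule integrableI_bounded)
      show "(\<lambda>X. f X * schroedinger lam X u \<xi>) \<in> borel_measurable lborel"
        unfolding schroedinger_def split_beta' by measurable
      have "(\<integral>\<^sup>+X. ennreal (norm (f X * schroedinger lam X u \<xi>)) \<partial>lborel) \<le>
          (\<integral>\<^sup>+X. ennreal (cmod (f X)) + ennreal (cmod (f X)) * ennreal ((cmod (u (\<xi> + fst (snd X))))\<^sup>2) \<partial>lborel)"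
      proof (rule nn_integral_mono)
        fix X
        have "norm (f X * schroedinger lam X u \<xi>) = cmod (f X) * cmod (u (\<xi> + fst (snd X)))"
          by (simp add: schroedinger_def split_beta' norm_mult)
        also have "\<dots> \<le> cmod (f X) + cmod (f X) * (cmod (u (\<xi> + fst (snd X))))\<^sup>2" by (rule bnd) simp
        finally show "ennreal (norm (f X * schroedinger lam X u \<xi>)) \<le>
            ennreal (cmod (f X)) + ennreal (cmod (f X)) * ennreal ((cmod (u (\<xi> + fst (snd X))))\<^sup>2)"
          by (simp flip: ennreal_mult ennreal_plus)
      qed
      also have "\<dots> < \<infinity>"
        using f fin by (subst nn_integral_add) (auto simp: integrable_iff_bounded less_top)
      finally show "(\<integral>\<^sup>+X. ennreal (norm (f X * schroedinger lam X u \<xi>)) \<partial>lborel) < \<infinity>" .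
    qed
  qed
qed

text \<open>Carrying out the integration in \<open>x\<close> and \<open>t\<close> first and substituting \<open>y = \<eta> - \<xi>\<close>.\<close>

lemma fourier_L1_eq_kernel_op:
  fixes f :: "'n::finite heis \<Rightarrow> complex"
  assumes f: "integrable lborel f" and u: "u \<in> sqint lborel"
  shows "AE \<xi> in lborel. fourier_L1 f lam u \<xi> = kernel_op (heis_kernel f lam) u \<xi>"
  using fourier_L1_integrable[OF f u, of lam]
proof eventually_elim
  have [measurable]: "f \<in> borel_measurable borel" "u \<in> borel_measurable borel"
    using f sqintD(1)[OF u] by auto
  fix \<xi> assume int: "integrable lborel (\<lambda>X. f X * schroedinger lam X u \<xi>)"
  have "fourier_L1 f lam u \<xi> = (LINT y|lborel. LINT p|lborel. f (fst p, y, snd p) * schroedinger lam (fst p, y, snd p) u \<xi>)"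
    unfolding fourier_L1_def by (rule integral_heis[OF int])
  also have "\<dots> = (LINT y|lborel. ft (slice f y) (lam *\<^sub>R (\<xi> + (1 / 2) *\<^sub>R y), lam) * u (\<xi> + y))"
  proof (intro Bochner_Integration.integral_cong refl)
    fix y
    have "f (fst p, y, snd p) * schroedinger lam (fst p, y, snd p) u \<xi> =
        (slice f y p * cis (2 * pi * ((lam *\<^sub>R (\<xi> + (1 / 2) *\<^sub>R y), lam) \<bullet> p))) * u (\<xi> + y)" for p
      unfolding schroedinger_def slice_def
      by (cases p) (simp add: cis_mult inner_add_left inner_commute algebra_simps add_divide_distrib)
    then show "(LINT p|lborel. f (fst p, y, snd p) * schroedinger lam (fst p, y, snd p) u \<xi>) =
        ft (slice f y) (lam *\<^sub>R (\<xi> + (1 / 2) *\<^sub>R y), lam) * u (\<xi> + y)"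
      by (simp add: ft_def)
  qed
  also have "\<dots> = (LINT y|lborel. heis_kernel f lam (\<xi>, y + \<xi>) * u (y + \<xi>))"
  proof -
    have "(lam / 2) *\<^sub>R (\<xi> + (y + \<xi>)) = lam *\<^sub>R (\<xi> + (1 / 2) *\<^sub>R y)" for y
      by (subst scaleR_half_sum) (simp add: scaleR_add_right add.commute)
    then show ?thesis by (simp add: heis_kernel_def add.commute)
  qed
  also have "\<dots> = kernel_op (heis_kernel f lam) u \<xi>"
    unfolding kernel_op_def by (rule integral_lborel_translate) measurable
  finally show "fourier_L1 f lam u \<xi> = kernel_op (heis_kernel f lam) u \<xi>" .
qed

lemma normsq_heis_kernel:
  fixes f :: "'n::finite heis \<Rightarrow> complex"
  assumes [measurable]: "f \<in> borel_measurable borel" and lam: "lam \<noteq> 0"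
  shows "ennreal (\<bar>lam\<bar> ^ CARD('n)) * normsq lborel (heis_kernel f lam) =
    (\<integral>\<^sup>+y. \<integral>\<^sup>+w. ennreal ((cmod (ft (slice f y) (w, lam)))\<^sup>2) \<partial>lborel \<partial>lborel)"
proof -
  define g where "g y w = ennreal ((cmod (ft (slice f y) (w, lam)))\<^sup>2)" for y w
  have g [measurable (raw)]: "(\<lambda>x. g (a x) (b x)) \<in> borel_measurable M"
    if [measurable]: "a \<in> borel_measurable M" "b \<in> borel_measurable M" for a b and M :: "'x measure"
    unfolding g_def by measurable
  have "normsq lborel (heis_kernel f lam) = (\<integral>\<^sup>+\<xi>. \<integral>\<^sup>+\<eta>. g (\<eta> - \<xi>) ((lam / 2) *\<^sub>R (\<xi> + \<eta>)) \<partial>lborel \<partial>lborel)"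
    by (subst normsq_pair) (simp_all add: normsq_def heis_kernel_def g_def)
  also have "\<dots> = (\<integral>\<^sup>+\<xi>. \<integral>\<^sup>+y. g y ((lam / 2) *\<^sub>R y + lam *\<^sub>R \<xi>) \<partial>lborel \<partial>lborel)"
  proof (rule nn_integral_cong)
    fix \<xi> :: "real ^ 'n"
    have eq: "(lam / 2) *\<^sub>R (\<xi> + (y + \<xi>)) = (lam / 2) *\<^sub>R y + lam *\<^sub>R \<xi>" for y
      by (rule scaleR_half_sum)
    show "(\<integral>\<^sup>+\<eta>. g (\<eta> - \<xi>) ((lam / 2) *\<^sub>R (\<xi> + \<eta>)) \<partial>lborel) = (\<integral>\<^sup>+y. g y ((lam / 2) *\<^sub>R y + lam *\<^sub>R \<xi>) \<partial>lborel)"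
      using nn_integral_lborel_translate[of "\<lambda>\<eta>. g (\<eta> - \<xi>) ((lam / 2) *\<^sub>R (\<xi> + \<eta>))" \<xi>]
      by (simp only: eq add_diff_cancel_right') measurable
  qed
  also have "\<dots> = (\<integral>\<^sup>+y. \<integral>\<^sup>+\<xi>. g y ((lam / 2) *\<^sub>R y + lam *\<^sub>R \<xi>) \<partial>lborel \<partial>lborel)"
    by (rule nn_integral_lborel_swap) measurable
  finally have "ennreal (\<bar>lam\<bar> ^ CARD('n)) * normsq lborel (heis_kernel f lam) =
      (\<integral>\<^sup>+y. ennreal (\<bar>lam\<bar> ^ CARD('n)) * (\<integral>\<^sup>+\<xi>. g y ((lam / 2) *\<^sub>R y + lam *\<^sub>R \<xi>) \<partial>lborel) \<partial>lborel)"
    by (simp add: nn_integral_cmult)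
  also have "\<dots> = (\<integral>\<^sup>+y. \<integral>\<^sup>+w. g y w \<partial>lborel \<partial>lborel)"
  proof (rule nn_integral_cong)
    fix y :: "real ^ 'n"
    have "g y \<in> borel_measurable borel" by (rule g[of "\<lambda>_. y" borel "\<lambda>w. w"]) auto
    from nn_integral_lborel_affine[OF this lam, of "(lam / 2) *\<^sub>R y"]
    show "ennreal (\<bar>lam\<bar> ^ CARD('n)) * (\<integral>\<^sup>+\<xi>. g y ((lam / 2) *\<^sub>R y + lam *\<^sub>R \<xi>) \<partial>lborel) = (\<integral>\<^sup>+w. g y w \<partial>lborel)"
      by simp
  qed
  finally show ?thesis by (simp add: g_def)
qed

lemma sqint_slice:
  fixes f :: "'n::finite heis \<Rightarrow> complex"
  assumes f: "integrable lborel f" "f \<in> sqint lborel"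
  shows "AE y in lborel. integrable lborel (slice f y) \<and> slice f y \<in> sqint lborel"
proof -
  have [measurable]: "f \<in> borel_measurable borel" using f(1) by auto
  have "(\<integral>\<^sup>+y. normsq lborel (slice f y) \<partial>lborel) \<noteq> \<infinity>"
    using sqintD(2)[OF f(2)] unfolding normsq_def slice_def by (subst (asm) nn_integral_heis) auto
  then have 1: "AE y in lborel. normsq lborel (slice f y) \<noteq> \<infinity>"
    unfolding normsq_def by (intro nn_integral_PInf_AE) measurable
  have "(\<integral>\<^sup>+y. \<integral>\<^sup>+p. ennreal (norm (slice f y p)) \<partial>lborel \<partial>lborel) \<noteq> \<infinity>"
    using f(1) unfolding integrable_iff_bounded slice_def by (subst (asm) nn_integral_heis) auto
  then have "AE y in lborel. (\<integral>\<^sup>+p. ennreal (norm (slice f y p)) \<partial>lborel) \<noteq> \<infinity>"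
    by (intro nn_integral_PInf_AE) measurable
  with 1 show ?thesis
    by eventually_elim (auto intro!: sqintI integrableI_bounded simp: less_top)
qed

text \<open>The Plancherel theorem of the Heisenberg group for integrable functions.  For fixed
  \<open>y\<close> the change of variables \<open>w = \<lambda> (\<xi> + y / 2)\<close> absorbs the weight \<open>|\<lambda>|\<^sup>n\<close> and leaves the
  Euclidean Fourier transform of the slice at \<open>y\<close>.\<close>

theorem heis_kernel_Plancherel:
  fixes f :: "'n::finite heis \<Rightarrow> complex"
  assumes f: "integrable lborel f" "f \<in> sqint lborel"
  shows "(\<integral>\<^sup>+lam. normsq lborel (heis_kernel f lam) \<partial>plancherel_measure TYPE('n)) = normsq lborel f"
proof -
  have [measurable]: "f \<in> borel_measurable borel" using f(1) by auto
  have [measurable]: "(\<lambda>lam. normsq lborel (heis_kernel f lam)) \<in> borel_measurable borel"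
    unfolding normsq_def by measurable
  have "(\<integral>\<^sup>+lam. normsq lborel (heis_kernel f lam) \<partial>plancherel_measure TYPE('n)) =
      (\<integral>\<^sup>+lam. ennreal (\<bar>lam\<bar> ^ CARD('n)) * normsq lborel (heis_kernel f lam) \<partial>lborel)"
    unfolding plancherel_measure_def by (rule nn_integral_density) measurable
  also have "\<dots> = (\<integral>\<^sup>+lam. \<integral>\<^sup>+y. \<integral>\<^sup>+w. ennreal ((cmod (ft (slice f y) (w, lam)))\<^sup>2) \<partial>lborel \<partial>lborel \<partial>lborel)"
  proof (rule nn_integral_cong_AE)
    have "AE lam in lborel. lam \<noteq> (0::real)" by (rule AE_lborel_singleton)
    then show "AE lam in lborel. ennreal (\<bar>lam\<bar> ^ CARD('n)) * normsq lborel (heis_kernel f lam) =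
        (\<integral>\<^sup>+y. \<integral>\<^sup>+w. ennreal ((cmod (ft (slice f y) (w, lam)))\<^sup>2) \<partial>lborel \<partial>lborel)"
      by eventually_elim (rule normsq_heis_kernel, auto)
  qed
  also have "\<dots> = (\<integral>\<^sup>+y. \<integral>\<^sup>+lam. \<integral>\<^sup>+w. ennreal ((cmod (ft (slice f y) (w, lam)))\<^sup>2) \<partial>lborel \<partial>lborel \<partial>lborel)"
    by (rule nn_integral_lborel_swap) measurable
  also have "\<dots> = (\<integral>\<^sup>+y. \<integral>\<^sup>+w. \<integral>\<^sup>+lam. ennreal ((cmod (ft (slice f y) (w, lam)))\<^sup>2) \<partial>lborel \<partial>lborel \<partial>lborel)"
    by (intro nn_integral_cong nn_integral_lborel_swap) measurable
  also have "\<dots> = (\<integral>\<^sup>+y. normsq lborel (ft (slice f y)) \<partial>lborel)"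
    by (simp add: normsq_def nn_integral_lborel_pair)
  also have "\<dots> = (\<integral>\<^sup>+y. normsq lborel (slice f y) \<partial>lborel)"
    by (rule nn_integral_cong_AE, use sqint_slice[OF f] in eventually_elim) (auto intro: Plancherel_euclidean)
  also have "\<dots> = normsq lborel f"
    unfolding normsq_def slice_def by (rule nn_integral_heis[symmetric]) measurable
  finally show ?thesis .
qed

section \<open>Matrix coefficients of operator fields\<close>

lemma sets_plancherel [simp, measurable_cong]: "sets (plancherel_measure TYPE('n::finite)) = sets borel"
  and space_plancherel [simp]: "space (plancherel_measure TYPE('n::finite)) = UNIV"
  by (simp_all add: plancherel_measure_def)

lemma sigma_finite_plancherel: "sigma_finite_measure (plancherel_measure TYPE('n::finite))"
  unfolding plancherel_measure_def by (subst sigma_finite_measure.sigma_finite_iff_density_finite[OF sigma_finite_lborel]) auto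

text \<open>The density \<open>|\<lambda>|\<^sup>n\<close> vanishes only at \<open>0\<close>, so the two measures have the same null sets.\<close>

lemma AE_plancherel_iff: "(AE lam in plancherel_measure TYPE('n::finite). P lam) \<longleftrightarrow> (AE lam in lborel. P lam)"
proof -
  have nz: "AE lam in lborel. lam \<noteq> (0::real)" by (rule AE_lborel_singleton)
  have "(AE lam in plancherel_measure TYPE('n). P lam) \<longleftrightarrow> (AE lam in lborel. 0 < ennreal (\<bar>lam\<bar> ^ CARD('n)) \<longrightarrow> P lam)"
    unfolding plancherel_measure_def by (rule AE_density) measurable
  also have "\<dots> \<longleftrightarrow> (AE lam in lborel. P lam)"
  proof
    assume "AE lam in lborel. 0 < ennreal (\<bar>lam\<bar> ^ CARD('n)) \<longrightarrow> P lam"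
    with nz show "AE lam in lborel. P lam" by eventually_elim auto
  qed auto
  finally show ?thesis .
qed

definition matrix_measure :: "'n::finite itself \<Rightarrow> (real \<times> nat \<times> nat) measure" where
  "matrix_measure _ = plancherel_measure TYPE('n) \<Otimes>\<^sub>M count_space UNIV"

lemma pair_sigma_finite_matrix:
  "pair_sigma_finite (plancherel_measure TYPE('n::finite)) (count_space (UNIV :: (nat \<times> nat) set))"
  by (intro pair_sigma_finite.intro sigma_finite_plancherel sigma_finite_measure_count_space)

lemma nn_integral_count_nat_nat:
  fixes f :: "nat \<times> nat \<Rightarrow> ennreal"
  shows "(\<integral>\<^sup>+p. f p \<partial>count_space UNIV) = (\<Sum>i. \<Sum>j. f (i, j))"
proof -
  interpret sigma_finite_measure "count_space (UNIV :: nat set)"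
    by (rule sigma_finite_measure_count_space)
  have "(\<integral>\<^sup>+p. f p \<partial>count_space UNIV) = (\<integral>\<^sup>+p. f p \<partial>(count_space UNIV \<Otimes>\<^sub>M count_space UNIV))"
    by (rule nn_integral_count_space_prod_eq[symmetric])
  also have "\<dots> = (\<integral>\<^sup>+i. \<integral>\<^sup>+j. f (i, j) \<partial>count_space UNIV \<partial>count_space UNIV)"
    by (rule nn_integral_fst[symmetric]) (simp add: pair_measure_countable)
  finally show ?thesis by (simp add: nn_integral_count_space_nat)
qed

lemma normsq_matrix_measure:
  assumes "m \<in> borel_measurable (matrix_measure TYPE('n::finite))"
  shows "normsq (matrix_measure TYPE('n)) m =
    (\<integral>\<^sup>+lam. (\<Sum>i. \<Sum>j. ennreal ((cmod (m (lam, i, j)))\<^sup>2)) \<partial>plancherel_measure TYPE('n))"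
proof -
  interpret pair_sigma_finite "plancherel_measure TYPE('n)" "count_space (UNIV :: (nat \<times> nat) set)"
    by (rule pair_sigma_finite_matrix)
  have "normsq (matrix_measure TYPE('n)) m =
      (\<integral>\<^sup>+lam. \<integral>\<^sup>+p. ennreal ((cmod (m (lam, p)))\<^sup>2) \<partial>count_space UNIV \<partial>plancherel_measure TYPE('n))"
    unfolding normsq_def matrix_measure_def
    by (rule M2.nn_integral_fst[symmetric]) (use assms in \<open>simp add: matrix_measure_def\<close>)
  then show ?thesis by (simp add: nn_integral_count_nat_nat)
qed

definition op_matrix :: "'n::finite op \<Rightarrow> (nat \<times> nat \<Rightarrow> complex) \<Rightarrow> bool" where
  "op_matrix T m \<longleftrightarrow> (\<forall>i. T (L2_basis i) \<in> sqint lborel \<and>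
     (\<forall>j. ip lborel (T (L2_basis i)) (L2_basis j) = m (i, j)))"

lemma op_matrix_HS_normsq:
  assumes "op_matrix T m"
  shows "HS_normsq T = (\<Sum>i. \<Sum>j. ennreal ((cmod (m (i, j)))\<^sup>2))"
proof -
  have "normsq lborel (T (L2_basis i)) = (\<Sum>j. ennreal ((cmod (m (i, j)))\<^sup>2))" for i
  proof -
    have "T (L2_basis i) \<in> sqint lborel" using assms by (simp add: op_matrix_def)
    from L2_basis_Parseval[OF this] show ?thesis
      using assms by (metis (no_types, lifting) op_matrix_def suminf_cong)
  qed
  then show ?thesis by (simp add: HS_normsq_def L2_normsq_eq)
qed

lemma op_matrix_combine:
  assumes S: "op_matrix S a" and T: "op_matrix T b"
    and R: "\<And>i. R (L2_basis i) \<in> borel_measurable borel"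
      "\<And>i. AE \<xi> in lborel. R (L2_basis i) \<xi> = S (L2_basis i) \<xi> + c * T (L2_basis i) \<xi>"
  shows "op_matrix R (\<lambda>p. a p + c * b p)"
  unfolding op_matrix_def
proof (intro allI conjI)
  fix i j
  let ?S = "\<lambda>\<xi>. S (L2_basis i) \<xi> + c * T (L2_basis i) \<xi>"
  have s: "?S \<in> sqint lborel"
    using S T by (intro sqint_add sqint_scale) (auto simp: op_matrix_def)
  have m: "R (L2_basis i) \<in> borel_measurable lborel" using R(1) by simp
  have "normsq lborel (R (L2_basis i)) = normsq lborel ?S" by (rule normsq_eq_AE[OF R(2)])
  then show "R (L2_basis i) \<in> sqint lborel" using s m by (simp add: sqint_def)
  have "ip lborel (R (L2_basis i)) (L2_basis j) = ip lborel ?S (L2_basis j)"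
    using sqintD(1)[OF s] sqintD(1)[OF L2_basis_sqint] m R(2) by (intro ip_cong_AE) auto
  also have "\<dots> = a (i, j) + c * b (i, j)"
    using S T by (subst ip_add_left) (auto simp: op_matrix_def ip_scale_left intro: sqint_scale L2_basis_sqint)
  finally show "ip lborel (R (L2_basis i)) (L2_basis j) = a (i, j) + c * b (i, j)" .
qed

text \<open>The matrix of an operator field is a complex-valued function on \<open>\<real> \<times> \<nat> \<times> \<nat>\<close>, so that limits
  and inner products of fields are covered by the theory of scalar functions.\<close>

definition has_matrix :: "(real \<Rightarrow> 'n::finite op) \<Rightarrow> (real \<times> nat \<times> nat \<Rightarrow> complex) \<Rightarrow> bool" where
  "has_matrix F m \<longleftrightarrow> m \<in> borel_measurable (matrix_measure TYPE('n)) \<and>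
     (AE lam in lborel. op_matrix (F lam) (\<lambda>p. m (lam, p)))"

lemma borel_measurable_matrix:
  assumes "\<And>i j. (\<lambda>lam. m (lam, i, j)) \<in> borel_measurable borel"
  shows "m \<in> borel_measurable (matrix_measure TYPE('n::finite))"
proof -
  have "(\<lambda>q. m (fst q, p)) \<in> borel_measurable (plancherel_measure TYPE('n) \<Otimes>\<^sub>M count_space UNIV)" for p :: "nat \<times> nat"
    using assms[of "fst p" "snd p"] by (intro measurable_compose[OF measurable_fst]) simp
  from measurable_compose_countable[of "\<lambda>p q. m (fst q, p)", OF this measurable_snd]
  show ?thesis by (simp add: matrix_measure_def)
qed

lemma has_matrix_field_normsq:
  fixes F :: "real \<Rightarrow> 'n::finite op"
  assumes F: "has_matrix F m"
  shows "field_normsq F = normsq (matrix_measure TYPE('n)) m"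
proof -
  have "AE lam in plancherel_measure TYPE('n). HS_normsq (F lam) = (\<Sum>i. \<Sum>j. ennreal ((cmod (m (lam, i, j)))\<^sup>2))"
    unfolding AE_plancherel_iff using F[unfolded has_matrix_def, THEN conjunct2]
    by eventually_elim (rule op_matrix_HS_normsq)
  then show ?thesis
    using F unfolding field_normsq_def has_matrix_def
    by (subst normsq_matrix_measure) (auto intro: nn_integral_cong_AE)
qed

lemma has_matrix_combine:
  fixes E F H :: "real \<Rightarrow> 'n::finite op"
  assumes E: "has_matrix E a" and F: "has_matrix F b"
    and H: "AE lam in lborel. \<forall>i. H lam (L2_basis i) \<in> borel_measurable borel \<and>
      (AE \<xi> in lborel. H lam (L2_basis i) \<xi> = E lam (L2_basis i) \<xi> + c * F lam (L2_basis i) \<xi>)"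
  shows "has_matrix H (\<lambda>q. a q + c * b q)"
  unfolding has_matrix_def
proof
  show "(\<lambda>q. a q + c * b q) \<in> borel_measurable (matrix_measure TYPE('n))"
    using E F by (auto simp: has_matrix_def)
  show "AE lam in lborel. op_matrix (H lam) (\<lambda>p. a (lam, p) + c * b (lam, p))"
    using E[unfolded has_matrix_def, THEN conjunct2] F[unfolded has_matrix_def, THEN conjunct2] H
    by eventually_elim (rule op_matrix_combine, blast+)
qed

lemma has_matrix_diff:
  fixes E F :: "real \<Rightarrow> 'n::finite op"
  assumes E: "has_matrix E a" and F: "has_matrix F b"
  shows "has_matrix (\<lambda>lam u \<xi>. E lam u \<xi> - F lam u \<xi>) (\<lambda>q. a q - b q)"
proof -
  have "AE lam in lborel. \<forall>i. (\<lambda>\<xi>. E lam (L2_basis i) \<xi> - F lam (L2_basis i) \<xi>) \<in> borel_measurable borel"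
    using E[unfolded has_matrix_def, THEN conjunct2] F[unfolded has_matrix_def, THEN conjunct2]
  proof eventually_elim
    fix lam assume "op_matrix (E lam) (\<lambda>p. a (lam, p))" "op_matrix (F lam) (\<lambda>p. b (lam, p))"
    then have "(\<lambda>\<xi>. E lam (L2_basis i) \<xi> - F lam (L2_basis i) \<xi>) \<in> sqint lborel" for i
      by (intro sqint_diff) (auto simp: op_matrix_def)
    from sqintD(1)[OF this]
    show "\<forall>i. (\<lambda>\<xi>. E lam (L2_basis i) \<xi> - F lam (L2_basis i) \<xi>) \<in> borel_measurable borel" by simp
  qed
  then have "has_matrix (\<lambda>lam u \<xi>. E lam u \<xi> - F lam u \<xi>) (\<lambda>q. a q + (-1) * b q)"
    by (intro has_matrix_combine[OF E F]) simp
  then show ?thesis by simp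
qed

lemma L2_fields_has_matrix:
  fixes F :: "real \<Rightarrow> 'n::finite op"
  assumes "F \<in> L2_fields"
  obtains m where "has_matrix F m" "m \<in> sqint (matrix_measure TYPE('n))"
proof -
  define m where "m = (\<lambda>(lam, i, j). ip lborel (F lam (L2_basis i)) (L2_basis j))"
  have "m \<in> borel_measurable (matrix_measure TYPE('n))"
    using assms L2_basis_sqint
    by (intro borel_measurable_matrix) (auto simp: m_def L2_fields_def L2_eq_sqint L2_inner_eq)
  moreover have "AE lam in lborel. F lam \<in> HS" using assms by (simp add: L2_fields_def)
  then have "AE lam in lborel. op_matrix (F lam) (\<lambda>p. m (lam, p))"
    by eventually_elim (auto simp: m_def op_matrix_def HS_def bounded_operator_def L2_eq_sqint L2_basis_sqint)
  ultimately have m: "has_matrix F m" by (simp add: has_matrix_def)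
  moreover have "m \<in> sqint (matrix_measure TYPE('n))"
    using m assms has_matrix_field_normsq[OF m] by (auto simp: has_matrix_def L2_fields_def intro!: sqintI)
  ultimately show thesis by (rule that)
qed

section \<open>The Plancherel theorem on the Heisenberg group\<close>

lemma AE_heis_kernel_sqint:
  fixes f :: "'n::finite heis \<Rightarrow> complex"
  assumes f: "integrable lborel f" "f \<in> sqint lborel"
  shows "AE lam in lborel. heis_kernel f lam \<in> sqint lborel"
proof -
  have [measurable]: "f \<in> borel_measurable borel" using f(1) by auto
  have "(\<integral>\<^sup>+lam. normsq lborel (heis_kernel f lam) \<partial>plancherel_measure TYPE('n)) \<noteq> \<infinity>"
    using heis_kernel_Plancherel[OF f] sqintD(2)[OF f(2)] by simp
  then have "AE lam in plancherel_measure TYPE('n). normsq lborel (heis_kernel f lam) \<noteq> \<infinity>"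
    unfolding normsq_def by (intro nn_integral_PInf_AE) measurable
  then show ?thesis
    unfolding AE_plancherel_iff by eventually_elim (auto intro!: sqintI simp: less_top)
qed

lemma borel_measurable_fourier_L1 [measurable (raw)]:
  assumes [measurable]: "f \<in> borel_measurable borel" "u \<in> borel_measurable borel" "l \<in> borel_measurable M" "x \<in> borel_measurable M"
  shows "(\<lambda>p. fourier_L1 f (l p) u (x p)) \<in> borel_measurable M"
  unfolding fourier_L1_def schroedinger_def split_beta' by measurable

lemma L2_basis_measurable [measurable]: "L2_basis i \<in> borel_measurable borel"
  using sqintD(1)[OF L2_basis_sqint] by simp

text \<open>The Hilbert--Schmidt norm sees an operator only through its values on the basis, and those
  only almost everywhere.  For \<^term>\<open>fourier_L1\<close> the kernel representation holds in this sense.\<close>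

definition op_kernel :: "'n::finite op \<Rightarrow> ((real ^ 'n) \<times> (real ^ 'n) \<Rightarrow> complex) \<Rightarrow> bool" where
  "op_kernel T k \<longleftrightarrow> k \<in> sqint lborel \<and> (\<forall>i. T (L2_basis i) \<in> borel_measurable borel \<and>
     (AE \<xi> in lborel. T (L2_basis i) \<xi> = kernel_op k (L2_basis i) \<xi>))"

lemma op_kernel_sqint:
  assumes "op_kernel T k"
  shows "T (L2_basis i) \<in> sqint lborel"
proof -
  have "normsq lborel (T (L2_basis i)) = normsq lborel (kernel_op k (L2_basis i))"
    using assms by (intro normsq_eq_AE) (auto simp: op_kernel_def)
  then show ?thesis
    using assms sqintD(2)[OF kernel_op_sqint[OF _ L2_basis_sqint, of k i]]
    by (intro sqintI) (auto simp: op_kernel_def)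
qed

lemma op_kernel_HS_normsq:
  assumes "op_kernel T k"
  shows "HS_normsq T = normsq lborel k"
proof -
  have "normsq lborel (T (L2_basis i)) = normsq lborel (kernel_op k (L2_basis i))" for i
    using assms by (intro normsq_eq_AE) (auto simp: op_kernel_def)
  then have "HS_normsq T = HS_normsq (kernel_op k)" by (simp add: HS_normsq_def L2_normsq_eq)
  then show ?thesis using assms by (simp add: HS_normsq_kernel_op op_kernel_def)
qed

lemma op_kernel_diff:
  assumes S: "op_kernel S k" and T: "op_kernel T l"
  shows "op_kernel (\<lambda>u \<xi>. S u \<xi> - T u \<xi>) (\<lambda>p. k p - l p)"
  unfolding op_kernel_def
proof (intro conjI allI)
  have k: "k \<in> sqint lborel" and l: "l \<in> sqint lborel" using S T by (auto simp: op_kernel_def)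
  then show "(\<lambda>p. k p - l p) \<in> sqint lborel" by (rule sqint_diff)
  fix i
  show "(\<lambda>\<xi>. S (L2_basis i) \<xi> - T (L2_basis i) \<xi>) \<in> borel_measurable borel"
    using S T by (intro borel_measurable_diff) (auto simp: op_kernel_def)
  have "AE \<xi> in lborel. S (L2_basis i) \<xi> = kernel_op k (L2_basis i) \<xi>"
    "AE \<xi> in lborel. T (L2_basis i) \<xi> = kernel_op l (L2_basis i) \<xi>"
    using S T by (auto simp: op_kernel_def)
  with kernel_op_diff[OF k l L2_basis_sqint[of i]]
  show "AE \<xi> in lborel. S (L2_basis i) \<xi> - T (L2_basis i) \<xi> = kernel_op (\<lambda>p. k p - l p) (L2_basis i) \<xi>"
    by eventually_elim simp
qed

lemma op_kernel_kernel_op: "k \<in> sqint lborel \<Longrightarrow> op_kernel (kernel_op k) k"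
  by (auto simp: op_kernel_def dest!: sqintD(1))

lemma field_normsq_kernel:
  fixes F :: "real \<Rightarrow> 'n::finite op"
  assumes "AE lam in lborel. op_kernel (F lam) (k lam)"
  shows "field_normsq F = (\<integral>\<^sup>+lam. normsq lborel (k lam) \<partial>plancherel_measure TYPE('n))"
  unfolding field_normsq_def
  by (rule nn_integral_cong_AE, unfold AE_plancherel_iff, use assms in eventually_elim) (rule op_kernel_HS_normsq)

lemma fourier_L1_op_kernel:
  assumes f: "integrable lborel f" "f \<in> sqint lborel"
  shows "AE lam in lborel. op_kernel (fourier_L1 f lam) (heis_kernel f lam)"
  using AE_heis_kernel_sqint[OF f]
proof eventually_elim
  have [measurable]: "f \<in> borel_measurable borel" using f(1) by auto
  fix lam assume "heis_kernel f lam \<in> sqint lborel"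
  then show "op_kernel (fourier_L1 f lam) (heis_kernel f lam)"
    unfolding op_kernel_def by (simp add: fourier_L1_eq_kernel_op[OF f(1) L2_basis_sqint])
qed

text \<open>The norm of the transform, expressed first by kernels and then by matrices.\<close>

lemma fourier_L1_has_matrix:
  fixes f :: "'n::finite heis \<Rightarrow> complex"
  assumes f: "integrable lborel f" "f \<in> sqint lborel"
  obtains m where "has_matrix (fourier_L1 f) m" "m \<in> sqint (matrix_measure TYPE('n))"
    "normsq (matrix_measure TYPE('n)) m = normsq lborel f"
proof -
  have [measurable]: "f \<in> borel_measurable borel" using f(1) by auto
  define m where "m = (\<lambda>(lam, i, j). ip lborel (fourier_L1 f lam (L2_basis i)) (L2_basis j))"
  have mm: "m \<in> borel_measurable (matrix_measure TYPE('n))"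
    by (intro borel_measurable_matrix) (simp add: m_def ip_def)
  have "AE lam in lborel. op_matrix (fourier_L1 f lam) (\<lambda>p. m (lam, p))"
    using fourier_L1_op_kernel[OF f]
    by eventually_elim (simp add: op_matrix_def m_def op_kernel_sqint)
  with mm have m: "has_matrix (fourier_L1 f) m" by (simp add: has_matrix_def)
  have n: "normsq (matrix_measure TYPE('n)) m = normsq lborel f"
    using has_matrix_field_normsq[OF m] field_normsq_kernel[OF fourier_L1_op_kernel[OF f]] heis_kernel_Plancherel[OF f]
    by simp
  moreover have "m \<in> sqint (matrix_measure TYPE('n))"
    using n mm sqintD(2)[OF f(2)] by (intro sqintI) auto
  ultimately show thesis using m by (intro that)
qed

lemma fourier_L1_combine:
  fixes f g :: "'n::finite heis \<Rightarrow> complex"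
  assumes f: "integrable lborel f" "f \<in> sqint lborel" and g: "integrable lborel g" "g \<in> sqint lborel"
    and a: "has_matrix (fourier_L1 f) a" and b: "has_matrix (fourier_L1 g) b"
  shows "has_matrix (fourier_L1 (\<lambda>X. f X + c * g X)) (\<lambda>q. a q + c * b q)"
proof (rule has_matrix_combine[OF a b], rule AE_I2, intro allI conjI)
  have [measurable]: "f \<in> borel_measurable borel" "g \<in> borel_measurable borel" using f(1) g(1) by auto
  fix lam :: real and i
  show "fourier_L1 (\<lambda>X. f X + c * g X) lam (L2_basis i) \<in> borel_measurable borel" by measurable
  show "AE \<xi> in lborel. fourier_L1 (\<lambda>X. f X + c * g X) lam (L2_basis i) \<xi> =
      fourier_L1 f lam (L2_basis i) \<xi> + c * fourier_L1 g lam (L2_basis i) \<xi>"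
    using fourier_L1_integrable[OF f(1) L2_basis_sqint, of lam i] fourier_L1_integrable[OF g(1) L2_basis_sqint, of lam i]
  proof eventually_elim
    fix \<xi>
    assume i: "integrable lborel (\<lambda>X. f X * schroedinger lam X (L2_basis i) \<xi>)"
      "integrable lborel (\<lambda>X. g X * schroedinger lam X (L2_basis i) \<xi>)"
    have "(f X + c * g X) * schroedinger lam X (L2_basis i) \<xi> =
        f X * schroedinger lam X (L2_basis i) \<xi> + c * (g X * schroedinger lam X (L2_basis i) \<xi>)" for X
      by (simp add: algebra_simps)
    then show "fourier_L1 (\<lambda>X. f X + c * g X) lam (L2_basis i) \<xi> =
      fourier_L1 f lam (L2_basis i) \<xi> + c * fourier_L1 g lam (L2_basis i) \<xi>"
      using i by (simp add: fourier_L1_def)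
  qed
qed

text \<open>Both norms pass to the limit along the approximating sequences, for every combination
  \<open>f + c g\<close>; polarization gives the inner product.\<close>

theorem is_fourier_ip:
  fixes f g :: "'n::finite heis \<Rightarrow> complex"
  assumes f: "f \<in> sqint lborel" "is_fourier f F" and g: "g \<in> sqint lborel" "is_fourier g H"
    and a: "has_matrix F a" "a \<in> sqint (matrix_measure TYPE('n))"
    and b: "has_matrix H b" "b \<in> sqint (matrix_measure TYPE('n))"
  shows "ip (matrix_measure TYPE('n)) a b = ip lborel f g"
proof -
  let ?\<mu> = "matrix_measure TYPE('n)"
  have approx: "\<exists>h A. (\<forall>j. integrable lborel (h j) \<and> h j \<in> sqint lborel \<and> has_matrix (fourier_L1 (h j)) (A j) \<and>
        A j \<in> sqint ?\<mu>) \<and> sq_tendsto lborel h f \<and> sq_tendsto ?\<mu> A a"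
    if fF: "is_fourier f F" "has_matrix F a" for f :: "'n heis \<Rightarrow> complex" and F a
  proof -
    obtain h where h': "\<forall>j. h j \<in> sqint lborel \<and> integrable lborel (h j)" and h: "sq_tendsto lborel h f"
      "(\<lambda>j. field_normsq (\<lambda>lam u \<xi>. fourier_L1 (h j) lam u \<xi> - F lam u \<xi>)) \<longlonglongrightarrow> 0"
      using fF(1) unfolding is_fourier_def L2_eq_sqint L2_tendsto_eq by blast
    have "\<exists>m. has_matrix (fourier_L1 (h j)) m \<and> m \<in> sqint ?\<mu>" for j
      using fourier_L1_has_matrix[of "h j"] h' by blast
    then obtain A where A: "\<And>j. has_matrix (fourier_L1 (h j)) (A j)" "\<And>j. A j \<in> sqint ?\<mu>" by metis
    have "sq_tendsto ?\<mu> A a"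
      using h(2) has_matrix_field_normsq[OF has_matrix_diff[OF A(1) fF(2)]] by (simp add: sq_tendsto_def)
    with h(1) h' A show ?thesis by blast
  qed
  obtain p A where p: "\<And>j. integrable lborel (p j)" "\<And>j. p j \<in> sqint lborel" "\<And>j. has_matrix (fourier_L1 (p j)) (A j)"
      "\<And>j. A j \<in> sqint ?\<mu>" "sq_tendsto lborel p f" "sq_tendsto ?\<mu> A a"
    using approx[OF f(2) a(1)] by blast
  obtain q B where q: "\<And>j. integrable lborel (q j)" "\<And>j. q j \<in> sqint lborel" "\<And>j. has_matrix (fourier_L1 (q j)) (B j)"
      "\<And>j. B j \<in> sqint ?\<mu>" "sq_tendsto lborel q g" "sq_tendsto ?\<mu> B b"
    using approx[OF g(2) b(1)] by blast
  show ?thesis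
  proof (rule polarization[OF f(1) g(1) a(2) b(2)])
    fix c
    have "normsq ?\<mu> (\<lambda>x. A j x + c * B j x) = normsq lborel (\<lambda>x. p j x + c * q j x)" for j
    proof -
      have i: "integrable lborel (\<lambda>x. p j x + c * q j x)" "(\<lambda>x. p j x + c * q j x) \<in> sqint lborel"
        by (intro Bochner_Integration.integrable_add integrable_mult_right p q sqint_add sqint_scale)+
      obtain m where m: "has_matrix (fourier_L1 (\<lambda>x. p j x + c * q j x)) m" "normsq ?\<mu> m = normsq lborel (\<lambda>x. p j x + c * q j x)"
        using fourier_L1_has_matrix[OF i] by blast
      then show ?thesis
        using has_matrix_field_normsq[OF m(1)] has_matrix_field_normsq[OF fourier_L1_combine[OF p(1,2) q(1,2) p(3) q(3)]]
        by metis
    qed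
    moreover have "(\<lambda>j. normsq ?\<mu> (\<lambda>x. A j x + c * B j x)) \<longlonglongrightarrow> normsq ?\<mu> (\<lambda>x. a x + c * b x)"
      by (intro normsq_tendsto sq_tendsto_add sq_tendsto_scale p q sqint_add sqint_scale a b sqintD(1)[OF p(4)] sqintD(1)[OF q(4)] sqintD(1)[OF a(2)] sqintD(1)[OF b(2)] borel_measurable_times borel_measurable_const)
    moreover have "(\<lambda>j. normsq lborel (\<lambda>x. p j x + c * q j x)) \<longlonglongrightarrow> normsq lborel (\<lambda>x. f x + c * g x)"
      by (intro normsq_tendsto sq_tendsto_add sq_tendsto_scale p q sqint_add sqint_scale f g sqintD(1)[OF p(2)] sqintD(1)[OF q(2)] sqintD(1)[OF f(1)] sqintD(1)[OF g(1)] borel_measurable_times borel_measurable_const)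
    ultimately show "normsq ?\<mu> (\<lambda>x. a x + c * b x) = normsq lborel (\<lambda>x. f x + c * g x)"
      using LIMSEQ_unique by simp
  qed
qed

text \<open>Parseval's identity for inner products, by polarization in the counting measure.\<close>

lemma ip_L2_basis:
  assumes f: "f \<in> sqint lborel" and g: "g \<in> sqint lborel"
  shows "ip (count_space UNIV) (\<lambda>j. ip lborel f (L2_basis j)) (\<lambda>j. ip lborel g (L2_basis j)) = ip lborel f g"
proof -
  have n: "normsq (count_space UNIV) (\<lambda>j. ip lborel h (L2_basis j)) = normsq lborel h"
    if "h \<in> sqint lborel" for h
    using L2_basis_Parseval[OF that] by (simp add: normsq_def nn_integral_count_space_nat)
  have s: "(\<lambda>j. ip lborel h (L2_basis j)) \<in> sqint (count_space UNIV)" if "h \<in> sqint lborel" for h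
    using n[OF that] sqintD(2)[OF that] by (intro sqintI) auto
  show ?thesis
  proof (rule polarization[OF f g s[OF f] s[OF g]])
    fix c
    have "(\<lambda>x. f x + c * g x) \<in> sqint lborel" by (intro sqint_add sqint_scale f g)
    from n[OF this]
    show "normsq (count_space UNIV) (\<lambda>j. ip lborel f (L2_basis j) + c * ip lborel g (L2_basis j)) = normsq lborel (\<lambda>x. f x + c * g x)"
      using f g by (simp add: ip_add_left sqint_scale L2_basis_sqint ip_scale_left)
  qed
qed

text \<open>Fubini for the double sum: each row sum is an inner product of images of basis vectors.\<close>

lemma op_matrix_HS_inner:
  assumes S: "op_matrix S a" and T: "op_matrix T b"
    and int: "integrable (count_space UNIV) (\<lambda>p. a p * cnj (b p))"
  shows "HS_inner S T = (LINT p|count_space UNIV. a p * cnj (b p))"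
proof -
  interpret pair_sigma_finite "count_space (UNIV :: nat set)" "count_space (UNIV :: nat set)"
    by (intro pair_sigma_finite.intro sigma_finite_measure_count_space)
  have cc: "count_space UNIV \<Otimes>\<^sub>M count_space UNIV = (count_space UNIV :: (nat \<times> nat) measure)"
    by (simp add: pair_measure_countable)
  note int' = int[folded cc]
  have row: "(LINT j|count_space UNIV. a (i, j) * cnj (b (i, j))) = L2_inner (S (L2_basis i)) (T (L2_basis i))" for i
    using ip_L2_basis[of "S (L2_basis i)" "T (L2_basis i)"] S T by (simp add: op_matrix_def L2_inner_eq ip_def)
  have "integrable (count_space UNIV) (\<lambda>i. L2_inner (S (L2_basis i)) (T (L2_basis i)))"
    using integrable_fst'[OF int'] by (simp add: row)
  then have "HS_inner S T = (LINT i|count_space UNIV. L2_inner (S (L2_basis i)) (T (L2_basis i)))"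
    unfolding HS_inner_def by (subst infsetsum_infsum[symmetric]) (simp_all add: abs_summable_on_def infsetsum_def)
  also have "\<dots> = (LINT p|count_space UNIV. a p * cnj (b p))"
    using integral_fst'[OF int'] by (simp add: row cc)
  finally show ?thesis .
qed

text \<open>The pointwise inner product of two fields need not be measurable in the parameter; it agrees
  almost everywhere with an integrable function \<open>p\<close>.\<close>

lemma has_matrix_HS_inner:
  fixes F H :: "real \<Rightarrow> 'n::finite op"
  assumes F: "has_matrix F a" "a \<in> sqint (matrix_measure TYPE('n))"
    and H: "has_matrix H b" "b \<in> sqint (matrix_measure TYPE('n))"
  obtains p where "integrable lborel p"
    "AE lam in lborel. HS_inner (F lam) (H lam) * of_real (\<bar>lam\<bar> ^ CARD('n)) = p lam"
    "(LINT lam|lborel. p lam) = ip (matrix_measure TYPE('n)) a b"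
proof -
  interpret pair_sigma_finite "plancherel_measure TYPE('n)" "count_space (UNIV :: (nat \<times> nat) set)"
    by (rule pair_sigma_finite_matrix)
  define q where "q lam = (LINT ij|count_space UNIV. a (lam, ij) * cnj (b (lam, ij)))" for lam
  have int: "integrable (plancherel_measure TYPE('n) \<Otimes>\<^sub>M count_space UNIV) (\<lambda>p. a p * cnj (b p))"
    using sqint_mult_integrable[OF F(2) H(2)] by (simp add: matrix_measure_def)
  have q: "integrable (plancherel_measure TYPE('n)) q" "(LINT lam|plancherel_measure TYPE('n). q lam) = ip (matrix_measure TYPE('n)) a b"
    unfolding q_def[abs_def] ip_def matrix_measure_def
    using integrable_fst'[OF int] integral_fst'[OF int] by simp_all
  have qm [measurable]: "q \<in> borel_measurable borel" using q(1) by (auto dest: borel_measurable_integrable)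
  have "AE lam in plancherel_measure TYPE('n). integrable (count_space UNIV) (\<lambda>ij. a (lam, ij) * cnj (b (lam, ij)))"
    by (rule AE_integrable_fst'[OF int])
  then have "AE lam in lborel. integrable (count_space UNIV) (\<lambda>ij. a (lam, ij) * cnj (b (lam, ij)))"
    by (simp add: AE_plancherel_iff)
  then have HS: "AE lam in lborel. HS_inner (F lam) (H lam) = q lam"
    using F(1)[unfolded has_matrix_def, THEN conjunct2] H(1)[unfolded has_matrix_def, THEN conjunct2]
    by eventually_elim (simp add: op_matrix_HS_inner q_def)
  show thesis
  proof (rule that)
    show "integrable lborel (\<lambda>lam. \<bar>lam\<bar> ^ CARD('n) *\<^sub>R q lam)"
      using q(1) unfolding plancherel_measure_def by (subst (asm) integrable_density) auto
    show "(LINT lam|lborel. \<bar>lam\<bar> ^ CARD('n) *\<^sub>R q lam) = ip (matrix_measure TYPE('n)) a b"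
      using q(2) unfolding plancherel_measure_def by (subst (asm) integral_density) auto
    show "AE lam in lborel. HS_inner (F lam) (H lam) * of_real (\<bar>lam\<bar> ^ CARD('n)) = \<bar>lam\<bar> ^ CARD('n) *\<^sub>R q lam"
      using HS by eventually_elim (simp add: scaleR_conv_of_real mult.commute)
  qed
qed

lemma L1_L2_approximation:
  fixes f :: "'a::euclidean_space \<Rightarrow> complex"
  assumes f: "f \<in> sqint lborel"
  obtains g where "\<And>j. integrable lborel (g j)" "\<And>j::nat. g j \<in> sqint lborel" "sq_tendsto lborel g f"
proof -
  have [measurable]: "f \<in> borel_measurable borel" using sqintD(1)[OF f] by simp
  define g where "g j x = f x * cnj (indicator (ball 0 (real j)) x)" for j and x :: 'a
  have 1: "integrable lborel (g j)" for j
    unfolding g_def by (rule sqint_mult_integrable[OF f bounded_open_sqint]) auto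
  have gle: "cmod (g j x) \<le> cmod (f x)" for j x
    by (auto simp: g_def split: split_indicator)
  have 2: "g j \<in> sqint lborel" for j
  proof (rule sqintI)
    show "g j \<in> borel_measurable lborel" using 1 by auto
    have "normsq lborel (g j) \<le> normsq lborel f"
      unfolding normsq_def by (intro nn_integral_mono ennreal_leI power_mono gle) auto
    then show "normsq lborel (g j) < \<infinity>" using sqintD(2)[OF f] by (rule le_less_trans)
  qed
  have "(\<lambda>j. \<integral>\<^sup>+x. ennreal ((cmod (g j x - f x))\<^sup>2) \<partial>lborel) \<longlonglongrightarrow> (\<integral>\<^sup>+x. 0 \<partial>(lborel :: 'a measure))"
  proof (rule nn_integral_dominated_convergence)
    show "(\<integral>\<^sup>+x. ennreal ((cmod (f x))\<^sup>2) \<partial>lborel) < \<infinity>" using sqintD(2)[OF f] by (simp add: normsq_def)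
    show "AE x in lborel. ennreal ((cmod (g j x - f x))\<^sup>2) \<le> ennreal ((cmod (f x))\<^sup>2)" for j
      by (auto simp: g_def split: split_indicator)
    show "AE x in lborel. (\<lambda>j. ennreal ((cmod (g j x - f x))\<^sup>2)) \<longlonglongrightarrow> 0"
    proof (rule AE_I2, rule tendsto_eventually)
      fix x :: 'a
      obtain N where "norm x < real N" using reals_Archimedean2 by blast
      then show "eventually (\<lambda>j. ennreal ((cmod (g j x - f x))\<^sup>2) = 0) sequentially"
        unfolding eventually_sequentially
        by (intro exI[of _ N]) (auto simp: g_def split: split_indicator)
    qed
  qed (use 1 in \<open>measurable\<close>)
  then have "sq_tendsto lborel g f" by (simp add: sq_tendsto_def normsq_def)
  with 1 2 show thesis by (rule that)
qed

lemma kernel_field_L2_fields: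
  fixes k :: "real \<Rightarrow> (real ^ 'n) \<times> (real ^ 'n::finite) \<Rightarrow> complex"
  assumes meas: "(\<lambda>p. k (fst p) (snd p)) \<in> borel_measurable borel"
    and k: "\<And>lam. k lam \<in> sqint lborel"
    and fin: "(\<integral>\<^sup>+lam. normsq lborel (k lam) \<partial>plancherel_measure TYPE('n)) < \<infinity>"
  shows "(\<lambda>lam. kernel_op (k lam)) \<in> L2_fields"
proof -
  have [measurable (raw)]: "(\<lambda>x. k (l x) (p x)) \<in> borel_measurable M"
    if [measurable]: "l \<in> borel_measurable M" "p \<in> borel_measurable M" for l p and M :: "'x measure"
    using measurable_compose[OF borel_measurable_Pair[OF that] meas] by simp
  have "(\<lambda>lam. L2_inner (kernel_op (k lam) u) v) \<in> borel_measurable borel" if "u \<in> L2" "v \<in> L2" for u v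
  proof -
    have [measurable]: "u \<in> borel_measurable borel" "v \<in> borel_measurable borel"
      using that by (auto simp: L2_def)
    show ?thesis unfolding L2_inner_def kernel_op_def by measurable
  qed
  moreover have "field_normsq (\<lambda>lam. kernel_op (k lam)) = (\<integral>\<^sup>+lam. normsq lborel (k lam) \<partial>plancherel_measure TYPE('n))"
    by (simp add: field_normsq_def HS_normsq_kernel_op[OF k])
  ultimately show ?thesis
    using fin kernel_op_HS[OF k] by (simp add: L2_fields_def)
qed

text \<open>The kernels of an approximating sequence form a Cauchy sequence, since the norm of a
  difference of kernels is that of the transforms, hence that of the functions.  The limit
  is the kernel of the transform; it is replaced by \<open>0\<close> on the null set of parameters at which it is not
  square-integrable.\<close>

theorem is_fourier_exists:
  fixes f :: "'n::finite heis \<Rightarrow> complex"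
  assumes f: "f \<in> sqint lborel"
  shows "\<exists>F. is_fourier f F"
proof -
  obtain g where g: "\<And>j. integrable lborel (g j)" "\<And>j::nat. g j \<in> sqint lborel" "sq_tendsto lborel g f"
    using L1_L2_approximation[OF f] by blast
  note [measurable] = sqintD(1)[OF g(2), simplified] sqintD(1)[OF f, simplified]
  define \<nu> where "\<nu> = plancherel_measure TYPE('n) \<Otimes>\<^sub>M (lborel :: ((real ^ 'n) \<times> (real ^ 'n)) measure)"
  have sets_nu [measurable_cong]: "sets \<nu> = sets (borel \<Otimes>\<^sub>M borel)"
    unfolding \<nu>_def by (intro sets_pair_measure_cong) auto
  have nu: "normsq \<nu> k = (\<integral>\<^sup>+lam. normsq lborel (\<lambda>p. k (lam, p)) \<partial>plancherel_measure TYPE('n))"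
    if "k \<in> borel_measurable \<nu>" for k
    unfolding normsq_def \<nu>_def
    by (rule lborel.nn_integral_fst[symmetric]) (use that in \<open>simp add: \<nu>_def\<close>)
  define K where "K j = (\<lambda>(lam, p). heis_kernel (g j) lam p)" for j
  have Km: "K j \<in> borel_measurable \<nu>" for j
    unfolding K_def split_beta' by measurable
  have Kn: "normsq \<nu> (K j) = normsq lborel (g j)" for j
    using nu[OF Km[of j]] heis_kernel_Plancherel[OF g(1,2), of j] by (simp add: K_def)
  have K: "K j \<in> sqint \<nu>" for j
    using Km Kn sqintD(2)[OF g(2), of j] by (intro sqintI) auto
  have Kdiff: "normsq \<nu> (\<lambda>q. K i q - K j q) = normsq lborel (\<lambda>x. g i x - g j x)" for i j
  proof -
    obtain a where a: "has_matrix (fourier_L1 (g i)) a" using fourier_L1_has_matrix[OF g(1,2)] by blast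
    obtain b where b: "has_matrix (fourier_L1 (g j)) b" using fourier_L1_has_matrix[OF g(1,2)] by blast
    have d: "integrable lborel (\<lambda>x. g i x + (-1) * g j x)" "(\<lambda>x. g i x + (-1) * g j x) \<in> sqint lborel"
      by (intro Bochner_Integration.integrable_add integrable_mult_right g sqint_add sqint_scale)+
    obtain m where m: "has_matrix (fourier_L1 (\<lambda>x. g i x + (-1) * g j x)) m"
        "normsq (matrix_measure TYPE('n)) m = normsq lborel (\<lambda>x. g i x + (-1) * g j x)"
      using fourier_L1_has_matrix[OF d] by blast
    have "AE lam in lborel. op_kernel (\<lambda>u \<xi>. fourier_L1 (g i) lam u \<xi> - fourier_L1 (g j) lam u \<xi>)
        (\<lambda>p. heis_kernel (g i) lam p - heis_kernel (g j) lam p)"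
      using fourier_L1_op_kernel[OF g(1,2), of i] fourier_L1_op_kernel[OF g(1,2), of j]
      by eventually_elim (rule op_kernel_diff)
    then have "normsq \<nu> (\<lambda>q. K i q - K j q) = field_normsq (\<lambda>lam u \<xi>. fourier_L1 (g i) lam u \<xi> - fourier_L1 (g j) lam u \<xi>)"
      using Km by (subst nu) (auto simp: K_def field_normsq_kernel)
    also have "\<dots> = normsq (matrix_measure TYPE('n)) (\<lambda>q. a q + (-1) * b q)"
      using has_matrix_field_normsq[OF has_matrix_diff[OF a b]] by simp
    also have "\<dots> = normsq (matrix_measure TYPE('n)) m"
      using has_matrix_field_normsq[OF m(1)] has_matrix_field_normsq[OF fourier_L1_combine[OF g(1,2) g(1,2) a b, of "-1"]]
      by simp
    also have "\<dots> = normsq lborel (\<lambda>x. g i x - g j x)" using m(2) by simp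
    finally show ?thesis .
  qed
  have Cauchy: "\<exists>N. \<forall>i\<ge>N. \<forall>j\<ge>N. normsq \<nu> (\<lambda>q. K i q - K j q) \<le> ennreal e" if "e > 0" for e
  proof -
    have "eventually (\<lambda>j. normsq lborel (\<lambda>x. g j x - f x) < ennreal (e / 4)) sequentially"
      using g(3) that unfolding sq_tendsto_def by (rule_tac order_tendstoD(2)) auto
    then obtain N where N: "\<And>j. j \<ge> N \<Longrightarrow> normsq lborel (\<lambda>x. g j x - f x) < ennreal (e / 4)"
      by (auto simp: eventually_sequentially)
    have "normsq \<nu> (\<lambda>q. K i q - K j q) \<le> ennreal e" if ij: "i \<ge> N" "j \<ge> N" for i j
    proof -
      have "normsq lborel (\<lambda>x. g i x - g j x) \<le> 2 * normsq lborel (\<lambda>x. g i x - f x) + 2 * normsq lborel (\<lambda>x. f x - g j x)"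
        by (rule normsq_diff_triangle) measurable
      also have "\<dots> \<le> 2 * ennreal (e / 4) + 2 * ennreal (e / 4)"
        using N[OF ij(1)] N[OF ij(2)] by (intro add_mono mult_left_mono) (auto simp: normsq_minus_commute[of _ f])
      also have "\<dots> = ennreal (2 * (e / 4) + 2 * (e / 4))"
        using \<open>e > 0\<close> by (simp del: ennreal_numeral flip: ennreal_mult ennreal_plus ennreal_numeral)
      finally show ?thesis by (simp add: Kdiff)
    qed
    then show ?thesis by blast
  qed
  obtain L where L: "L \<in> sqint \<nu>" "sq_tendsto \<nu> K L"
    using sq_complete[OF K Cauchy] by blast
  have Lm: "L \<in> borel_measurable \<nu>" using sqintD(1)[OF L(1)] .
  have [measurable]: "L \<in> borel_measurable (borel \<Otimes>\<^sub>M borel)"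
    using Lm by (simp cong: measurable_cong_sets add: measurable_cong_sets[OF sets_nu refl])
  define k where "k lam p = (if normsq lborel (\<lambda>p. L (lam, p)) < \<infinity> then L (lam, p) else 0)" for lam p
  have Lsec: "(\<lambda>p. L (lam, p)) \<in> borel_measurable borel" for lam by measurable
  have k: "k lam \<in> sqint lborel" for lam
    using Lsec by (cases "normsq lborel (\<lambda>p. L (lam, p)) < \<infinity>") (auto simp: k_def[abs_def] sqint_zero intro: sqintI)
  have km: "(\<lambda>p. k (fst p) (snd p)) \<in> borel_measurable (borel :: (real \<times> (real ^ 'n) \<times> (real ^ 'n)) measure)"
  proof -
    have "(\<lambda>p. k (fst p) (snd p)) \<in> borel_measurable (borel \<Otimes>\<^sub>M borel)"
      unfolding k_def normsq_def by measurable
    then show ?thesis by (simp add: borel_prod)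
  qed
  have "(\<integral>\<^sup>+lam. normsq lborel (\<lambda>p. L (lam, p)) \<partial>plancherel_measure TYPE('n)) \<noteq> \<infinity>"
    using sqintD(2)[OF L(1)] nu[OF Lm] by simp
  then have "AE lam in plancherel_measure TYPE('n). normsq lborel (\<lambda>p. L (lam, p)) \<noteq> \<infinity>"
    unfolding normsq_def by (intro nn_integral_PInf_AE) measurable
  then have kL: "AE lam in lborel. k lam = (\<lambda>p. L (lam, p))"
    unfolding AE_plancherel_iff by eventually_elim (auto simp: k_def[abs_def] less_top)
  have "(\<integral>\<^sup>+lam. normsq lborel (k lam) \<partial>plancherel_measure TYPE('n)) = normsq \<nu> L"
    unfolding nu[OF Lm] by (rule nn_integral_cong_AE, unfold AE_plancherel_iff, use kL in eventually_elim) simp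
  then have F: "(\<lambda>lam. kernel_op (k lam)) \<in> L2_fields"
    using sqintD(2)[OF L(1)] by (intro kernel_field_L2_fields km k) simp
  have "field_normsq (\<lambda>lam u \<xi>. fourier_L1 (g j) lam u \<xi> - kernel_op (k lam) u \<xi>) = normsq \<nu> (\<lambda>q. K j q - L q)" for j
  proof -
    have "AE lam in lborel. op_kernel (\<lambda>u \<xi>. fourier_L1 (g j) lam u \<xi> - kernel_op (k lam) u \<xi>)
        (\<lambda>p. heis_kernel (g j) lam p - L (lam, p))"
      using fourier_L1_op_kernel[OF g(1,2), of j] kL
    proof eventually_elim
      fix lam assume 1: "op_kernel (fourier_L1 (g j) lam) (heis_kernel (g j) lam)" and 2: "k lam = (\<lambda>p. L (lam, p))"
      show "op_kernel (\<lambda>u \<xi>. fourier_L1 (g j) lam u \<xi> - kernel_op (k lam) u \<xi>)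
          (\<lambda>p. heis_kernel (g j) lam p - L (lam, p))"
        using op_kernel_diff[OF 1 op_kernel_kernel_op[OF k[of lam]]] by (simp add: 2)
    qed
    then show ?thesis
      using Km Lm by (subst nu) (auto simp: K_def field_normsq_kernel)
  qed
  then have "(\<lambda>j. field_normsq (\<lambda>lam u \<xi>. fourier_L1 (g j) lam u \<xi> - kernel_op (k lam) u \<xi>)) \<longlonglongrightarrow> 0"
    using L(2) by (simp add: sq_tendsto_def)
  with F g show ?thesis
    unfolding is_fourier_def L2_eq_sqint L2_tendsto_eq by blast
qed

corollary is_fourier_fourier: "f \<in> sqint lborel \<Longrightarrow> is_fourier f (fourier f)"
  unfolding fourier_def using is_fourier_exists by (rule someI_ex)

section \<open>Translations\<close>

lemma HS_scale:
  assumes T: "T \<in> HS" and c: "cmod c = 1"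
  shows "(\<lambda>u \<xi>. c * T u \<xi>) \<in> HS"
proof -
  have n: "L2_normsq (\<lambda>\<xi>. c * g \<xi>) = L2_normsq g" for g :: "real ^ 'a \<Rightarrow> complex"
    by (simp add: L2_normsq_def norm_mult c)
  have lin: "AE x in lborel. c * T (\<lambda>y. a * u y + b * v y) x = a * (c * T u x) + b * (c * T v x)"
    if "u \<in> L2" "v \<in> L2" for u v a b
  proof -
    have "AE x in lborel. T (\<lambda>y. a * u y + b * v y) x = a * T u x + b * T v x"
      using T that unfolding HS_def bounded_operator_def by blast
    then show ?thesis by eventually_elim (simp add: algebra_simps)
  qed
  have "bounded_operator (\<lambda>u \<xi>. c * T u \<xi>)"
    using T lin unfolding HS_def bounded_operator_def n by (auto simp: L2_eq_sqint intro: sqint_scale)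
  then show ?thesis using T by (simp add: HS_def HS_normsq_def n)
qed

lemma left_transl_central: "left_transl (0, 0, s) f X = f (X + (0, 0, - s))"
  by (cases X) (simp add: left_transl_def heis_mult_def heis_inv_def add.commute)

text \<open>A central translation multiplies the transform by a character of the parameter.\<close>

lemma is_fourier_central:
  fixes f :: "'n::finite heis \<Rightarrow> complex"
  assumes F: "is_fourier f F" and f: "f \<in> sqint lborel"
  shows "is_fourier (left_transl (0, 0, s) f) (\<lambda>lam u \<xi>. cis (2 * pi * lam * s) * F lam u \<xi>)"
proof -
  let ?z = "(0, 0, - s) :: 'n heis"
  obtain g where g: "\<forall>j. g j \<in> sqint lborel \<and> integrable lborel (g j)" "sq_tendsto lborel g f"
      "(\<lambda>j. field_normsq (\<lambda>lam u \<xi>. fourier_L1 (g j) lam u \<xi> - F lam u \<xi>)) \<longlonglongrightarrow> 0"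
    using F unfolding is_fourier_def L2_eq_sqint L2_tendsto_eq by blast
  have FL: "F \<in> L2_fields" using F by (simp add: is_fourier_def)
  define h where "h j X = g j (X + ?z)" for j X
  have gm [measurable]: "g j \<in> borel_measurable borel" for j using g(1) sqintD(1)[of "g j" lborel] by simp
  have fm [measurable]: "f \<in> borel_measurable borel" using sqintD(1)[OF f] by simp
  have h: "h j \<in> sqint lborel \<and> integrable lborel (h j)" for j
    unfolding h_def using sqint_translate[of "g j" ?z] integrable_lborel_affine[of "g j" 1 ?z] g(1)
    by (simp add: add.commute)
  have lim: "sq_tendsto lborel h (left_transl (0, 0, s) f)"
    using g(2) normsq_translate[of "\<lambda>X. g _ X - f X" ?z]
    by (simp add: sq_tendsto_def h_def left_transl_central)
  have ft: "fourier_L1 (h j) lam (L2_basis i) \<xi> = cis (2 * pi * lam * s) * fourier_L1 (g j) lam (L2_basis i) \<xi>"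
    for j lam i \<xi>
  proof -
    define k where "k X = h j X * schroedinger lam X (L2_basis i) \<xi>" for X
    have km: "k \<in> borel_measurable borel"
      unfolding k_def h_def schroedinger_def split_beta' by measurable
    have "k (X + (0, 0, s)) = cis (2 * pi * lam * s) * (g j X * schroedinger lam X (L2_basis i) \<xi>)" for X
    proof (cases X)
      case (fields x y t)
      have "cis (2 * pi * lam * (t + s)) = cis (2 * pi * lam * s) * cis (2 * pi * lam * t)"
        by (simp add: cis_mult algebra_simps)
      then show ?thesis
        by (simp add: fields k_def h_def schroedinger_def)
    qed
    then have "(LINT X|lborel. k (X + (0, 0, s))) = cis (2 * pi * lam * s) * fourier_L1 (g j) lam (L2_basis i) \<xi>"
      by (simp add: fourier_L1_def)
    moreover have "(LINT X|lborel. k (X + (0, 0, s))) = (LINT X|lborel. k X)"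
      by (rule integral_lborel_translate[OF km])
    ultimately show ?thesis by (simp add: fourier_L1_def k_def)
  qed
  have "field_normsq (\<lambda>lam u \<xi>. fourier_L1 (h j) lam u \<xi> - cis (2 * pi * lam * s) * F lam u \<xi>) =
      field_normsq (\<lambda>lam u \<xi>. fourier_L1 (g j) lam u \<xi> - F lam u \<xi>)" for j
    unfolding field_normsq_def HS_normsq_def L2_normsq_def ft
    by (simp add: norm_mult flip: right_diff_distrib)
  then have lim2: "(\<lambda>j. field_normsq (\<lambda>lam u \<xi>. fourier_L1 (h j) lam u \<xi> - cis (2 * pi * lam * s) * F lam u \<xi>)) \<longlonglongrightarrow> 0"
    using g(3) by simp
  have "(\<lambda>lam u \<xi>. cis (2 * pi * lam * s) * F lam u \<xi>) \<in> L2_fields"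
  proof -
    have "AE lam in lborel. F lam \<in> HS" using FL by (simp add: L2_fields_def)
    then have "AE lam in lborel. (\<lambda>u \<xi>. cis (2 * pi * lam * s) * F lam u \<xi>) \<in> HS"
      by eventually_elim (rule HS_scale, auto)
    moreover have "(\<lambda>lam. L2_inner (\<lambda>\<xi>. cis (2 * pi * lam * s) * F lam u \<xi>) v) \<in> borel_measurable borel"
      if "u \<in> L2" "v \<in> L2" for u v
    proof -
      have [measurable]: "(\<lambda>lam. L2_inner (F lam u) v) \<in> borel_measurable borel"
        using FL that by (simp add: L2_fields_def)
      have "L2_inner (\<lambda>\<xi>. cis (2 * pi * lam * s) * F lam u \<xi>) v = cis (2 * pi * lam * s) * L2_inner (F lam u) v" for lam
        by (simp add: L2_inner_eq ip_scale_left)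
      then show ?thesis by simp
    qed
    moreover have "field_normsq (\<lambda>lam u \<xi>. cis (2 * pi * lam * s) * F lam u \<xi>) = field_normsq F"
      by (simp add: field_normsq_def HS_normsq_def L2_normsq_def norm_mult)
    ultimately show ?thesis using FL by (simp add: L2_fields_def)
  qed
  with h lim lim2 show ?thesis
    unfolding is_fourier_def L2_eq_sqint L2_tendsto_eq by blast
qed

lemma heis_mult_assoc: "heis_mult (heis_mult g h) k = heis_mult g (heis_mult h k)"
  by (cases g; cases h; cases k)
     (simp add: heis_mult_def inner_add_left inner_add_right field_simps)

lemma heis_inv_heis_mult: "heis_inv (heis_mult g h) = heis_mult (heis_inv h) (heis_inv g)"
  by (cases g; cases h) (simp add: heis_mult_def heis_inv_def field_simps inner_commute)

lemma left_transl_mult: "left_transl g (left_transl h f) = left_transl (heis_mult g h) f"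
  by (simp add: fun_eq_iff left_transl_def heis_inv_heis_mult heis_mult_assoc)

lemma borel_measurable_heis_mult [measurable]:
  "heis_mult h \<in> borel_measurable (borel :: 'n::finite heis measure)"
  unfolding heis_mult_def split_beta' by measurable

text \<open>Left translations are shears in the last variable followed by Euclidean translations.\<close>

lemma distr_heis_mult: "distr lborel borel (heis_mult h) = (lborel :: 'n::finite heis measure)"
proof (rule measure_eqI)
  fix A :: "'n heis set" assume "A \<in> sets (distr lborel borel (heis_mult h))"
  then have A [measurable]: "A \<in> sets borel" by simp
  obtain a b c where h: "h = (a, b, c)" by (cases h)
  define g where "g = (indicator A :: 'n heis \<Rightarrow> ennreal)"
  have [measurable]: "g \<in> borel_measurable borel" unfolding g_def by measurable
  have "emeasure (distr lborel borel (heis_mult h)) A = (\<integral>\<^sup>+p. g p \<partial>distr lborel borel (heis_mult h))"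
    by (simp add: g_def)
  also have "\<dots> = (\<integral>\<^sup>+X. g (heis_mult h X) \<partial>lborel)"
    by (subst nn_integral_distr) auto
  also have "\<dots> = (\<integral>\<^sup>+x. \<integral>\<^sup>+y. \<integral>\<^sup>+t. g (x + a, y + b, t + (c + (x \<bullet> b - y \<bullet> a) / 2)) \<partial>lborel \<partial>lborel \<partial>lborel)"
    by (subst nn_integral_lborel_pair, measurable, subst nn_integral_lborel_pair, measurable)
       (simp add: h heis_mult_def ac_simps)
  also have "\<dots> = (\<integral>\<^sup>+x. \<integral>\<^sup>+y. \<integral>\<^sup>+t. g (x + a, y + b, t) \<partial>lborel \<partial>lborel \<partial>lborel)"
    using nn_integral_lborel_translate[of "\<lambda>t. g (_, _, t)"] by simp
  also have "\<dots> = (\<integral>\<^sup>+x. \<integral>\<^sup>+y. \<integral>\<^sup>+t. g (x + a, y, t) \<partial>lborel \<partial>lborel \<partial>lborel)"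
    using nn_integral_lborel_translate[of "\<lambda>y. \<integral>\<^sup>+t. g (_, y, t) \<partial>lborel" b] by simp
  also have "\<dots> = (\<integral>\<^sup>+x. \<integral>\<^sup>+y. \<integral>\<^sup>+t. g (x, y, t) \<partial>lborel \<partial>lborel \<partial>lborel)"
    by (rule nn_integral_lborel_translate) measurable
  also have "\<dots> = (\<integral>\<^sup>+p. g p \<partial>lborel)"
    by (simp add: nn_integral_lborel_pair)
  finally show "emeasure (distr lborel borel (heis_mult h)) A = emeasure lborel A"
    by (simp add: g_def)
qed simp

lemma left_transl_isometry:
  fixes f g :: "'n::finite heis \<Rightarrow> complex"
  assumes f: "f \<in> sqint lborel" and g: "g \<in> sqint lborel"
  shows "left_transl h f \<in> sqint lborel" "ip lborel (left_transl h f) (left_transl h g) = ip lborel f g"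
proof -
  have [measurable]: "f \<in> borel_measurable borel" "g \<in> borel_measurable borel"
    using sqintD(1)[OF f] sqintD(1)[OF g] by simp_all
  have eq: "left_transl h k = (\<lambda>X. k (heis_mult (heis_inv h) X))" for k :: "'n heis \<Rightarrow> complex"
    by (simp add: fun_eq_iff left_transl_def)
  have "normsq lborel f = normsq lborel (left_transl h f)"
    unfolding normsq_def eq by (subst distr_heis_mult[of "heis_inv h", symmetric], subst nn_integral_distr) auto
  then show "left_transl h f \<in> sqint lborel"
    using sqintD(2)[OF f] by (intro sqintI) (simp_all add: eq)
  have "ip lborel f g = ip lborel (left_transl h f) (left_transl h g)"
    unfolding ip_def eq by (subst distr_heis_mult[of "heis_inv h", symmetric], subst integral_distr) auto
  then show "ip lborel (left_transl h f) (left_transl h g) = ip lborel f g" by simp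
qed

section \<open>Periodization\<close>

definition periodize :: "(real \<Rightarrow> complex) \<Rightarrow> real \<Rightarrow> complex" where
  "periodize q lam = (LINT r|count_space (UNIV :: int set). q (lam + of_int r))"

lemma indicator_Ioc_int: "(indicator {of_int r<..of_int r + 1} x :: real) = indicator {\<lceil>x\<rceil> - 1} r"
proof -
  have "x \<in> {of_int r<..of_int r + 1} \<longleftrightarrow> \<lceil>x\<rceil> = r + 1" by (simp add: ceiling_eq_iff)
  then show ?thesis by (auto simp: indicator_def)
qed

text \<open>The translates of the unit interval by integers tile the line, so the integral over the
  line folds onto the interval.\<close>

lemma periodize_integral:
  assumes q: "integrable lborel q"
  shows "integrable lborel (\<lambda>lam. indicator {0<..1} lam *\<^sub>R periodize q lam)"
    and "(LINT lam|lborel. indicator {0<..1} lam *\<^sub>R periodize q lam) = (LINT lam|lborel. q lam)"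
    and "AE lam in lborel. lam \<in> {0<..1} \<longrightarrow> (\<Sum>\<^sub>\<infinity>r::int. q (lam + of_int r)) = periodize q lam"
proof -
  let ?C = "count_space (UNIV :: int set)"
  interpret pair_sigma_finite lborel ?C
    by (intro pair_sigma_finite.intro sigma_finite_lborel sigma_finite_measure_count_space)
  have qm [measurable]: "q \<in> borel_measurable borel" using q by auto
  have meas: "k \<in> borel_measurable (lborel \<Otimes>\<^sub>M ?C)"
    if "\<And>r. (\<lambda>lam. k (lam, r)) \<in> borel_measurable borel" for k :: "real \<times> int \<Rightarrow> complex"
  proof -
    have "(\<lambda>z. k (fst z, r)) \<in> borel_measurable (lborel \<Otimes>\<^sub>M ?C)" for r
      using that[of r] by (intro measurable_compose[OF measurable_fst]) simp
    from measurable_compose_countable[of "\<lambda>r z. k (fst z, r)", OF this measurable_snd]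
    show ?thesis by simp
  qed
  \<comment> \<open>\<open>h\<close> and \<open>h'\<close> differ by a shift of \<open>lam\<close> by \<open>r\<close>; each \<open>lam\<close> meets one tile in \<open>h'\<close>.\<close>
  define h where "h = (\<lambda>(lam, r::int). indicator {0<..1} lam *\<^sub>R q (lam + of_int r))"
  define h' where "h' = (\<lambda>(lam, r::int). indicator {of_int r<..of_int r + 1} lam *\<^sub>R q lam)"
  have hm: "h \<in> borel_measurable (lborel \<Otimes>\<^sub>M ?C)" and h'm: "h' \<in> borel_measurable (lborel \<Otimes>\<^sub>M ?C)"
    unfolding h_def h'_def by (intro meas; simp)+
  have shift: "h' (lam + of_int r, r) = h (lam, r)" for lam r
    by (auto simp: h_def h'_def split: split_indicator)
  have row: "h' (lam, r) = indicator {\<lceil>lam\<rceil> - 1} r *\<^sub>R q lam" for lam r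
    by (simp add: h'_def indicator_Ioc_int)
  have h': "integrable (lborel \<Otimes>\<^sub>M ?C) h'"
  proof (rule integrableI_bounded[OF h'm])
    have "(\<integral>\<^sup>+z. ennreal (norm (h' z)) \<partial>(lborel \<Otimes>\<^sub>M ?C)) = (\<integral>\<^sup>+lam. \<integral>\<^sup>+r. ennreal (norm (h' (lam, r))) \<partial>?C \<partial>lborel)"
      by (rule M2.nn_integral_fst[symmetric]) (use h'm in measurable)
    also have "\<dots> = (\<integral>\<^sup>+lam. ennreal (norm (q lam)) \<partial>lborel)"
    proof (rule nn_integral_cong)
      fix lam
      have "(\<integral>\<^sup>+r. ennreal (norm (h' (lam, r))) \<partial>?C) = (\<integral>\<^sup>+r. ennreal (norm (q lam)) * indicator {\<lceil>lam\<rceil> - 1} r \<partial>?C)"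
        by (intro nn_integral_cong) (auto simp: row split: split_indicator)
      then show "(\<integral>\<^sup>+r. ennreal (norm (h' (lam, r))) \<partial>?C) = ennreal (norm (q lam))"
        by (simp add: nn_integral_cmult_indicator)
    qed
    finally show "(\<integral>\<^sup>+z. ennreal (norm (h' z)) \<partial>(lborel \<Otimes>\<^sub>M ?C)) < \<infinity>"
      using q by (simp add: integrable_iff_bounded)
  qed
  have h: "integrable (lborel \<Otimes>\<^sub>M ?C) h"
  proof (rule integrableI_bounded[OF hm])
    have "(\<integral>\<^sup>+z. ennreal (norm (h z)) \<partial>(lborel \<Otimes>\<^sub>M ?C)) = (\<integral>\<^sup>+r. \<integral>\<^sup>+lam. ennreal (norm (h (lam, r))) \<partial>lborel \<partial>?C)"
      by (rule nn_integral_snd[symmetric]) (use hm in measurable)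
    also have "\<dots> = (\<integral>\<^sup>+r. \<integral>\<^sup>+lam. ennreal (norm (h' (lam, r))) \<partial>lborel \<partial>?C)"
    proof (rule nn_integral_cong)
      fix r :: int
      have "(\<lambda>lam. ennreal (norm (h' (lam, r)))) \<in> borel_measurable borel" unfolding h'_def by simp
      from nn_integral_lborel_translate[OF this, of "of_int r"]
      show "(\<integral>\<^sup>+lam. ennreal (norm (h (lam, r))) \<partial>lborel) = (\<integral>\<^sup>+lam. ennreal (norm (h' (lam, r))) \<partial>lborel)"
        by (simp add: shift)
    qed
    also have "\<dots> = (\<integral>\<^sup>+z. ennreal (norm (h' z)) \<partial>(lborel \<Otimes>\<^sub>M ?C))"
      by (rule nn_integral_snd) (use h'm in measurable)
    finally show "(\<integral>\<^sup>+z. ennreal (norm (h z)) \<partial>(lborel \<Otimes>\<^sub>M ?C)) < \<infinity>"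
      using h' by (simp add: integrable_iff_bounded)
  qed
  have per: "(LINT r|?C. h (lam, r)) = indicator {0<..1} lam *\<^sub>R periodize q lam" for lam
    by (simp add: h_def periodize_def split: split_indicator)
  show "integrable lborel (\<lambda>lam. indicator {0<..1} lam *\<^sub>R periodize q lam)"
    using integrable_fst'[OF h] by (simp add: per)
  have "(LINT lam|lborel. indicator {0<..1} lam *\<^sub>R periodize q lam) = (LINT lam|lborel. LINT r|?C. h (lam, r))"
    by (simp add: per)
  also have "\<dots> = (LINT r|?C. LINT lam|lborel. h (lam, r))"
    using Fubini_integral[of "\<lambda>lam r. h (lam, r)"] h by simp
  also have "\<dots> = (LINT r|?C. LINT lam|lborel. h' (lam, r))"
  proof (rule Bochner_Integration.integral_cong[OF refl])
    fix r :: int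
    have "(\<lambda>lam. h' (lam, r)) \<in> borel_measurable borel" unfolding h'_def by simp
    from integral_lborel_translate[OF this, of "of_int r"]
    show "(LINT lam|lborel. h (lam, r)) = (LINT lam|lborel. h' (lam, r))" by (simp add: shift)
  qed
  also have "\<dots> = (LINT lam|lborel. LINT r|?C. h' (lam, r))"
    using Fubini_integral[of "\<lambda>lam r. h' (lam, r)"] h' by simp
  also have "\<dots> = (LINT lam|lborel. q lam)"
    by (simp add: row)
  finally show "(LINT lam|lborel. indicator {0<..1} lam *\<^sub>R periodize q lam) = (LINT lam|lborel. q lam)" .
  have "AE lam in lborel. integrable ?C (\<lambda>r. h (lam, r))"
    by (rule AE_integrable_fst'[OF h])
  then show "AE lam in lborel. lam \<in> {0<..1} \<longrightarrow> (\<Sum>\<^sub>\<infinity>r::int. q (lam + of_int r)) = periodize q lam"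
  proof eventually_elim
    fix lam assume i: "integrable ?C (\<lambda>r. h (lam, r))"
    show "lam \<in> {0<..1} \<longrightarrow> (\<Sum>\<^sub>\<infinity>r::int. q (lam + of_int r)) = periodize q lam"
    proof
      assume "lam \<in> {0<..1}"
      then have "integrable ?C (\<lambda>r. q (lam + of_int r))" using i by (simp add: h_def)
      then show "(\<Sum>\<^sub>\<infinity>r::int. q (lam + of_int r)) = periodize q lam"
        unfolding periodize_def
        by (subst infsetsum_infsum[symmetric]) (simp_all add: abs_summable_on_def infsetsum_def)
    qed
  qed
qed

section \<open>Inner products of translates as Fourier coefficients\<close>

text \<open>Multiplying the transform by \<open>cis (2 \<pi> \<lambda> m)\<close> does not disturb the periodization for
  integral \<open>m\<close>, so the inner products with the translates \<open>(2k, l, m)\<close> are the Fourier coefficients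
  of \<open>G \<phi> k l\<close>.\<close>

theorem ip_translate_eq_Fourier_coeff:
  fixes \<phi> :: "'n::finite heis \<Rightarrow> complex"
  assumes \<phi>: "\<phi> \<in> sqint lborel"
  obtains Q where "integrable lborel (\<lambda>lam. indicator {0<..1} lam *\<^sub>R Q lam)"
    "AE lam in lborel. lam \<in> {0<..1} \<longrightarrow> G \<phi> k l lam = Q lam"
    "\<And>m::int. ip lborel \<phi> (left_transl (2 *\<^sub>R lattice_vec k, lattice_vec l, of_int m) \<phi>) =
      (LINT lam|lborel. indicator {0<..1} lam *\<^sub>R (cis (- (2 * pi * lam * of_int m)) * Q lam))"
proof -
  define \<psi> where "\<psi> = left_transl (2 *\<^sub>R lattice_vec k, lattice_vec l, 0) \<phi>"
  define F where "F = fourier \<phi>"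
  define H where "H = fourier \<psi>"
  have \<psi>: "\<psi> \<in> sqint lborel" unfolding \<psi>_def by (rule left_transl_isometry(1)[OF \<phi> \<phi>])
  have F: "is_fourier \<phi> F" and H: "is_fourier \<psi> H"
    unfolding F_def H_def by (intro is_fourier_fourier \<phi> \<psi>)+
  obtain a where a: "has_matrix F a" "a \<in> sqint (matrix_measure TYPE('n))"
    using F by (auto simp: is_fourier_def elim: L2_fields_has_matrix)
  obtain b where b: "has_matrix H b" "b \<in> sqint (matrix_measure TYPE('n))"
    using H by (auto simp: is_fourier_def elim: L2_fields_has_matrix)
  obtain p where p: "integrable lborel p"
    "AE lam in lborel. HS_inner (F lam) (H lam) * of_real (\<bar>lam\<bar> ^ CARD('n)) = p lam"
    using has_matrix_HS_inner[OF a b] by blast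
  have coeff: "ip lborel \<phi> (left_transl (2 *\<^sub>R lattice_vec k, lattice_vec l, of_int m) \<phi>) =
      (LINT lam|lborel. cis (- (2 * pi * lam * of_int m)) * p lam)" for m :: int
  proof -
    define \<psi>' where "\<psi>' = left_transl (0, 0, of_int m) \<psi>"
    define H' where "H' lam u \<xi> = cis (2 * pi * lam * of_int m) * H lam u \<xi>" for lam u \<xi>
    have \<psi>': "\<psi>' \<in> sqint lborel" unfolding \<psi>'_def by (rule left_transl_isometry(1)[OF \<psi> \<psi>])
    have eq: "\<psi>' = left_transl (2 *\<^sub>R lattice_vec k, lattice_vec l, of_int m) \<phi>"
      unfolding \<psi>'_def \<psi>_def left_transl_mult by (simp add: heis_mult_def)
    have H': "is_fourier \<psi>' H'"
      unfolding \<psi>'_def H'_def[abs_def] by (rule is_fourier_central[OF H \<psi>])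
    obtain b' where b': "has_matrix H' b'" "b' \<in> sqint (matrix_measure TYPE('n))"
      using H' by (auto simp: is_fourier_def elim: L2_fields_has_matrix)
    obtain p' where p': "integrable lborel p'"
      "AE lam in lborel. HS_inner (F lam) (H' lam) * of_real (\<bar>lam\<bar> ^ CARD('n)) = p' lam"
      "(LINT lam|lborel. p' lam) = ip (matrix_measure TYPE('n)) a b'"
      using has_matrix_HS_inner[OF a b'] by blast
    have HS: "HS_inner (F lam) (H' lam) = cis (- (2 * pi * lam * of_int m)) * HS_inner (F lam) (H lam)" for lam
      unfolding HS_inner_def H'_def L2_inner_eq ip_scale_right
      by (subst infsum_cmult_right') (simp add: cis_cnj)
    have "AE lam in lborel. p' lam = cis (- (2 * pi * lam * of_int m)) * p lam"
      using p(2) p'(2) by eventually_elim (simp add: HS mult.assoc)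
    then have "(LINT lam|lborel. p' lam) = (LINT lam|lborel. cis (- (2 * pi * lam * of_int m)) * p lam)"
      using p(1) p'(1) by (intro integral_cong_AE) auto
    moreover have "ip (matrix_measure TYPE('n)) a b' = ip lborel \<phi> \<psi>'"
      by (rule is_fourier_ip[OF \<phi> F \<psi>' H' a b'])
    ultimately show ?thesis using p'(3) eq by simp
  qed
  show thesis
  proof (rule that)
    show "integrable lborel (\<lambda>lam. indicator {0<..1} lam *\<^sub>R periodize p lam)"
      by (rule periodize_integral(1)[OF p(1)])
    have shift: "AE lam in lborel. HS_inner (F (lam + of_int r)) (H (lam + of_int r)) * of_real (\<bar>lam + of_int r\<bar> ^ CARD('n)) = p (lam + of_int r)"
      for r :: int
    proof -
      have "AE lam in distr lborel borel ((+) (of_int r)). HS_inner (F lam) (H lam) * of_real (\<bar>lam\<bar> ^ CARD('n)) = p lam"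
        unfolding lborel_distr_plus by (rule p(2))
      then have "AE lam in lborel. HS_inner (F (of_int r + lam)) (H (of_int r + lam)) * of_real (\<bar>of_int r + lam\<bar> ^ CARD('n)) = p (of_int r + lam)"
        by (rule AE_distrD[rotated]) simp
      then show ?thesis by (simp add: add.commute)
    qed
    have "AE lam in lborel. \<forall>r::int. HS_inner (F (lam + of_int r)) (H (lam + of_int r)) * of_real (\<bar>lam + of_int r\<bar> ^ CARD('n)) = p (lam + of_int r)"
      by (subst AE_all_countable) (blast intro: shift)
    then show "AE lam in lborel. lam \<in> {0<..1} \<longrightarrow> G \<phi> k l lam = periodize p lam"
      using periodize_integral(3)[OF p(1)]
      by eventually_elim (simp add: G_def F_def H_def \<psi>_def)
    fix m :: int
    let ?q = "\<lambda>lam. cis (- (2 * pi * lam * of_int m)) * p lam"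
    have q: "integrable lborel ?q"
      by (rule Bochner_Integration.integrable_bound[OF p(1)]) (use p(1) in \<open>auto simp: norm_mult\<close>)
    have "cis (- (2 * pi * (lam + of_int r) * of_int m)) = cis (- (2 * pi * lam * of_int m))" for lam and r :: int
    proof -
      have "- (2 * pi * (lam + of_int r) * of_int m) = - (2 * pi * lam * of_int m) + 2 * pi * of_int (- (r * m))"
        by (simp add: algebra_simps)
      moreover have "cis (2 * pi * of_int (- (r * m))) = 1" by (rule cis_multiple_2pi) simp
      ultimately show ?thesis by (metis cis_mult mult.right_neutral)
    qed
    then have "periodize ?q lam = cis (- (2 * pi * lam * of_int m)) * periodize p lam" for lam
      by (simp add: periodize_def)
    then show "ip lborel \<phi> (left_transl (2 *\<^sub>R lattice_vec k, lattice_vec l, of_int m) \<phi>) =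
      (LINT lam|lborel. indicator {0<..1} lam *\<^sub>R (cis (- (2 * pi * lam * of_int m)) * periodize p lam))"
      using periodize_integral(2)[OF q] coeff[of m] by simp
  qed
qed

section \<open>Linear independence of the translates\<close>

definition lattice_point :: "'n::finite lattice \<Rightarrow> 'n heis" where
  "lattice_point = (\<lambda>(k, l, m). (2 *\<^sub>R lattice_vec k, lattice_vec l, of_int m))"

lemma inner_lattice_vec:
  "lattice_vec k \<bullet> lattice_vec l = of_int (\<Sum>i\<in>UNIV. k $ i * l $ i)"
  by (simp add: lattice_vec_def inner_vec_def)

lemma lattice_vec_diff: "lattice_vec (k - l) = lattice_vec k - lattice_vec l"
  by (simp add: lattice_vec_def vec_eq_iff)

text \<open>The factor \<open>2\<close> in the first component cancels the \<open>1 / 2\<close> of the group law, so that \<open>s\<close>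
  is an integer.\<close>

lemma lattice_point_quotient:
  obtains s where "heis_mult (heis_inv (lattice_point (k, l, m))) (lattice_point (k', l', m')) =
    lattice_point (k' - k, l' - l, m' - m + s)" "(k, l) = (k', l') \<Longrightarrow> s = 0"
proof
  let ?s = "(\<Sum>i\<in>UNIV. k $ i * l' $ i) - (\<Sum>i\<in>UNIV. k' $ i * l $ i)"
  show "heis_mult (heis_inv (lattice_point (k, l, m))) (lattice_point (k', l', m')) =
    lattice_point (k' - k, l' - l, m' - m + ?s)"
    by (simp add: lattice_point_def heis_mult_def heis_inv_def lattice_vec_diff inner_lattice_vec
        scaleR_diff_right inner_commute)
  show "?s = 0" if "(k, l) = (k', l')" using that by simp
qed

lemma ip_lattice_translates:
  fixes \<phi> :: "'n::finite heis \<Rightarrow> complex"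
  assumes \<phi>: "\<phi> \<in> sqint lborel"
  obtains s where "ip lborel (left_transl (lattice_point (k, l, m)) \<phi>) (left_transl (lattice_point (k', l', m')) \<phi>) =
      ip lborel \<phi> (left_transl (lattice_point (k' - k, l' - l, m' - m + s)) \<phi>)"
    "(k, l) = (k', l') \<Longrightarrow> s = 0"
proof -
  let ?g = "lattice_point (k, l, m)" and ?h = "lattice_point (k', l', m')"
  obtain s where s: "heis_mult (heis_inv ?g) ?h = lattice_point (k' - k, l' - l, m' - m + s)"
    "(k, l) = (k', l') \<Longrightarrow> s = 0"
    by (rule lattice_point_quotient) blast
  have "left_transl ?g (left_transl (heis_mult (heis_inv ?g) ?h) \<phi>) = left_transl ?h \<phi>"
  proof -
    have "heis_mult ?g (heis_mult (heis_inv ?g) ?h) = heis_mult (0, 0, 0) ?h"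
      by (simp add: heis_mult_inv flip: heis_mult_assoc)
    also have "\<dots> = ?h" by (cases ?h) (simp add: heis_mult_def)
    finally show ?thesis by (simp add: left_transl_mult)
  qed
  then have "ip lborel (left_transl ?g \<phi>) (left_transl ?h \<phi>) =
      ip lborel (left_transl ?g \<phi>) (left_transl ?g (left_transl (heis_mult (heis_inv ?g) ?h) \<phi>))"
    by simp
  also have "\<dots> = ip lborel \<phi> (left_transl (heis_mult (heis_inv ?g) ?h) \<phi>)"
    by (intro left_transl_isometry(2) left_transl_isometry(1)[OF \<phi> \<phi>] \<phi>)
  finally have eq: "ip lborel (left_transl ?g \<phi>) (left_transl ?h \<phi>) =
      ip lborel \<phi> (left_transl (heis_mult (heis_inv ?g) ?h) \<phi>)" .
  show thesis by (rule that[OF eq[unfolded s(1)] s(2)])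
qed

subsection \<open>Trigonometric polynomials on the unit interval\<close>

definition trig :: "int \<Rightarrow> real \<Rightarrow> complex" where
  "trig m lam = indicator {0<..1} lam * cis (2 * pi * lam * of_int m)"

lemma integral_Ioc_cis:
  "(LINT lam|lborel. indicator {0<..1} lam *\<^sub>R cis (2 * pi * lam * of_int d)) = (if d = 0 then 1 else 0)"
proof (cases "d = 0")
  case True
  then show ?thesis by simp
next
  case False
  define F where "F x = cis (2 * pi * x * of_int d) / (2 * pi * of_int d * \<i>)" for x
  have "(LINT lam|lborel. indicator {0..1} lam *\<^sub>R cis (2 * pi * lam * of_int d)) = F 1 - F 0"
  proof (rule integral_FTC_Icc)
    fix x :: real
    let ?a = "\<i> * of_real (2 * pi * of_int d)"
    have "((\<lambda>z. exp (?a * z) / ?a) has_field_derivative exp (?a * of_real x)) (at (of_real x))"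
      using False by (auto intro!: derivative_eq_intros)
    from has_vector_derivative_real_field[OF this]
    have "((\<lambda>x. exp (?a * of_real x) / ?a) has_vector_derivative exp (?a * of_real x)) (at x within {0..1})" .
    moreover have e: "exp (?a * of_real x) = cis (2 * pi * x * of_int d)" for x
      by (simp add: cis_conv_exp ac_simps)
    moreover have "(\<lambda>x. exp (?a * of_real x) / ?a) = F"
      unfolding e F_def by (simp add: fun_eq_iff ac_simps)
    ultimately show "(F has_vector_derivative cis (2 * pi * x * of_int d)) (at x within {0..1})"
      by metis
  qed (auto intro!: continuous_intros)
  moreover have "F 1 = F 0"
    using cis_multiple_2pi[of "of_int d"] by (simp add: F_def)
  moreover have "(LINT lam|lborel. indicator {0<..1} lam *\<^sub>R cis (2 * pi * lam * of_int d)) =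
      (LINT lam|lborel. indicator {0..1} lam *\<^sub>R cis (2 * pi * lam * of_int d))"
  proof (rule integral_cong_AE)
    have "AE lam in lborel. lam \<noteq> (0::real)" by (rule AE_lborel_singleton)
    then show "AE lam in lborel. indicator {0<..1} lam *\<^sub>R cis (2 * pi * lam * of_int d) =
        indicator {0..1} lam *\<^sub>R cis (2 * pi * lam * of_int d)"
      by eventually_elim (auto split: split_indicator)
  qed auto
  ultimately show ?thesis using False by simp
qed

lemma orthonormal_trig: "orthonormal_on lborel trig"
  unfolding orthonormal_on_def
proof (intro conjI allI)
  fix i j
  show "trig i \<in> sqint lborel"
  proof (rule sqintI)
    show "trig i \<in> borel_measurable lborel" unfolding trig_def[abs_def] by measurable
    have "normsq lborel (trig i) = (\<integral>\<^sup>+lam. indicator {0<..1} (lam::real) \<partial>lborel)"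
      unfolding normsq_def by (intro nn_integral_cong) (auto simp: trig_def norm_mult split: split_indicator)
    then show "normsq lborel (trig i) < \<infinity>" by simp
  qed
  have "trig i lam * cnj (trig j lam) = indicator {0<..1} lam *\<^sub>R cis (2 * pi * lam * of_int (i - j))" for lam
    by (auto simp: trig_def cis_cnj cis_mult algebra_simps split: split_indicator)
  then show "ip lborel (trig i) (trig j) = (if i = j then 1 else 0)"
    using integral_Ioc_cis[of "i - j"] by (simp add: ip_def)
qed

text \<open>The polynomials with coefficients \<open>c\<close> converge in \<open>L\<^sup>2\<close> to some \<open>h\<close> with Fourier coefficients \<open>c\<close>.  With the
  bounded weight \<open>min w 1\<close> in place of \<open>w\<close>, the weighted norm of \<open>h\<close> is the limit of those of the
  polynomials, hence \<open>0\<close>.\<close>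

lemma weighted_trig_series_zero:
  fixes c :: "int \<Rightarrow> complex"
  assumes c: "convergent (\<lambda>N. \<Sum>m\<in>{- int N..int N}. (cmod (c m))\<^sup>2)"
    and wm: "(\<lambda>lam. indicator {0<..1} lam * w lam) \<in> borel_measurable borel"
    and w: "AE lam in lborel. lam \<in> {0<..1} \<longrightarrow> (0::real) < w lam"
    and lim: "(\<lambda>N. \<integral>\<^sup>+lam. ennreal (indicator {0<..1} lam * ((cmod (\<Sum>m\<in>{- int N..int N}. c m * trig m lam))\<^sup>2 * w lam)) \<partial>lborel) \<longlonglongrightarrow> 0"
  shows "c m = 0"
proof -
  define P where "P N lam = (\<Sum>m\<in>{- int N..int N}. c m * trig m lam)" for N lam
  have UN: "(\<Union>N. {- int N..int N}) = UNIV"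
  proof -
    have "m \<in> {- int (nat \<bar>m\<bar>)..int (nat \<bar>m\<bar>)}" for m by auto
    then show ?thesis by blast
  qed
  obtain h where h: "h \<in> sqint lborel" "sq_tendsto lborel P h" "\<And>m. ip lborel h (trig m) = c m"
    unfolding P_def[abs_def]
    by (rule orthonormal_series_exhaustion[OF orthonormal_trig _ _ UN c]) (auto simp: incseq_def)
  have Pm [measurable]: "P N \<in> borel_measurable borel" for N
    unfolding P_def[abs_def] trig_def by measurable
  have hm [measurable]: "h \<in> borel_measurable borel" using sqintD(1)[OF h(1)] by simp
  define v where "v lam = min (indicator {0<..1} lam * w lam) 1" for lam
  have vm [measurable]: "v \<in> borel_measurable borel" unfolding v_def[abs_def] using wm by measurable
  have v: "AE lam in lborel. 0 \<le> v lam \<and> v lam \<le> 1 \<and> v lam \<le> indicator {0<..1} lam * w lam \<and> (lam \<in> {0<..1} \<longrightarrow> 0 < v lam)"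
    using w by eventually_elim (auto simp: v_def split: split_indicator)
  have "(\<integral>\<^sup>+lam. ennreal ((cmod (h lam))\<^sup>2 * v lam) \<partial>lborel) \<le>
      2 * normsq lborel (\<lambda>lam. P N lam - h lam) +
      2 * (\<integral>\<^sup>+lam. ennreal (indicator {0<..1} lam * ((cmod (P N lam))\<^sup>2 * w lam)) \<partial>lborel)" for N
  proof -
    have iw: "indicator {0<..1} lam * ((cmod (P N lam))\<^sup>2 * w lam) = (cmod (P N lam))\<^sup>2 * (indicator {0<..1} lam * w lam)" for lam :: real
      by simp
    have m2: "(\<lambda>lam. indicator {0<..1} lam * ((cmod (P N lam))\<^sup>2 * w lam)) \<in> borel_measurable borel"
      unfolding iw using wm by measurable
    have "(\<integral>\<^sup>+lam. ennreal ((cmod (h lam))\<^sup>2 * v lam) \<partial>lborel) \<le>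
        (\<integral>\<^sup>+lam. 2 * ennreal ((cmod (P N lam - h lam))\<^sup>2) + 2 * ennreal (indicator {0<..1} lam * ((cmod (P N lam))\<^sup>2 * w lam)) \<partial>lborel)"
    proof (rule nn_integral_mono_AE, use v in eventually_elim)
      fix lam assume v: "0 \<le> v lam \<and> v lam \<le> 1 \<and> v lam \<le> indicator {0<..1} lam * w lam \<and> (lam \<in> {0<..1} \<longrightarrow> 0 < v lam)"
      have "(cmod (h lam))\<^sup>2 \<le> 2 * (cmod (P N lam - h lam))\<^sup>2 + 2 * (cmod (P N lam))\<^sup>2"
        using cmod_add_sq_le[of "h lam - P N lam" "P N lam"] by (simp add: norm_minus_commute)
      then have "(cmod (h lam))\<^sup>2 * v lam \<le> (2 * (cmod (P N lam - h lam))\<^sup>2 + 2 * (cmod (P N lam))\<^sup>2) * v lam"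
        using v by (intro mult_right_mono) auto
      also have "\<dots> = 2 * ((cmod (P N lam - h lam))\<^sup>2 * v lam) + 2 * ((cmod (P N lam))\<^sup>2 * v lam)"
        by (simp add: algebra_simps)
      also have "\<dots> \<le> 2 * ((cmod (P N lam - h lam))\<^sup>2 * 1) + 2 * ((cmod (P N lam))\<^sup>2 * (indicator {0<..1} lam * w lam))"
        using v by (intro add_mono mult_left_mono) auto
      finally have "(cmod (h lam))\<^sup>2 * v lam \<le> 2 * (cmod (P N lam - h lam))\<^sup>2 + 2 * (indicator {0<..1} lam * ((cmod (P N lam))\<^sup>2 * w lam))"
        by (simp only: iw mult_1_right)
      moreover have "0 \<le> indicator {0<..1} lam * ((cmod (P N lam))\<^sup>2 * w lam)"
      proof -
        have "0 \<le> indicator {0<..1} lam * w lam" using v by linarith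
        then show ?thesis unfolding iw by (rule mult_nonneg_nonneg[OF zero_le_power2])
      qed
      ultimately show "ennreal ((cmod (h lam))\<^sup>2 * v lam) \<le>
          2 * ennreal ((cmod (P N lam - h lam))\<^sup>2) + 2 * ennreal (indicator {0<..1} lam * ((cmod (P N lam))\<^sup>2 * w lam))"
        by (simp del: ennreal_numeral add: ennreal_leI flip: ennreal_mult ennreal_plus ennreal_numeral)
    qed
    also have "\<dots> = 2 * normsq lborel (\<lambda>lam. P N lam - h lam) +
      2 * (\<integral>\<^sup>+lam. ennreal (indicator {0<..1} lam * ((cmod (P N lam))\<^sup>2 * w lam)) \<partial>lborel)"
      using m2 by (simp add: nn_integral_add nn_integral_cmult normsq_def)
    finally show ?thesis .
  qed
  moreover have "(\<lambda>N. 2 * normsq lborel (\<lambda>lam. P N lam - h lam) +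
      2 * (\<integral>\<^sup>+lam. ennreal (indicator {0<..1} lam * ((cmod (P N lam))\<^sup>2 * w lam)) \<partial>lborel)) \<longlonglongrightarrow> 0"
    using tendsto_add[OF ennreal_tendsto_0_cmult ennreal_tendsto_0_cmult, OF h(2)[unfolded sq_tendsto_def] _ lim[folded P_def], of 2 2]
    by simp
  ultimately have "(\<integral>\<^sup>+lam. ennreal ((cmod (h lam))\<^sup>2 * v lam) \<partial>lborel) \<le> 0"
    by (intro tendsto_lowerbound[where F=sequentially]) auto
  then have "AE lam in lborel. ennreal ((cmod (h lam))\<^sup>2 * v lam) = 0"
    by (simp add: nn_integral_0_iff_AE)
  then have "AE lam in lborel. h lam * cnj (trig m lam) = 0"
    using v
  proof eventually_elim
    fix lam
    assume z: "ennreal ((cmod (h lam))\<^sup>2 * v lam) = 0"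
      and v: "0 \<le> v lam \<and> v lam \<le> 1 \<and> v lam \<le> indicator {0<..1} lam * w lam \<and> (lam \<in> {0<..1} \<longrightarrow> 0 < v lam)"
    show "h lam * cnj (trig m lam) = 0"
    proof (cases "lam \<in> {0<..1}")
      case True
      have le: "(cmod (h lam))\<^sup>2 * v lam \<le> 0" using z by (simp add: ennreal_eq_0_iff)
      have "h lam = 0"
      proof (rule ccontr)
        assume "h lam \<noteq> 0"
        then have "0 < (cmod (h lam))\<^sup>2 * v lam" using True v by (intro mult_pos_pos) auto
        with le show False by linarith
      qed
      then show ?thesis by simp
    qed (simp add: trig_def)
  qed
  then have "ip lborel h (trig m) = 0"
    unfolding ip_def by (rule integral_eq_zero_AE)
  then show ?thesis using h(3) by simp
qed

text \<open>By condition C, translates with different \<open>(k, l)\<close> are orthogonal.  So the part of a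
  vanishing combination that belongs to one pair \<open>(k, l)\<close> tends to \<open>0\<close> by itself, and its norm
  is that of a trigonometric polynomial with weight \<open>G \<phi> 0 0\<close>.\<close>

theorem theorem6p2:
  fixes \<phi> :: "'n::finite heis \<Rightarrow> complex"
  assumes "\<phi> \<in> L2"
    and "condition_C \<phi>"
    and "AE lam in lborel. lam \<in> {0<..1} \<longrightarrow> G \<phi> 0 0 lam \<in> \<real> \<and> Re (G \<phi> 0 0 lam) > 0"
  shows "l2_linearly_independent
    (\<lambda>(k, l, m). left_transl (2 *\<^sub>R lattice_vec k, lattice_vec l, of_int m) \<phi>)"
proof -
  have \<phi>: "\<phi> \<in> sqint lborel" using assms(1) by (simp add: L2_eq_sqint)
  define T where "T j = left_transl (lattice_point j) \<phi>" for j :: "'n lattice"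
  have T: "T j \<in> sqint lborel" for j
    unfolding T_def by (rule left_transl_isometry(1)[OF \<phi> \<phi>])
  have fam: "(\<lambda>(k, l, m). left_transl (2 *\<^sub>R lattice_vec k, lattice_vec l, of_int m) \<phi>) = T"
    by (auto simp: fun_eq_iff T_def lattice_point_def)
  have orth: "ip lborel (T (k, l, m)) (T (k', l', m')) = 0" if "(k, l) \<noteq> (k', l')" for k l m k' l' m'
  proof -
    obtain s where s: "ip lborel (T (k, l, m)) (T (k', l', m')) =
        ip lborel \<phi> (left_transl (lattice_point (k' - k, l' - l, m' - m + s)) \<phi>)"
      unfolding T_def by (rule ip_lattice_translates[OF \<phi>]) blast
    obtain Q where Q: "integrable lborel (\<lambda>lam. indicator {0<..1} lam *\<^sub>R Q lam)"
      "AE lam in lborel. lam \<in> {0<..1} \<longrightarrow> G \<phi> (k' - k) (l' - l) lam = Q lam"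
      "\<And>m::int. ip lborel \<phi> (left_transl (2 *\<^sub>R lattice_vec (k' - k), lattice_vec (l' - l), of_int m) \<phi>) =
        (LINT lam|lborel. indicator {0<..1} lam *\<^sub>R (cis (- (2 * pi * lam * of_int m)) * Q lam))"
      using ip_translate_eq_Fourier_coeff[OF \<phi>] by blast
    have "(k' - k, l' - l) \<noteq> (0, 0)" using that by auto
    then have "AE lam in lborel. lam \<in> {0<..1} \<longrightarrow> G \<phi> (k' - k) (l' - l) lam = 0"
      using assms(2) unfolding condition_C_def by blast
    then have "AE lam in lborel. indicator {0<..1} lam *\<^sub>R (cis (- (2 * pi * lam * of_int (m' - m + s))) * Q lam) = 0"
      using Q(2) by eventually_elim (auto split: split_indicator)
    then have "(LINT lam|lborel. indicator {0<..1} lam *\<^sub>R (cis (- (2 * pi * lam * of_int (m' - m + s))) * Q lam)) = 0"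
      by (rule integral_eq_zero_AE)
    then show ?thesis unfolding s lattice_point_def using Q(3)[of "m' - m + s"] by simp
  qed
  obtain Q where Q: "integrable lborel (\<lambda>lam. indicator {0<..1} lam *\<^sub>R Q lam)"
    "AE lam in lborel. lam \<in> {0<..1} \<longrightarrow> G \<phi> 0 0 lam = Q lam"
    "\<And>m::int. ip lborel \<phi> (left_transl (2 *\<^sub>R lattice_vec 0, lattice_vec 0, of_int m) \<phi>) =
      (LINT lam|lborel. indicator {0<..1} lam *\<^sub>R (cis (- (2 * pi * lam * of_int m)) * Q lam))"
    using ip_translate_eq_Fourier_coeff[OF \<phi>] by blast
  have Qpos: "AE lam in lborel. lam \<in> {0<..1} \<longrightarrow> Q lam = of_real (Re (Q lam)) \<and> Re (Q lam) > 0"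
    using assms(3) Q(2) by eventually_elim (auto simp: complex_is_Real_iff complex_eq_iff)
  have Tip: "ip lborel (T (k, l, m)) (T (k, l, m')) =
      (LINT lam|lborel. indicator {0<..1} lam *\<^sub>R (trig m lam * cnj (trig m' lam) * Q lam))" for k l m m'
  proof -
    obtain s where s: "ip lborel (T (k, l, m)) (T (k, l, m')) =
        ip lborel \<phi> (left_transl (lattice_point (k - k, l - l, m' - m + s)) \<phi>)" "s = 0"
      unfolding T_def by (rule ip_lattice_translates[OF \<phi>]) blast
    have e: "indicator {0<..1} lam *\<^sub>R (cis (- (2 * pi * lam * of_int (m' - m))) * Q lam) =
        indicator {0<..1} lam *\<^sub>R (trig m lam * cnj (trig m' lam) * Q lam)" for lam
      by (auto simp: trig_def cis_cnj cis_mult algebra_simps split: split_indicator)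
    have "ip lborel (T (k, l, m)) (T (k, l, m')) =
        (LINT lam|lborel. indicator {0<..1} lam *\<^sub>R (cis (- (2 * pi * lam * of_int (m' - m))) * Q lam))"
      unfolding s lattice_point_def using Q(3)[of "m' - m"] by simp
    then show ?thesis unfolding e .
  qed
  have False if c: "\<exists>j. c j \<noteq> 0" "(\<lambda>j. (cmod (c j))\<^sup>2) summable_on UNIV"
      "sq_tendsto lborel (\<lambda>N x. \<Sum>j\<in>cube N. c j * T j x) (\<lambda>x. 0)" for c :: "'n lattice \<Rightarrow> complex"
  proof -
    obtain k0 l0 m0 where nz: "c (k0, l0, m0) \<noteq> 0" using c(1) by (metis prod_cases3)
    \<comment> \<open>\<open>A N\<close> is the part of the partial sum over \<open>cube N\<close> that belongs to \<open>(k0, l0)\<close>.\<close>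
    define d where "d m = c (k0, l0, m)" for m
    define I where "I N = {- int N..int N}" for N
    define A where "A N x = (\<Sum>m\<in>I N. d m * T (k0, l0, m) x)" for N x
    have A: "A N \<in> sqint lborel" for N
      unfolding A_def[abs_def] by (intro sqint_sum sqint_scale T)
    obtain N0 where N0: "\<forall>i. \<bar>k0 $ i\<bar> \<le> int N0" "\<forall>i. \<bar>l0 $ i\<bar> \<le> int N0"
    proof -
      let ?S = "(\<Sum>i\<in>UNIV. \<bar>k0 $ i\<bar>) + (\<Sum>i\<in>UNIV. \<bar>l0 $ i\<bar>)"
      have nn: "0 \<le> (\<Sum>i\<in>UNIV. \<bar>k0 $ i\<bar>)" "0 \<le> (\<Sum>i\<in>UNIV. \<bar>l0 $ i\<bar>)" by (intro sum_nonneg; simp)+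
      have "\<bar>k0 $ i\<bar> \<le> (\<Sum>i\<in>UNIV. \<bar>k0 $ i\<bar>)" "\<bar>l0 $ i\<bar> \<le> (\<Sum>i\<in>UNIV. \<bar>l0 $ i\<bar>)" for i
        using member_le_sum[of i UNIV "\<lambda>i. \<bar>k0 $ i\<bar>"] member_le_sum[of i UNIV "\<lambda>i. \<bar>l0 $ i\<bar>"] by simp_all
      note le = this
      have S: "int (nat ?S) = ?S" using nn by simp
      have "\<bar>k0 $ i\<bar> \<le> int (nat ?S)" for i unfolding S using le(1)[of i] nn by linarith
      moreover have "\<bar>l0 $ i\<bar> \<le> int (nat ?S)" for i unfolding S using le(2)[of i] nn by linarith
      ultimately show thesis by (intro that[of "nat ?S"] allI)
    qed
    have part: "normsq lborel (A N) \<le> normsq lborel (\<lambda>x. (\<Sum>j\<in>cube N. c j * T j x) - 0)" if N: "N \<ge> N0" for N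
    proof -
      define J where "J = (\<lambda>m. (k0, l0, m)) ` I N"
      define B where "B x = (\<Sum>j\<in>cube N - J. c j * T j x)" for x
      have B: "B \<in> sqint lborel" unfolding B_def[abs_def] by (intro sqint_sum sqint_scale T)
      have J: "J \<subseteq> cube N"
      proof -
        have "int N0 \<le> int N" using N by simp
        then have "\<bar>k0 $ i\<bar> \<le> int N" "\<bar>l0 $ i\<bar> \<le> int N" for i
          using N0 order_trans by blast+
        then show ?thesis by (auto simp: J_def I_def cube_def)
      qed
      have sA: "(\<Sum>j\<in>J. c j * T j x) = A N x" for x
        unfolding J_def A_def d_def by (subst sum.reindex) (auto simp: inj_on_def)
      have S: "(\<Sum>j\<in>cube N. c j * T j x) = A N x + 1 * B x" for x
        using sum.subset_diff[OF J finite_cube, of "\<lambda>j. c j * T j x"] by (simp add: sA B_def)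
      have "ip lborel (T (k0, l0, m)) (T j) = 0" if "j \<in> cube N - J" for m j
      proof -
        obtain k l m' where j: "j = (k, l, m')" by (cases j)
        have "m' \<in> I N" using that by (auto simp: j cube_def I_def)
        then have "(k0, l0) \<noteq> (k, l)" using that by (auto simp: j J_def)
        then show ?thesis using orth by (simp add: j)
      qed
      then have "ip lborel (A N) B = 0"
        unfolding A_def[abs_def] B_def[abs_def]
        by (subst ip_sum_left) (auto intro!: sqint_scale sqint_sum T sum.neutral
              simp: ip_sum_right sqint_scale T ip_scale_left ip_scale_right)
      then have "Re (ip lborel (\<lambda>x. A N x + 1 * B x) (\<lambda>x. A N x + 1 * B x)) = Re (ip lborel (A N) (A N)) + Re (ip lborel B B)"
        using normsq_add_expand[OF A[of N] B, of 1] by simp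
      then show ?thesis
        unfolding S using A[of N] B sqint_add[OF A[of N] B] Re_ip_self_nonneg[of lborel B]
        by (simp add: normsq_eq_ip(2) ennreal_leI)
    qed
    have limA: "(\<lambda>N. normsq lborel (A N)) \<longlonglongrightarrow> 0"
    proof (rule tendsto_sandwich[OF _ _ tendsto_const])
      show "eventually (\<lambda>N. normsq lborel (A N) \<le> normsq lborel (\<lambda>x. (\<Sum>j\<in>cube N. c j * T j x) - 0)) sequentially"
        using part unfolding eventually_sequentially by blast
      show "(\<lambda>N. normsq lborel (\<lambda>x. (\<Sum>j\<in>cube N. c j * T j x) - 0)) \<longlonglongrightarrow> 0"
        using c(3) by (simp add: sq_tendsto_def)
    qed auto
    define P where "P N lam = (\<Sum>m\<in>I N. d m * trig m lam)" for N lam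
    have trigm [measurable]: "trig m \<in> borel_measurable borel" for m
      using sqintD(1)[OF orthonormal_on_D(1)[OF orthonormal_trig, of m]] by simp
    have tQ: "integrable lborel (\<lambda>lam. indicator {0<..1} lam *\<^sub>R (trig m lam * cnj (trig m' lam) * Q lam))" for m m'
    proof (rule Bochner_Integration.integrable_bound[OF Q(1)])
      have "(\<lambda>lam. (trig m lam * cnj (trig m' lam)) * (indicator {0<..1} lam *\<^sub>R Q lam)) \<in> borel_measurable lborel"
        using borel_measurable_integrable[OF Q(1)] by measurable
      then show "(\<lambda>lam. indicator {0<..1} lam *\<^sub>R (trig m lam * cnj (trig m' lam) * Q lam)) \<in> borel_measurable lborel"
        by (simp add: mult.left_commute)
    qed (auto simp: trig_def norm_mult split: split_indicator)
    have PP: "of_real ((cmod (P N lam))\<^sup>2) * q = (\<Sum>m\<in>I N. \<Sum>m'\<in>I N. (d m * cnj (d m')) * (trig m lam * cnj (trig m' lam) * q))"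
      for N lam q
      unfolding complex_norm_square P_def cnj_sum sum_product sum_distrib_right
      by (intro sum.cong refl) (simp add: sum_distrib_left ac_simps)
    have int: "integrable lborel (\<lambda>lam. indicator {0<..1} lam *\<^sub>R (of_real ((cmod (P N lam))\<^sup>2) * Q lam))"
      and ipA: "ip lborel (A N) (A N) = (LINT lam|lborel. indicator {0<..1} lam *\<^sub>R (of_real ((cmod (P N lam))\<^sup>2) * Q lam))" for N
    proof -
      have e: "indicator {0<..1} lam *\<^sub>R (of_real ((cmod (P N lam))\<^sup>2) * Q lam) =
        (\<Sum>m\<in>I N. \<Sum>m'\<in>I N. (d m * cnj (d m')) * (indicator {0<..1} lam *\<^sub>R (trig m lam * cnj (trig m' lam) * Q lam)))" for lam
        unfolding PP scaleR_sum_right by (intro sum.cong refl) simp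
      show "integrable lborel (\<lambda>lam. indicator {0<..1} lam *\<^sub>R (of_real ((cmod (P N lam))\<^sup>2) * Q lam))"
        unfolding e by (intro Bochner_Integration.integrable_sum integrable_mult_right tQ)
      have "ip lborel (A N) (A N) = (\<Sum>m\<in>I N. \<Sum>m'\<in>I N. (d m * cnj (d m')) * ip lborel (T (k0, l0, m)) (T (k0, l0, m')))"
        unfolding A_def[abs_def]
        by (subst ip_sum_left; (intro sqint_scale sqint_sum T)?)
           (simp add: ip_sum_right sqint_scale T ip_scale_left ip_scale_right sum_distrib_left mult.assoc)
      also have "\<dots> = (LINT lam|lborel. indicator {0<..1} lam *\<^sub>R (of_real ((cmod (P N lam))\<^sup>2) * Q lam))"
        unfolding e Tip
        by (subst Bochner_Integration.integral_sum, intro Bochner_Integration.integrable_sum integrable_mult_right tQ)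
           (subst Bochner_Integration.integral_sum, intro integrable_mult_right tQ,
            simp only: integral_mult_right_zero)
      finally show "ip lborel (A N) (A N) = (LINT lam|lborel. indicator {0<..1} lam *\<^sub>R (of_real ((cmod (P N lam))\<^sup>2) * Q lam))" .
    qed
    have weighted: "(\<integral>\<^sup>+lam. ennreal (indicator {0<..1} lam * ((cmod (P N lam))\<^sup>2 * Re (Q lam))) \<partial>lborel) = normsq lborel (A N)" for N
    proof -
      have Re: "Re (indicator {0<..1} lam *\<^sub>R (of_real ((cmod (P N lam))\<^sup>2) * Q lam)) =
        indicator {0<..1} lam * ((cmod (P N lam))\<^sup>2 * Re (Q lam))" for lam
        by (simp del: of_real_power)
      have "(\<integral>\<^sup>+lam. ennreal (indicator {0<..1} lam * ((cmod (P N lam))\<^sup>2 * Re (Q lam))) \<partial>lborel) =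
          ennreal (LINT lam|lborel. indicator {0<..1} lam * ((cmod (P N lam))\<^sup>2 * Re (Q lam)))"
      proof (rule nn_integral_eq_integral)
        show "integrable lborel (\<lambda>lam. indicator {0<..1} lam * ((cmod (P N lam))\<^sup>2 * Re (Q lam)))"
          using integrable_Re[OF int[of N]] unfolding Re .
        show "AE lam in lborel. 0 \<le> indicator {0<..1} lam * ((cmod (P N lam))\<^sup>2 * Re (Q lam))"
          using Qpos by eventually_elim (auto split: split_indicator)
      qed
      also have "(LINT lam|lborel. indicator {0<..1} lam * ((cmod (P N lam))\<^sup>2 * Re (Q lam))) = Re (ip lborel (A N) (A N))"
        unfolding ipA using integral_Re[OF int[of N]] unfolding Re by simp
      finally show ?thesis using normsq_eq_ip(2)[OF A] by simp
    qed
    have "d m0 = 0"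
    proof (rule weighted_trig_series_zero)
      have inj: "inj (\<lambda>m. (k0, l0, m))" by (simp add: inj_def)
      have "(\<lambda>j. (cmod (c j))\<^sup>2) summable_on range (\<lambda>m. (k0, l0, m))"
        by (rule summable_on_subset_banach[OF c(2)]) simp
      then have sd: "(\<lambda>m. (cmod (d m))\<^sup>2) summable_on UNIV"
        by (subst (asm) summable_on_reindex[OF inj]) (simp add: o_def d_def)
      show "convergent (\<lambda>N. \<Sum>m\<in>{- int N..int N}. (cmod (d m))\<^sup>2)"
      proof (rule Bseq_mono_convergent)
        have "(\<Sum>m\<in>{- int N..int N}. (cmod (d m))\<^sup>2) \<le> (\<Sum>\<^sub>\<infinity>m. (cmod (d m))\<^sup>2)" for N
          by (rule finite_sum_le_infsum[OF sd]) auto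
        then show "Bseq (\<lambda>N. \<Sum>m\<in>{- int N..int N}. (cmod (d m))\<^sup>2)"
          by (intro BseqI'[of _ "\<Sum>\<^sub>\<infinity>m. (cmod (d m))\<^sup>2"]) (simp add: sum_nonneg)
        show "\<forall>M N. M \<le> N \<longrightarrow> (\<Sum>m\<in>{- int M..int M}. (cmod (d m))\<^sup>2) \<le> (\<Sum>m\<in>{- int N..int N}. (cmod (d m))\<^sup>2)"
          by (intro allI impI sum_mono2) auto
      qed
      have "(\<lambda>lam. Re (indicator {0<..1} lam *\<^sub>R Q lam)) \<in> borel_measurable borel"
        using borel_measurable_integrable[OF Q(1)] by measurable
      then show "(\<lambda>lam. indicator {0<..1} lam * Re (Q lam)) \<in> borel_measurable borel" by simp
      show "AE lam in lborel. lam \<in> {0<..1} \<longrightarrow> 0 < Re (Q lam)"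
        using Qpos by eventually_elim auto
      show "(\<lambda>N. \<integral>\<^sup>+lam. ennreal (indicator {0<..1} lam * ((cmod (\<Sum>m\<in>{- int N..int N}. d m * trig m lam))\<^sup>2 * Re (Q lam))) \<partial>lborel) \<longlonglongrightarrow> 0"
        using limA weighted by (simp add: P_def I_def)
    qed
    then show False using nz by (simp add: d_def)
  qed
  then show ?thesis
    unfolding l2_linearly_independent_def l2_linearly_dependent_def L2_tendsto_eq fam by blast
qed

end
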